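(* Let $q=2^h$ with $h=2(2e+1)$, $e\ge 1$. Let $\pi\cong\mathrm{PG}(3,\sqrt{q})$ be a Baer subspace of $H_\infty=\mathrm{PG}(3,q)$ and let $\mathcal{K}$ be the set of points of a Tits ovoid in $\pi$ with one point removed. Then the graph $\Gamma_{3,q}(\mathcal{K})$ is semisymmetric. Moreover, the geometric automorphism group of $\Gamma_{3,q}(\mathcal{K})$ is isomorphic to $\mathrm{Persp}(H_\infty)\rtimes (\mathfrak{FH}\rtimes \mathrm{Aut}(\mathbb{F}_q))$ and has size $hq^5(q-1)(\sqrt{q}-1)$.
   Context: A Tits ovoid in $\mathrm{PG}(3,\sqrt q)$, $\sqrt q=2^{2e+1}$, is a point set projectively equivalent to $\{(1,s,t,st+s^{\sigma+2}+t^{\sigma})\mid s,t\in\mathbb{F}_{\sqrt q}\}\cup\{(0,0,0,1)\}$, where $\sigma:x\mapsto x^{2^{e+1}}$. Its stabiliser in $\mathrm{PGL}(4,\sqrt q)$ is the Suzuki group $\mathrm{Sz}(\sqrt q)$, acting 2-transitively on the points of the ovoid; $\mathfrak{FH}$ denotes the stabiliser in $\mathrm{Sz}(\sqrt q)$ of a point of the ovoid. Embed $H_\infty=\mathrm{PG}(3,q)$ as a hyperplane in $\mathrm{PG}(4,q)$. $\Gamma_{3,q}(\mathcal{K})$ is the bipartite graph whose vertex classes are the points of $\mathrm{PG}(4,q)\setminus H_\infty$ and the lines of $\mathrm{PG}(4,q)$ not contained in $H_\infty$ and passing through a point of $\mathcal{K}$; adjacency is incidence. A graph is semisymmetric if it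 is regular and edge-transitive but not vertex-transitive. The geometric automorphism group of $\Gamma_{3,q}(\mathcal{K})$ is the subgroup of its automorphism group consisting of the elements induced by collineations of $\mathrm{PG}(4,q)$. $\mathrm{Persp}(H_\infty)$ is the group of all collineations of $\mathrm{PG}(4,q)$ fixing every point of $H_\infty$. $N\rtimes H$ denotes a semidirect product with normal subgroup $N$. *)

theory Defs
  imports "HOL-Analysis.Cartesian_Space" "HOL-Library.Numeral_Type" "HOL-Algebra.Bij"
begin

section \<open>Semidirect products\<close>

definition semidirect_product ::
  "('a, 'm) monoid_scheme \<Rightarrow> ('b, 'n) monoid_scheme \<Rightarrow> ('b \<Rightarrow> 'a \<Rightarrow> 'a) \<Rightarrow> ('a \<times> 'b) monoid"
  where
  "semidirect_product N H \<theta> =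
     \<lparr>carrier = carrier N \<times> carrier H,
      mult = (\<lambda>(n, h) (n', h'). (n \<otimes>\<^bsub>N\<^esub> \<theta> h n', h \<otimes>\<^bsub>H\<^esub> h')),
      one = (\<one>\<^bsub>N\<^esub>, \<one>\<^bsub>H\<^esub>)\<rparr>"

section \<open>Simple graphs, given by a vertex set and a set of two-element edges\<close>

type_synonym 'v graph = "'v set \<times> 'v set set"

definition graph_automorphisms :: "'v graph \<Rightarrow> ('v \<Rightarrow> 'v) set" where
  "graph_automorphisms \<Gamma> =
     {f \<in> Bij (fst \<Gamma>). \<forall>u \<in> fst \<Gamma>. \<forall>v \<in> fst \<Gamma>. {u, v} \<in> snd \<Gamma> \<longleftrightarrow> {f u, f v} \<in> snd \<Gamma>}"

definition regular_graph :: "'v graph \<Rightarrow> bool" where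
  "regular_graph \<Gamma> \<longleftrightarrow>
     (\<exists>d. \<forall>v \<in> fst \<Gamma>. finite {e \<in> snd \<Gamma>. v \<in> e} \<and> card {e \<in> snd \<Gamma>. v \<in> e} = d)"

definition vertex_transitive :: "'v graph \<Rightarrow> bool" where
  "vertex_transitive \<Gamma> \<longleftrightarrow> (\<forall>u \<in> fst \<Gamma>. \<forall>v \<in> fst \<Gamma>. \<exists>f \<in> graph_automorphisms \<Gamma>. f u = v)"

definition edge_transitive :: "'v graph \<Rightarrow> bool" where
  "edge_transitive \<Gamma> \<longleftrightarrow> (\<forall>d \<in> snd \<Gamma>. \<forall>e \<in> snd \<Gamma>. \<exists>f \<in> graph_automorphisms \<Gamma>. f ` d = e)"

definition semisymmetric :: "'v graph \<Rightarrow> bool" where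
  "semisymmetric \<Gamma> \<longleftrightarrow> regular_graph \<Gamma> \<and> edge_transitive \<Gamma> \<and> \<not> vertex_transitive \<Gamma>"

section \<open>Projective spaces\<close>

text \<open>A subspace of projective dimension \<open>d\<close> is represented by the corresponding
  linear subspace, of dimension \<open>d + 1\<close>; incidence is inclusion.\<close>

definition pg_points :: "('a::field ^ 'n) set set" where
  "pg_points = {U. vec.subspace U \<and> vec.dim U = 1}"

definition pg_lines :: "('a::field ^ 'n) set set" where
  "pg_lines = {U. vec.subspace U \<and> vec.dim U = 2}"

definition pg_hyperplanes :: "('a::field ^ 'n) set set" where
  "pg_hyperplanes = {U. vec.subspace U \<and> vec.dim U = CARD('n) - 1}"

definition points_on :: "('a::field ^ 'n) set \<Rightarrow> ('a ^ 'n) set set" where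
  "points_on U = {p \<in> pg_points. p \<subseteq> U}"

text \<open>A collineation is a permutation of the points that also permutes the lines,
  these being regarded as sets of points.\<close>

definition collineations :: "(('a::field ^ 'n) set \<Rightarrow> ('a ^ 'n) set) set" where
  "collineations = {f \<in> Bij pg_points. (`) f ` (points_on ` pg_lines) = points_on ` pg_lines}"

definition Persp :: "('a::field ^ 'n) set \<Rightarrow> (('a ^ 'n) set \<Rightarrow> ('a ^ 'n) set) monoid" where
  "Persp H = (BijGroup pg_points)
     \<lparr>carrier := {f \<in> collineations. \<forall>p \<in> points_on H. f p = p}\<rparr>"

text \<open>As a set of vectors, a subspace is the union of its points, so this is the
  image of a subspace under a collineation of the points.\<close>

definition collineation_image ::
  "(('a::field ^ 'n) set \<Rightarrow> ('a ^ 'n) set) \<Rightarrow> ('a ^ 'n) set \<Rightarrow> ('a ^ 'n) set" where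
  "collineation_image f U = \<Union> (f ` points_on U)"

definition PGL :: "(('a::field ^ 'n) set \<Rightarrow> ('a ^ 'n) set) monoid" where
  "PGL = (BijGroup pg_points)
     \<lparr>carrier := {restrict (\<lambda>X. (*v) A ` X) pg_points | A :: 'a ^ 'n ^ 'n. invertible A}\<rparr>"

definition field_Aut :: "('a::field \<Rightarrow> 'a) monoid" where
  "field_Aut = (BijGroup UNIV)
     \<lparr>carrier := {f. bij f \<and> (\<forall>x y. f (x + y) = f x + f y) \<and> (\<forall>x y. f (x * y) = f x * f y)}\<rparr>"

section \<open>Tits ovoids and the group \<open>FH\<close>\<close>

definition tits_sigma :: "nat \<Rightarrow> 'r::field \<Rightarrow> 'r" where
  "tits_sigma e x = x ^ (2 ^ (e + 1))"

text \<open>The exponent \<open>\<sigma> + 2\<close> abbreviates \<open>s\<^sup>\<sigma> s\<^sup>2\<close>.\<close>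

definition canonical_tits_ovoid :: "nat \<Rightarrow> ('r::field ^ 4) set set" where
  "canonical_tits_ovoid e =
     {vec.span {vector [1, s, t, s * t + tits_sigma e s * s ^ 2 + tits_sigma e t]} | s t. True}
     \<union> {vec.span {vector [0, 0, 0, 1]}}"

definition tits_ovoid :: "nat \<Rightarrow> ('r::field ^ 4) set set \<Rightarrow> bool" where
  "tits_ovoid e \<O> \<longleftrightarrow> (\<exists>g \<in> carrier PGL. \<O> = g ` canonical_tits_ovoid e)"

definition Sz_stabiliser ::
  "('r::field ^ 4) set set \<Rightarrow> (('r ^ 4) set \<Rightarrow> ('r ^ 4) set) monoid" where
  "Sz_stabiliser \<O> = PGL\<lparr>carrier := {g \<in> carrier PGL. g ` \<O> = \<O>}\<rparr>"

definition FH ::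
  "('r::field ^ 4) set set \<Rightarrow> ('r ^ 4) set \<Rightarrow> (('r ^ 4) set \<Rightarrow> ('r ^ 4) set) monoid" where
  "FH \<O> P = (Sz_stabiliser \<O>)\<lparr>carrier := {g \<in> carrier (Sz_stabiliser \<O>). g P = P}\<rparr>"

section \<open>Baer subspaces\<close>

definition field_embedding :: "('r::field \<Rightarrow> 'q::field) \<Rightarrow> bool" where
  "field_embedding \<iota> \<longleftrightarrow> \<iota> 1 = 1 \<and> (\<forall>x y. \<iota> (x + y) = \<iota> x + \<iota> y) \<and> (\<forall>x y. \<iota> (x * y) = \<iota> x * \<iota> y)"

text \<open>\<open>\<phi>\<close> identifies \<open>PG(3, r)\<close> with the Baer subspace \<open>\<pi>\<close> of the solid \<open>H\<close> of \<open>PG(n, q)\<close>,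
  \<open>q = r\<^sup>2\<close>: \<open>\<pi>\<close> consists of the points having coordinates in the subfield
  of order \<open>r\<close> with respect to some basis \<open>b\<close> of \<open>H\<close>.\<close>

definition baer_subspace ::
  "('q::{field,finite} ^ 'n) set \<Rightarrow> ('q ^ 'n) set set
    \<Rightarrow> (('r::{field,finite} ^ 4) set \<Rightarrow> ('q ^ 'n) set) \<Rightarrow> bool" where
  "baer_subspace H \<pi> \<phi> \<longleftrightarrow>
     CARD('q) = CARD('r) ^ 2 \<and>
     (\<exists>(\<iota> :: 'r \<Rightarrow> 'q) (b :: 4 \<Rightarrow> 'q ^ 'n).
        field_embedding \<iota> \<and>
        inj b \<and> vec.independent (range b) \<and> vec.span (range b) = H \<and>
        (\<forall>X \<in> pg_points. \<phi> X = vec.span ((\<lambda>x. \<Sum>i\<in>UNIV. \<iota> (x $ i) *s b i) ` X))) \<and>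
     \<pi> = \<phi> ` pg_points"

section \<open>The linear representation graph\<close>

definition Gamma :: "('a::field ^ 'n) set \<Rightarrow> ('a ^ 'n) set set \<Rightarrow> ('a ^ 'n) set graph" where
  "Gamma H K =
     (let P = {p \<in> pg_points. \<not> p \<subseteq> H};
          L = {l \<in> pg_lines. \<not> l \<subseteq> H \<and> (\<exists>k \<in> K. k \<subseteq> l)}
      in (P \<union> L, {{p, l} | p l. p \<in> P \<and> l \<in> L \<and> p \<subseteq> l}))"

definition geometric_Aut ::
  "('a::field ^ 'n) set graph \<Rightarrow> (('a ^ 'n) set \<Rightarrow> ('a ^ 'n) set) monoid" where
  "geometric_Aut \<Gamma> = (BijGroup (fst \<Gamma>))
     \<lparr>carrier := {\<alpha> \<in> graph_automorphisms \<Gamma>.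
        \<exists>f \<in> collineations. \<forall>v \<in> fst \<Gamma>. \<alpha> v = collineation_image f v}\<rparr>"

end

theory Submission
  imports Defs "HOL-Algebra.Multiplicative_Group" "HOL-Computational_Algebra.Polynomial"
begin

text \<open>
  Fix a basis of \<open>H\<close> in which the points of \<open>\<pi>\<close> have coordinates in \<open>F\<^sub>r\<close>, the ovoid is the canonical
  one and the removed point is \<open>e4 = (0, 0, 0, 1)\<close>. The points off \<open>H\<close> become vectors over \<open>F\<^sub>q\<close>, and by
  the fundamental theorem of affine geometry the collineations stabilising \<open>H\<close> are the maps
  \<open>x \<mapsto> A x\<^sup>\<tau> + w\<close>. Such a map induces an automorphism of the graph iff its linear part permutes the
  directions in \<open>K\<close>; since \<open>K\<close> contains five points in general position with coordinates in \<open>F\<^sub>r\<close>, this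
  forces \<open>A = c M\<close> with a matrix \<open>M\<close> over \<open>F\<^sub>r\<close> stabilising the affine part of the ovoid. The pairs
  \<open>(c, w)\<close>, the matrices \<open>M\<close> and the automorphisms \<open>\<tau>\<close> account for \<open>Persp(H)\<close>, \<open>FH\<close> and \<open>Aut(F\<^sub>q)\<close>.
  A comparison of coefficients determines all \<open>M\<close>, and the Suzuki group is transitive on the ovoid.

  No automorphism of the graph maps a point to a line: for a point \<open>x\<close> and a further point \<open>y\<close>, the
  points collinear with both are permuted without fixed points by the involution \<open>z \<mapsto> x + y + z\<close>, so
  that their number is even, whereas there are two skew lines with exactly \<open>r - 1\<close> transversals.
\<close>

section \<open>Groups\<close>

text \<open>The vectors \<open>cv s t\<close> of the canonical ovoid have first coordinate 1. In
  adapted coordinates each element of FH is induced by exactly one matrix that permutes these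
  vectors without scalar factors. Subgroups of PGL thereby become matrix groups, and the scalar
  \<open>c\<close> over F_q, which belongs to a perspectivity, is separated from the matrix over
  F_r.

  The group and the parity count use different coordinates. With \<open>e4\<close> removed the
  stabiliser is lower triangular with three parameters. The plane x_2 = 0, whose section has the
  simple equation x_4 = \<open>sg\<close> x_3 where x_1 = 1, passes through \<open>e4\<close>; the
  count wants this oval complete, so there the removed point is taken to be (1, 1, 0, 1).
  Transitivity of the Suzuki group permits both choices for the same graph.

  Aut(F_q) acts because F_r is the solution set of y^r = y, hence invariant, and because the ovoid
  equation has coefficients in the prime field.

  The factors of the order are (q - 1) q^4 for the perspectivities, (r - 1) r^2 for FH and h for the
  field automorphisms; r^2 = q yields the fifth power.\<close>

lemma (in group) finite_subgroupI:
  assumes "finite S" "S \<subseteq> carrier G" "\<one> \<in> S"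
    and closed: "\<And>x y. x \<in> S \<Longrightarrow> y \<in> S \<Longrightarrow> x \<otimes> y \<in> S"
  shows "subgroup S G"
proof
  fix x assume x: "x \<in> S"
  \<comment> \<open>Left translation by \<open>x\<close> is injective on the finite set
    \<open>S\<close>, hence onto, and the preimage of \<open>\<one>\<close> is the inverse of
    \<open>x\<close>.\<close>
  have "inj_on ((\<otimes>) x) S"
    using assms x by (intro inj_onI) (metis Units_eq Units_l_cancel subsetD)
  moreover have "(\<otimes>) x ` S \<subseteq> S" using closed x by auto
  ultimately have "(\<otimes>) x ` S = S" using \<open>finite S\<close> by (simp add: endo_inj_surj)
  then obtain y where "y \<in> S" "x \<otimes> y = \<one>" using \<open>\<one> \<in> S\<close> by (metis imageE)
  then have "inv x = y"
    using inv_equality[of y x] inv_comm[of x y] assms(2) x by blast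
  then show "inv x \<in> S" using \<open>y \<in> S\<close> by simp
qed (use assms in auto)

lemma BijGroup_compose:
  "f \<in> Bij S \<Longrightarrow> g \<in> Bij S \<Longrightarrow> f \<otimes>\<^bsub>BijGroup S\<^esub> g = compose S f g"
  by (simp add: BijGroup_def)

text \<open>All concrete groups here are finite sets of permutations, so closure under composition
  is the only real obligation.\<close>

lemma finite_BijGroup_group:
  assumes "finite C" "C \<subseteq> Bij S" "restrict id S \<in> C"
    and "\<And>f g. f \<in> C \<Longrightarrow> g \<in> C \<Longrightarrow> compose S f g \<in> C"
  shows "group (BijGroup S\<lparr>carrier := C\<rparr>)"
proof -
  interpret group "BijGroup S" by (rule group_BijGroup)
  have "subgroup C (BijGroup S)"
    by (rule finite_subgroupI) (use assms in \<open>auto simp: BijGroup_def id_def subset_iff\<close>)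
  then show ?thesis by (rule subgroup_imp_group)
qed

lemma hom_AutoGroupD:
  assumes "\<psi> \<in> hom Q (AutoGroup N)" "x \<in> carrier Q"
  shows "\<psi> x \<in> hom N N" "\<psi> x \<in> Bij (carrier N)"
  using hom_in_carrier[OF assms] by (auto simp: AutoGroup_def auto_def)

text \<open>\<open>semidirect_product\<close> is a bare record. Its group laws serve to nest one
  product in another and to reverse an isomorphism, whose source has to be a group.\<close>

lemma group_semidirect_product:
  assumes "group N" "group Q" and \<psi>: "\<psi> \<in> hom Q (AutoGroup N)"
  shows "group (semidirect_product N Q \<psi>)"
proof -
  interpret N: group N by fact
  interpret Q: group Q by fact
  interpret A: group "AutoGroup N" by (rule N.AutoGroup)
  have mult: "\<psi> (x \<otimes>\<^bsub>Q\<^esub> y) n = \<psi> x (\<psi> y n)"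
    if "x \<in> carrier Q" "y \<in> carrier Q" "n \<in> carrier N" for x y n
    using hom_mult[OF \<psi> that(1,2)] hom_AutoGroupD[OF \<psi>] that
    by (simp add: AutoGroup_def BijGroup_def compose_eq)
  have clo: "\<psi> x n \<in> carrier N" if "x \<in> carrier Q" "n \<in> carrier N" for x n
    using hom_AutoGroupD(1)[OF \<psi> that(1)] that(2) by (rule hom_in_carrier)
  have homN: "\<psi> x (n \<otimes>\<^bsub>N\<^esub> m) = \<psi> x n \<otimes>\<^bsub>N\<^esub> \<psi> x m"
    if "x \<in> carrier Q" "n \<in> carrier N" "m \<in> carrier N" for x n m
    using hom_AutoGroupD(1)[OF \<psi> that(1)] that(2,3) by (rule hom_mult)
  have one: "\<psi> \<one>\<^bsub>Q\<^esub> n = n" if "n \<in> carrier N" for n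
    using hom_one[OF \<psi> Q.is_group A.is_group] that by (simp add: AutoGroup_def BijGroup_def)
  show ?thesis
  proof (rule groupI)
    fix p assume "p \<in> carrier (semidirect_product N Q \<psi>)"
    then obtain n x where p: "p = (n, x)" "n \<in> carrier N" "x \<in> carrier Q"
      by (auto simp: semidirect_product_def)
    have "\<psi> (inv\<^bsub>Q\<^esub> x) (inv\<^bsub>N\<^esub> n) \<otimes>\<^bsub>N\<^esub> \<psi> (inv\<^bsub>Q\<^esub> x) n = \<one>\<^bsub>N\<^esub>"
      using p homN[of "inv\<^bsub>Q\<^esub> x" "inv\<^bsub>N\<^esub> n" n]
        hom_one[OF hom_AutoGroupD(1)[OF \<psi>] N.is_group N.is_group] by simp
    then show "\<exists>q\<in>carrier (semidirect_product N Q \<psi>).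
        q \<otimes>\<^bsub>semidirect_product N Q \<psi>\<^esub> p = \<one>\<^bsub>semidirect_product N Q \<psi>\<^esub>"
      using p clo by (intro bexI[of _ "(\<psi> (inv\<^bsub>Q\<^esub> x) (inv\<^bsub>N\<^esub> n), inv\<^bsub>Q\<^esub> x)"])
        (auto simp: semidirect_product_def)
  qed (auto simp: semidirect_product_def clo homN mult one N.m_assoc Q.m_assoc
        hom_one[OF hom_AutoGroupD(1)[OF \<psi>] N.is_group N.is_group])
qed

text \<open>Recognition of an internal semidirect product from two embedded groups. Normality is
  phrased without inverses; injectivity of \<open>i\<close> makes the element \<open>n'\<close>
  unique, and the passage from \<open>n\<close> to \<open>n'\<close> is the action.\<close>

theorem (in group) split_semidirect_product_iso:
  assumes "group N" "group Q"
    and i: "i \<in> hom N G" "inj_on i (carrier N)"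
    and j: "j \<in> hom Q G" "inj_on j (carrier Q)"
    and norm: "\<And>x n. x \<in> carrier Q \<Longrightarrow> n \<in> carrier N \<Longrightarrow>
      \<exists>n'\<in>carrier N. j x \<otimes> i n = i n' \<otimes> j x"
    and triv: "i ` carrier N \<inter> j ` carrier Q \<subseteq> {\<one>}"
    and gen: "\<And>g. g \<in> carrier G \<Longrightarrow> \<exists>n\<in>carrier N. \<exists>x\<in>carrier Q. g = i n \<otimes> j x"
  shows "\<exists>\<psi>\<in>hom Q (AutoGroup N). (\<lambda>(n, x). i n \<otimes> j x) \<in> iso (semidirect_product N Q \<psi>) G"
proof -
  interpret N: group N by fact
  interpret Q: group Q by fact
  note iC[simp] = hom_in_carrier[OF i(1)] and jC[simp] = hom_in_carrier[OF j(1)]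
  define c where "c x n = (SOME n'. n' \<in> carrier N \<and> j x \<otimes> i n = i n' \<otimes> j x)" for x n
  have c: "c x n \<in> carrier N" "j x \<otimes> i n = i (c x n) \<otimes> j x"
    if "x \<in> carrier Q" "n \<in> carrier N" for x n
    using someI_ex[of "\<lambda>n'. n' \<in> carrier N \<and> j x \<otimes> i n = i n' \<otimes> j x"] norm[OF that]
    unfolding c_def by blast+
  have cu: "c x n = m" if "x \<in> carrier Q" "n \<in> carrier N" "m \<in> carrier N"
    "j x \<otimes> i n = i m \<otimes> j x" for x n m
    using c[OF that(1,2)] that i(2) by (metis right_cancel iC jC inj_onD)
  have cm: "c x (n \<otimes>\<^bsub>N\<^esub> m) = c x n \<otimes>\<^bsub>N\<^esub> c x m"
    if "x \<in> carrier Q" "n \<in> carrier N" "m \<in> carrier N" for x n m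
  proof (rule cu)
    show "j x \<otimes> i (n \<otimes>\<^bsub>N\<^esub> m) = i (c x n \<otimes>\<^bsub>N\<^esub> c x m) \<otimes> j x"
    proof -
      have "j x \<otimes> i (n \<otimes>\<^bsub>N\<^esub> m) = (j x \<otimes> i n) \<otimes> i m"
        using that by (simp add: hom_mult[OF i(1)] m_assoc)
      also have "\<dots> = i (c x n) \<otimes> (j x \<otimes> i m)"
        using that c by (simp add: m_assoc)
      also have "\<dots> = i (c x n \<otimes>\<^bsub>N\<^esub> c x m) \<otimes> j x"
        using that c by (simp add: hom_mult[OF i(1)] m_assoc)
      finally show ?thesis .
    qed
  qed (use that c in auto)
  have cc: "c (x \<otimes>\<^bsub>Q\<^esub> y) n = c x (c y n)"
    if "x \<in> carrier Q" "y \<in> carrier Q" "n \<in> carrier N" for x y n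
  proof (rule cu)
    show "j (x \<otimes>\<^bsub>Q\<^esub> y) \<otimes> i n = i (c x (c y n)) \<otimes> j (x \<otimes>\<^bsub>Q\<^esub> y)"
    proof -
      have "j (x \<otimes>\<^bsub>Q\<^esub> y) \<otimes> i n = j x \<otimes> (j y \<otimes> i n)"
        using that by (simp add: hom_mult[OF j(1)] m_assoc)
      also have "\<dots> = (j x \<otimes> i (c y n)) \<otimes> j y"
        using that c(1) by (simp add: c(2)[OF that(2,3)] m_assoc)
      also have "\<dots> = i (c x (c y n)) \<otimes> j (x \<otimes>\<^bsub>Q\<^esub> y)"
        unfolding c(2)[OF that(1) c(1)[OF that(2,3)]]
        using that c(1) by (simp add: hom_mult[OF j(1)] m_assoc)
      finally show ?thesis .
    qed
  qed (use that c in auto)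
  have c1: "c \<one>\<^bsub>Q\<^esub> n = n" if "n \<in> carrier N" for n
    by (rule cu) (use that hom_one[OF j(1) Q.is_group is_group] in auto)
  \<comment> \<open>\<open>Bij\<close> consists of extensional functions, hence the
    restriction.\<close>
  define \<psi> where "\<psi> x = restrict (c x) (carrier N)" for x
  have bij: "\<psi> x \<in> Bij (carrier N)" if "x \<in> carrier Q" for x
  proof -
    have "bij_betw (c x) (carrier N) (carrier N)"
      by (rule bij_betw_byWitness[where f' = "c (inv\<^bsub>Q\<^esub> x)"])
        (use that c in \<open>auto simp: cc[symmetric] c1\<close>)
    then show ?thesis by (auto simp: \<psi>_def Bij_def)
  qed
  have \<psi>: "\<psi> \<in> hom Q (AutoGroup N)"
  proof (rule homI)
    fix x assume x: "x \<in> carrier Q"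
    show "\<psi> x \<in> carrier (AutoGroup N)"
      using bij[OF x] x c by (auto simp: AutoGroup_def auto_def \<psi>_def hom_def cm)
    fix y assume y: "y \<in> carrier Q"
    show "\<psi> (x \<otimes>\<^bsub>Q\<^esub> y) = \<psi> x \<otimes>\<^bsub>AutoGroup N\<^esub> \<psi> y"
      using bij[OF x] bij[OF y] x y c by (auto simp: AutoGroup_def BijGroup_def compose_def \<psi>_def cc)
  qed
  let ?S = "semidirect_product N Q \<psi>"
  let ?h = "\<lambda>(n, x). i n \<otimes> j x"
  have "?h \<in> hom ?S G"
  proof (rule homI)
    fix p q assume "p \<in> carrier ?S" "q \<in> carrier ?S"
    then obtain n x m y where pq: "p = (n, x)" "q = (m, y)"
      "n \<in> carrier N" "x \<in> carrier Q" "m \<in> carrier N" "y \<in> carrier Q"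
      by (auto simp: semidirect_product_def)
    have "i (n \<otimes>\<^bsub>N\<^esub> c x m) \<otimes> j (x \<otimes>\<^bsub>Q\<^esub> y) = i n \<otimes> (i (c x m) \<otimes> j x) \<otimes> j y"
      using pq c by (simp add: hom_mult[OF i(1)] hom_mult[OF j(1)] m_assoc)
    also have "\<dots> = (i n \<otimes> j x) \<otimes> (i m \<otimes> j y)"
      using pq c(2)[OF pq(4,5), symmetric] by (simp add: m_assoc)
    finally show "?h (p \<otimes>\<^bsub>?S\<^esub> q) = ?h p \<otimes> ?h q"
      using pq by (simp add: semidirect_product_def \<psi>_def)
  qed (auto simp: semidirect_product_def)
  moreover have "inj_on ?h (carrier ?S)"
  proof (rule inj_onI)
    fix p q assume "p \<in> carrier ?S" "q \<in> carrier ?S" and eq: "?h p = ?h q"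
    then obtain n x m y where pq: "p = (n, x)" "q = (m, y)"
      "n \<in> carrier N" "x \<in> carrier Q" "m \<in> carrier N" "y \<in> carrier Q"
      by (auto simp: semidirect_product_def)
    \<comment> \<open>Two factorisations of one element differ by an element that is both an
      \<open>i\<close>-image and a \<open>j\<close>-image, hence trivial.\<close>
    let ?z = "inv (i m) \<otimes> i n"
    have e: "i n \<otimes> j x = i m \<otimes> j y" using eq pq by simp
    have "?z = i (inv\<^bsub>N\<^esub> m \<otimes>\<^bsub>N\<^esub> n)"
      using pq by (simp add: hom_mult[OF i(1)] group_hom.hom_inv[OF group_hom.intro[OF N.is_group is_group group_hom_axioms.intro[OF i(1)]]])
    then have "?z \<in> i ` carrier N" using pq by simp
    moreover have "?z = j y \<otimes> inv (j x)"
    proof -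
      have "?z = inv (i m) \<otimes> (i n \<otimes> j x) \<otimes> inv (j x)"
        using pq by (simp add: m_assoc)
      also have "\<dots> = j y \<otimes> inv (j x)"
        unfolding e using pq by (simp flip: m_assoc)
      finally show ?thesis .
    qed
    then have "?z = j (y \<otimes>\<^bsub>Q\<^esub> inv\<^bsub>Q\<^esub> x)"
      using pq by (simp add: hom_mult[OF j(1)] group_hom.hom_inv[OF group_hom.intro[OF Q.is_group is_group group_hom_axioms.intro[OF j(1)]]])
    then have "?z \<in> j ` carrier Q" using pq by simp
    ultimately have z: "?z = \<one>" using triv by blast
    then have im: "i n = i m" using pq inv_solve_left[of "\<one>" "i m" "i n"] by simp
    then have "n = m" using pq i(2) by (auto dest: inj_onD)
    moreover have "j x = j y" using e im pq by simp
    then have "x = y" using pq j(2) by (auto dest: inj_onD)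
    ultimately show "p = q" using pq by simp
  qed
  moreover have "?h ` carrier ?S = carrier G"
  proof
    show "?h ` carrier ?S \<subseteq> carrier G" by (auto simp: semidirect_product_def)
    show "carrier G \<subseteq> ?h ` carrier ?S"
    proof
      fix g assume "g \<in> carrier G"
      then obtain n x where "n \<in> carrier N" "x \<in> carrier Q" "g = i n \<otimes> j x" using gen by blast
      then show "g \<in> ?h ` carrier ?S" by (intro image_eqI[of _ _ "(n, x)"]) (auto simp: semidirect_product_def)
    qed
  qed
  ultimately have "?h \<in> iso ?S G" by (simp add: iso_def bij_betw_def)
  with \<psi> show ?thesis by blast
qed

section \<open>Finite fields\<close>

text \<open>Multiplication by a nonzero \<open>x\<close> permutes the nonzero elements, so their
  product is unchanged by the factor \<open>x ^ (CARD('a) - 1)\<close>.\<close>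

lemma finite_field_pow_card:
  fixes x :: "'a::{field,finite}"
  shows "x ^ CARD('a) = x"
proof (cases "x = 0")
  case False
  have "x * (\<Prod>y\<in>UNIV-{0}. x * y) = x * x ^ (CARD('a) - 1) * \<Prod>(UNIV-{0})"
    by (simp add: prod.distrib mult_ac)
  also have "x * x ^ (CARD('a) - 1) = x ^ CARD('a)"
    by (simp flip: power_Suc)
  also have "(\<Prod>y\<in>UNIV-{0}. x * y) = (\<Prod>y\<in>UNIV-{0}. y)"
    by (rule prod.reindex_bij_witness[of _ "\<lambda>y. y / x" "\<lambda>y. x * y"]) (use False in auto)
  finally show ?thesis by simp
qed simp

text \<open>The exponent \<open>2 ^ n\<close> is even, so it sends -1 to 1; being the order of the
  field, it also sends -1 to itself.\<close>

lemma char_two_minus: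
  fixes x :: "'a::{field,finite}"
  assumes "CARD('a) = 2 ^ n" "n > 0"
  shows "- x = x" and "x + x = 0" and "y - x = y + x"
proof -
  have "(-1::'a) ^ (2 ^ n) = 1" using assms(2) by simp
  then have "(-1::'a) = 1" using finite_field_pow_card[of "-1::'a"] assms(1) by simp
  then have *: "-x = x" for x :: 'a by (metis mult_1 mult_minus1)
  then show "- x = x" "y - x = y + x" by (metis diff_conv_add_uminus)+
  show "x + x = 0" using * by (metis add.right_inverse)
qed

lemma frobenius_add:
  fixes x y :: "'a::comm_ring_1"
  assumes "\<And>z::'a. z + z = 0"
  shows "(x + y) ^ (2 ^ i) = x ^ (2 ^ i) + y ^ (2 ^ i)"
proof (induction i)
  case (Suc i)
  have sq: "(a + b)\<^sup>2 = a\<^sup>2 + b\<^sup>2" for a b :: 'a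
  proof -
    have "(a + b)\<^sup>2 = a\<^sup>2 + b\<^sup>2 + (a * b + a * b)" by (simp add: power2_eq_square algebra_simps)
    then show ?thesis by (simp only: assms add_0_right)
  qed
  have "z ^ (2 ^ Suc i) = (z ^ (2 ^ i))\<^sup>2" for z :: 'a
    by (simp add: mult.commute flip: power_mult)
  then show ?case using Suc by (simp only: sq)
qed simp

lemma finite_field_generator:
  "\<exists>g::'a::{field,finite}. \<forall>x. x \<noteq> 0 \<longrightarrow> (\<exists>i::nat. x = g ^ i)"
proof -
  \<comment> \<open>The type-class field is repackaged as a record, to which the cyclicity of the
    multiplicative group of a finite field applies.\<close>
  define R :: "'a ring" where "R = \<lparr>carrier = UNIV, monoid.mult = (*), one = 1, zero = 0, add = (+)\<rparr>"
  have fR: "field R"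
  proof (rule cring.cring_fieldI2)
    show "cring R"
    proof (rule cringI)
      show "abelian_group R"
      proof (rule abelian_groupI)
        fix x assume "x \<in> carrier R"
        show "\<exists>y\<in>carrier R. y \<oplus>\<^bsub>R\<^esub> x = \<zero>\<^bsub>R\<^esub>"
          by (rule bexI[of _ "- x"]) (auto simp: R_def)
      qed (auto simp: R_def ac_simps)
      show "comm_monoid R" by (rule comm_monoidI) (auto simp: R_def ac_simps)
    qed (auto simp: R_def algebra_simps)
    show "\<zero>\<^bsub>R\<^esub> \<noteq> \<one>\<^bsub>R\<^esub>" by (simp add: R_def)
    fix a assume "a \<in> carrier R" "a \<noteq> \<zero>\<^bsub>R\<^esub>"
    then show "\<exists>b\<in>carrier R. a \<otimes>\<^bsub>R\<^esub> b = \<one>\<^bsub>R\<^esub>"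
      by (intro bexI[of _ "inverse a"]) (auto simp: R_def)
  qed
  interpret field R by (rule fR)
  have pow: "x [^]\<^bsub>R\<^esub> (i::nat) = x ^ i" for x i
    by (induction i) (auto simp: R_def nat_pow_def mult.commute)
  obtain g where g: "carrier (mult_of R) = {g [^]\<^bsub>R\<^esub> i | i::nat. i \<in> UNIV}"
    using finite_field_mult_group_has_gen by (auto simp: R_def)
  have "x \<noteq> 0 \<longrightarrow> (\<exists>i::nat. x = g ^ i)" for x
  proof
    assume "x \<noteq> 0"
    then have "x \<in> carrier (mult_of R)" by (simp add: R_def)
    then show "\<exists>i::nat. x = g ^ i" unfolding g by (auto simp: pow)
  qed
  then show ?thesis by blast
qed

lemma field_embeddingD:
  assumes "field_embedding \<iota>"
  shows "\<iota> 1 = 1" "\<iota> 0 = 0" "\<iota> (x + y) = \<iota> x + \<iota> y" "\<iota> (x * y) = \<iota> x * \<iota> y" "\<iota> (x ^ n) = \<iota> x ^ n"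
    "\<iota> x = \<iota> y \<longleftrightarrow> x = y" "\<iota> x = 0 \<longleftrightarrow> x = 0" "\<iota> (- x) = - \<iota> x" "\<iota> (x - y) = \<iota> x - \<iota> y"
    "\<iota> (inverse x) = inverse (\<iota> x)" "\<iota> (sum g A) = (\<Sum>i\<in>A. \<iota> (g i))"
proof -
  show one: "\<iota> 1 = 1" and add: "\<iota> (x + y) = \<iota> x + \<iota> y" and mult: "\<iota> (x * y) = \<iota> x * \<iota> y" for x y
    using assms by (auto simp: field_embedding_def)
  show z: "\<iota> 0 = 0" using add[of 0 0] add_left_cancel[of "\<iota> 0" "\<iota> 0" 0] by simp
  show "\<iota> (x ^ n) = \<iota> x ^ n" by (induction n) (simp_all add: one mult)
  show neg: "\<iota> (- x) = - \<iota> x" for x using add[of x "-x"] z by (simp add: eq_neg_iff_add_eq_0 add.commute)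
  show sub: "\<iota> (x - y) = \<iota> x - \<iota> y" for x y using add[of x "-y"] neg by simp
  show nz: "\<iota> x = 0 \<longleftrightarrow> x = 0" for x
  proof (cases "x = 0")
    case False
    then have "\<iota> x * \<iota> (inverse x) = 1" using mult[of x "inverse x"] one by simp
    then show ?thesis using False by auto
  qed (simp add: z)
  show "\<iota> x = \<iota> y \<longleftrightarrow> x = y" using nz[of "x - y"] sub by simp
  show "\<iota> (inverse x) = inverse (\<iota> x)"
  proof (cases "x = 0")
    case False
    then have "\<iota> x * \<iota> (inverse x) = 1" using mult[of x "inverse x"] one by simp
    then show ?thesis by (simp add: inverse_unique)
  qed (simp add: z)
  show "\<iota> (sum g A) = (\<Sum>i\<in>A. \<iota> (g i))"
    by (induction A rule: infinite_finite_induct) (simp_all add: z add)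
qed

definition field_auts :: "('a::field \<Rightarrow> 'a) set" where
  "field_auts = {f. bij f \<and> (\<forall>x y. f (x + y) = f x + f y) \<and> (\<forall>x y. f (x * y) = f x * f y)}"

lemma carrier_field_Aut: "carrier field_Aut = field_auts"
  by (simp add: field_Aut_def field_auts_def)

lemma field_autsD:
  assumes "\<tau> \<in> field_auts"
  shows "bij \<tau>" "\<tau> (x + y) = \<tau> x + \<tau> y" "\<tau> (x * y) = \<tau> x * \<tau> y"
  using assms by (auto simp: field_auts_def)

lemma field_auts_simps:
  fixes \<tau> :: "'a::field \<Rightarrow> 'a"
  assumes "\<tau> \<in> field_auts"
  shows "\<tau> 0 = 0" "\<tau> 1 = 1" "\<tau> x = 0 \<longleftrightarrow> x = 0" "\<tau> x = \<tau> y \<longleftrightarrow> x = y" "\<tau> (x ^ n) = \<tau> x ^ n"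
    "\<tau> (- x) = - \<tau> x" "\<tau> (x - y) = \<tau> x - \<tau> y" "\<tau> (sum g A) = (\<Sum>i\<in>A. \<tau> (g i))"
proof -
  note D = field_autsD[OF assms]
  have inj: "\<tau> x = \<tau> y \<longleftrightarrow> x = y" for x y using D(1) by (auto simp: bij_def inj_eq)
  have "\<tau> 0 = 0" using D(2)[of 0 0] add_left_cancel[of "\<tau> 0" "\<tau> 0" 0] by simp
  then have "\<tau> 1 = 1" using D(3)[of 1 1] inj[of 1 0] by simp
  then have "field_embedding \<tau>" using D(2,3) by (simp add: field_embedding_def)
  note F = field_embeddingD[OF this]
  show "\<tau> 0 = 0" "\<tau> 1 = 1" "\<tau> x = 0 \<longleftrightarrow> x = 0" "\<tau> x = \<tau> y \<longleftrightarrow> x = y" "\<tau> (x ^ n) = \<tau> x ^ n"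
    "\<tau> (- x) = - \<tau> x" "\<tau> (x - y) = \<tau> x - \<tau> y" "\<tau> (sum g A) = (\<Sum>i\<in>A. \<tau> (g i))"
    by (fact F)+
qed

lemma field_auts_id: "id \<in> field_auts" "(\<lambda>x. x) \<in> field_auts"
  by (auto simp: field_auts_def bij_def)

lemma field_auts_comp: "\<tau> \<in> field_auts \<Longrightarrow> \<rho> \<in> field_auts \<Longrightarrow> \<tau> \<circ> \<rho> \<in> field_auts"
  by (auto simp: field_auts_def intro: bij_comp)

lemma field_auts_Bij: "field_auts \<subseteq> Bij UNIV"
  by (auto simp: field_auts_def Bij_def)

lemma field_Aut_mult:
  "\<tau> \<in> field_auts \<Longrightarrow> \<rho> \<in> field_auts \<Longrightarrow> \<tau> \<otimes>\<^bsub>field_Aut\<^esub> \<rho> = \<tau> \<circ> \<rho>"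
  using field_auts_Bij by (auto simp: field_Aut_def BijGroup_def compose_def fun_eq_iff)

lemma group_field_Aut: "group (field_Aut :: ('a::{field,finite} \<Rightarrow> 'a) monoid)"
proof -
  have comp: "compose UNIV f g = f \<circ> g" for f g :: "'a \<Rightarrow> 'a"
    by (simp add: compose_def fun_eq_iff)
  have "group (BijGroup UNIV\<lparr>carrier := field_auts :: ('a \<Rightarrow> 'a) set\<rparr>)"
    by (rule finite_BijGroup_group)
      (use field_auts_Bij in \<open>auto simp: field_auts_id field_auts_comp comp restrict_UNIV\<close>)
  then show ?thesis by (simp only: field_Aut_def field_auts_def)
qed

lemma coeff_mult_root:
  "coeff (p * [:- a, 1:]) k = (if k = 0 then 0 else coeff p (k - 1)) - a * coeff p k"
  for a :: "'a::comm_ring_1"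
  by (cases k) (simp_all add: algebra_simps)

text \<open>In characteristic 2 squaring is a ring endomorphism, so squaring the coefficients of a
  product of linear factors squares its roots.\<close>

lemma coeff_prod_roots_square:
  fixes a :: "nat \<Rightarrow> 'a::comm_ring_1"
  assumes "\<And>z::'a. z + z = 0"
  shows "coeff (\<Prod>i<n. [:- a i, 1:]) k ^ 2 = coeff (\<Prod>i<n. [:- (a i)\<^sup>2, 1:]) k"
proof (induction n arbitrary: k)
  case (Suc n)
  have sub: "x - y = x + y" for x y :: 'a
    using assms[of y] by (simp add: diff_eq_eq add.assoc)
  have sq: "(x + y)\<^sup>2 = x\<^sup>2 + y\<^sup>2" for x y :: 'a
    using frobenius_add[OF assms, of x y 1] by simp
  show ?case
    by (simp add: coeff_mult_root sub sq power_mult_distrib Suc.IH del: mult_pCons_right)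
qed (auto simp: coeff_1)

text \<open>The automorphisms are the powers \<open>fr i\<close> of the Frobenius map. An
  automorphism is determined by its value at a generator \<open>g\<close>, and this value is a root
  of the product of the factors X - \<open>fr i g\<close>.\<close>

lemma card_field_auts:
  assumes card: "CARD('a::{field,finite}) = 2 ^ h" and "h > 0"
  shows "card (field_auts :: ('a \<Rightarrow> 'a) set) = h"
proof -
  note ch = char_two_minus(2)[OF assms]
  obtain g :: 'a where g: "x \<noteq> 0 \<Longrightarrow> \<exists>i::nat. x = g ^ i" for x
    using finite_field_generator by blast
  define fr :: "nat \<Rightarrow> 'a \<Rightarrow> 'a" where "fr i x = x ^ (2 ^ i)" for i x
  have fr_inj: "inj (fr i)" for i
  proof (rule injI)
    fix x y assume "fr i x = fr i y"
    then have "(x - y) ^ (2 ^ i) = 0"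
      using frobenius_add[OF ch, of x y i] ch by (simp add: fr_def char_two_minus(3)[OF assms])
    then show "x = y" by simp
  qed
  have fr_eq: "i = j" if "i < h" "j < h" "fr i g = fr j g" for i j
  proof -
    have *: "\<not> i < j" if "i < h" "j < h" "fr i g = fr j g" for i j
    proof
      assume "i < j"
      have "fr i (fr (j - i) g) = fr i g"
        using \<open>i < j\<close> that(3) by (simp add: fr_def flip: power_mult power_add)
      then have "fr (j - i) g = g" using fr_inj by (simp add: inj_eq)
      have "fr (j - i) x = x" for x
      proof (cases "x = 0")
        case False
        then obtain n where "x = g ^ n" using g by blast
        moreover have "fr (j - i) (g ^ n) = fr (j - i) g ^ n"
          by (simp add: fr_def mult.commute flip: power_mult)
        ultimately show ?thesis using \<open>fr (j - i) g = g\<close> by simp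
      qed (simp add: fr_def)
      \<comment> \<open>A power of Frobenius fixing everything gives a nonzero polynomial of degree
        at most \<open>2 ^ (j - i)\<close> with \<open>2 ^ h\<close> roots.\<close>
      then have "x \<in> {x. poly (monom 1 (2 ^ (j - i)) - [:0, 1:]) x = 0}" for x :: 'a
        by (simp add: fr_def poly_monom)
      then have "UNIV \<subseteq> {x::'a. poly (monom 1 (2 ^ (j - i)) - [:0, 1:]) x = 0}" by blast
      moreover have ne: "monom 1 (2 ^ (j - i)) - [:0, 1:] \<noteq> (0 :: 'a poly)"
      proof -
        have "2 ^ (j - i) \<noteq> (1::nat)" using \<open>i < j\<close> by simp
        then have "coeff (monom 1 (2 ^ (j - i)) - [:0, 1:]) (2 ^ (j - i)) = (1::'a)"
          by (auto simp: coeff_pCons split: nat.splits)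
        then show ?thesis by (metis coeff_0 zero_neq_one)
      qed
      ultimately have "CARD('a) \<le> degree (monom 1 (2 ^ (j - i)) - [:0, 1:] :: 'a poly)"
        using card_mono[OF poly_roots_finite[OF ne]] card_poly_roots_bound[OF ne] by (meson le_trans)
      also have "\<dots> \<le> 2 ^ (j - i)"
        by (rule degree_diff_le) (use \<open>i < j\<close> in \<open>auto simp: degree_monom_le\<close>)
      finally have "h \<le> j - i" unfolding card by simp
      then show False using \<open>i < j\<close> \<open>j < h\<close> by simp
    qed
    then show "i = j" using that by (metis linorder_neqE_nat)
  qed
  have fr_aut: "fr i \<in> field_auts" for i
  proof -
    have "bij (fr i)" using fr_inj by (simp add: bij_def finite_UNIV_inj_surj)
    then show ?thesis by (auto simp: field_auts_def fr_def frobenius_add[OF ch] power_mult_distrib)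
  qed
  define p where "p = (\<Prod>i<h. [:- fr i g, 1:])"
  have "(fr i g)\<^sup>2 = fr (Suc i) g" for i
    by (simp add: fr_def mult.commute flip: power_mult)
  then have sqp: "coeff p k ^ 2 = coeff (\<Prod>i<h. [:- fr (Suc i) g, 1:]) k" for k
    using coeff_prod_roots_square[OF ch, of "\<lambda>i. fr i g" h k] by (simp add: p_def)
  \<comment> \<open>Squaring shifts the roots cyclically, because \<open>fr h g = g\<close>. Each
    coefficient of \<open>p\<close> therefore equals its square, lies in {0, 1} and is fixed by all
    automorphisms.\<close>
  have "(\<Prod>i<h. [:- fr (Suc i) g, 1:]) = p"
  proof -
    obtain m where m: "h = Suc m" using \<open>h > 0\<close> by (metis gr0_implies_Suc)
    have "fr h g = fr 0 g" using finite_field_pow_card[of g] by (simp add: fr_def card)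
    then show ?thesis
      unfolding p_def m by (subst prod.lessThan_Suc_shift) (simp add: m mult.commute del: mult_pCons_right mult_pCons_left)
  qed
  then have "coeff p k * (coeff p k - 1) = 0" for k
    using sqp[of k] by (simp add: power2_eq_square algebra_simps)
  then have c01: "coeff p k = 0 \<or> coeff p k = 1" for k by simp
  have "field_auts = fr ` {..<h}"
  proof
    show "field_auts \<subseteq> fr ` {..<h}"
    proof
      fix \<tau> :: "'a \<Rightarrow> 'a" assume \<tau>: "\<tau> \<in> field_auts"
      have "\<tau> (coeff p k) = coeff p k" for k using c01[of k] field_auts_simps[OF \<tau>] by auto
      then have "poly p (\<tau> g) = \<tau> (poly p g)"
        by (simp add: poly_altdef field_auts_simps[OF \<tau>] field_autsD[OF \<tau>])
      also have "poly p g = 0" 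
        using \<open>h > 0\<close> by (auto simp: p_def poly_prod fr_def intro!: bexI[of _ 0])
      finally have "poly p (\<tau> g) = 0" by (simp add: field_auts_simps[OF \<tau>])
      then obtain i where i: "i < h" "\<tau> g = fr i g" by (auto simp: p_def poly_prod)
      have "\<tau> x = fr i x" for x
      proof (cases "x = 0")
        case False
        then obtain n where "x = g ^ n" using g by blast
        then show ?thesis using i field_auts_simps(5)[OF \<tau>] field_auts_simps(5)[OF fr_aut] by simp
      qed (simp add: fr_def field_auts_simps[OF \<tau>])
      then show "\<tau> \<in> fr ` {..<h}" using i by (intro image_eqI[of _ _ i]) auto
    qed
  qed (use fr_aut in auto)
  moreover have "inj_on fr {..<h}" by (rule inj_onI) (use fr_eq in auto)
  ultimately show ?thesis by (metis card_image card_lessThan)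
qed

text \<open>The r values of \<open>\<iota>\<close> all solve y^r = y, an equation with at most r
  solutions.\<close>

lemma range_field_embedding:
  fixes \<iota> :: "'r::{field,finite} \<Rightarrow> 'q::field"
  assumes "field_embedding \<iota>"
  shows "range \<iota> = {y. y ^ CARD('r) = y}"
proof -
  have "1 < CARD('r)"
    using card_mono[of UNIV "{0, 1::'r}"] by simp
  define p :: "'q poly" where "p = monom 1 CARD('r) - [:0, 1:]"
  have "coeff p CARD('r) = 1"
    using \<open>1 < CARD('r)\<close> by (auto simp: p_def coeff_pCons split: nat.splits)
  then have p0: "p \<noteq> 0" by (metis coeff_0 zero_neq_one)
  have roots: "{y. poly p y = 0} = {y. y ^ CARD('r) = y}" by (auto simp: p_def poly_monom)
  have "degree p \<le> CARD('r)"
    unfolding p_def by (rule degree_diff_le) (use \<open>1 < CARD('r)\<close> in \<open>auto simp: degree_monom_le\<close>)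
  then have "card {y. poly p y = 0} \<le> card (range \<iota>)"
    using card_poly_roots_bound[OF p0] by (simp add: card_image inj_def field_embeddingD[OF assms])
  moreover have "range \<iota> \<subseteq> {y. poly p y = 0}"
    unfolding roots by (auto simp: finite_field_pow_card simp flip: field_embeddingD(5)[OF assms])
  ultimately have "range \<iota> = {y. poly p y = 0}"
    using card_seteq[OF poly_roots_finite[OF p0]] by blast
  then show ?thesis using roots by simp
qed

text \<open>Automorphisms respect the equation that cuts out the subfield. This lets all of Aut(F_q)
  act on vectors with coordinates in the small field.\<close>

lemma field_auts_range_embedding:
  fixes \<iota> :: "'r::{field,finite} \<Rightarrow> 'q::field"
  assumes "field_embedding \<iota>" "\<tau> \<in> field_auts" "x \<in> range \<iota>"
  shows "\<tau> x \<in> range \<iota>"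
  using assms(3) unfolding range_field_embedding[OF assms(1)]
  by (auto simp flip: field_auts_simps(5)[OF assms(2)])

section \<open>The Tits ovoid\<close>

lemma vector_4 [simp]:
  "(vector [a, b, c, d] :: 'a::zero ^ 4) $ 1 = a"
  "(vector [a, b, c, d] :: 'a ^ 4) $ 2 = b"
  "(vector [a, b, c, d] :: 'a ^ 4) $ 3 = c"
  "(vector [a, b, c, d] :: 'a ^ 4) $ 4 = d"
  by (simp_all add: vector_def)

lemma vec4_eq_iff: "x = y \<longleftrightarrow> x $ 1 = y $ 1 \<and> x $ 2 = y $ 2 \<and> x $ 3 = y $ 3 \<and> x $ 4 = y $ 4"
  for x y :: "'a ^ 4"
  by (simp add: vec_eq_iff forall_4)

lemma mat_4_apply [simp]:
  "mat x $ (1::4) $ (1::4) = x" "mat x $ (2::4) $ (2::4) = x" "mat x $ (3::4) $ (3::4) = x" "mat x $ (4::4) $ (4::4) = x"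
  "mat x $ (1::4) $ (2::4) = 0" "mat x $ (1::4) $ (3::4) = 0" "mat x $ (1::4) $ (4::4) = 0"
  "mat x $ (2::4) $ (1::4) = 0" "mat x $ (2::4) $ (3::4) = 0" "mat x $ (2::4) $ (4::4) = 0"
  "mat x $ (3::4) $ (1::4) = 0" "mat x $ (3::4) $ (2::4) = 0" "mat x $ (3::4) $ (4::4) = 0"
  "mat x $ (4::4) $ (1::4) = 0" "mat x $ (4::4) $ (2::4) = 0" "mat x $ (4::4) $ (3::4) = 0"
  by (simp_all add: mat_def)

lemma matrix_vector_4: "((A::'a::comm_semiring_1^4^4) *v x) $ i = A$i$1 * x$1 + A$i$2 * x$2 + A$i$3 * x$3 + A$i$4 * x$4"
  by (simp add: matrix_vector_mult_def sum_4)

lemma matrix_matrix_4: "((A::'a::comm_semiring_1^4^4) ** B) $ i $ j = A$i$1 * B$1$j + A$i$2 * B$2$j + A$i$3 * B$3$j + A$i$4 * B$4$j"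
  by (simp add: matrix_matrix_mult_def sum_4)

lemma invertible_iff_ker: "invertible A \<longleftrightarrow> (\<forall>x. A *v x = 0 \<longrightarrow> x = 0)" for A :: "'a::field^'n^'n"
  by (simp add: invertible_left_inverse matrix_left_invertible_ker)

lemma invertible_inj: "invertible A \<Longrightarrow> A *v x = A *v y \<longleftrightarrow> x = y" for A :: "'a::field^'n^'n"
  by (metis invertible_left_inverse matrix_left_invertible_injective injD)

lemma mat_mult_component: "(mat c ** A) $ i $ j = c * A $ i $ j" for A :: "'a::comm_semiring_1^'n^'m"
proof -
  have "(\<Sum>k\<in>UNIV. (if i = k then c else 0) * A $ k $ j) = (\<Sum>k\<in>UNIV. if i = k then c * A $ k $ j else 0)"
    by (rule sum.cong) auto
  then show ?thesis by (simp add: matrix_matrix_mult_def mat_def)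
qed

lemma mat_mult_vector: "(mat c ** A) *v x = c *s (A *v x)" for A :: "'a::comm_semiring_1^'n^'m"
  by (simp add: vec_eq_iff matrix_vector_mult_def mat_mult_component sum_distrib_left mult.assoc)

lemma span_singleton_scale: "c \<noteq> 0 \<Longrightarrow> vec.span {c *s v} = vec.span {v}"
  by (auto simp: vec.span_singleton image_def) (metis field_class.field_inverse mult.assoc mult.commute mult.right_neutral vec.scale_scale)

lemma span_singleton_eq_iff:
  assumes "v \<noteq> 0"
  shows "vec.span {v} = vec.span {w} \<longleftrightarrow> (\<exists>c. c \<noteq> 0 \<and> v = c *s w)"
proof
  assume "vec.span {v} = vec.span {w}"
  then have "v \<in> vec.span {w}" by (metis singletonI vec.span_base)
  then obtain c where "v = c *s w" by (auto simp: vec.span_singleton)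
  then show "\<exists>c. c \<noteq> 0 \<and> v = c *s w" using assms by (auto intro!: exI[of _ c])
qed (auto simp: span_singleton_scale)

lemma image_matrix_span: "(*v) A ` vec.span {v} = vec.span {A *v v}"
  by (auto simp: vec.span_singleton image_def vec.scale)

locale tits_field =
  fixes e :: nat and r :: "'r::{field,finite} itself"
  assumes card_r: "CARD('r) = 2 ^ (2 * e + 1)" and e: "e \<ge> 1"
begin

abbreviation sg :: "'r \<Rightarrow> 'r" where "sg \<equiv> tits_sigma e"

abbreviation vh :: "'r \<Rightarrow> 'r \<Rightarrow> 'r" where "vh s t \<equiv> s * t + sg s * s ^ 2 + sg t"

text \<open>First coordinate 1 singles out one vector on each point of the ovoid other than
  \<open>e4\<close>.\<close>

definition cv :: "'r \<Rightarrow> 'r \<Rightarrow> 'r ^ 4" where "cv s t = vector [1, s, t, vh s t]"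

definition e4 :: "'r ^ 4" where "e4 = vector [0, 0, 0, 1]"

lemma minus_eq [simp]: "- x = x" and double [simp]: "x + x = 0" and diff_eq_add [simp]: "x - y = x + y"
  and double_left [simp]: "x + (x + y) = y" for x y :: 'r
  using char_two_minus[OF card_r, of x] char_two_minus(3)[OF card_r, of x y] 
  by (auto simp flip: add.assoc)

lemma two_eq_0 [simp]: "(2::'r) = 0"
  by (metis double one_add_one)

lemma add_eq_0 [simp]: "x + y = 0 \<longleftrightarrow> x = y" for x y :: 'r
  by (metis add.right_neutral double double_left)

lemma sg_add [simp]: "sg (x + y) = sg x + sg y"
  using frobenius_add[of x y "e + 1"] by (simp add: tits_sigma_def)

lemma sg_mult [simp]: "sg (x * y) = sg x * sg y"
  by (simp add: tits_sigma_def power_mult_distrib)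

lemma sg_0 [simp]: "sg 0 = 0" and sg_1 [simp]: "sg 1 = 1" and sg_power [simp]: "sg (x ^ n) = sg x ^ n"
  by (simp_all add: tits_sigma_def power_mult[symmetric] mult.commute)

text \<open>Two applications raise to the power \<open>2 ^ (2 * e + 2)\<close>, which is twice the
  order of the field: the Tits automorphism is a square root of the Frobenius map.\<close>

lemma sg_sg [simp]: "sg (sg x) = x ^ 2"
proof -
  have "sg (sg x) = (x ^ CARD('r)) ^ 2"
    unfolding card_r by (simp add: tits_sigma_def algebra_simps power2_eq_square flip: power_mult power_add)
      (simp add: mult_2_right power_add)
  then show ?thesis by (simp add: finite_field_pow_card)
qed

lemma sg_eq_0 [simp]: "sg x = 0 \<longleftrightarrow> x = 0"
  by (simp add: tits_sigma_def)

lemma sg_inj [simp]: "sg x = sg y \<longleftrightarrow> x = y"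
  using sg_eq_0[of "x - y"] by (simp del: sg_eq_0)

lemma sg_surj: "\<exists>x. sg x = y"
  using finite_UNIV_inj_surj[of sg] by (auto simp: inj_def surj_def) metis

lemma sg_divide [simp]: "sg (x / y) = sg x / sg y"
  by (simp add: tits_sigma_def power_divide)

lemma cv_nth [simp]: "cv s t $ 1 = 1" "cv s t $ 2 = s" "cv s t $ 3 = t" "cv s t $ 4 = vh s t"
  by (simp_all add: cv_def)

lemma e4_nth [simp]: "e4 $ 1 = 0" "e4 $ 2 = 0" "e4 $ 3 = 0" "e4 $ 4 = 1"
  by (simp_all add: e4_def)

lemma cv_eq_iff: "cv s t = cv s' t' \<longleftrightarrow> s = s' \<and> t = t'"
  by (auto simp: vec4_eq_iff)

lemma cv_nz [simp]: "cv s t \<noteq> 0" "e4 \<noteq> 0"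
  by (auto simp: vec4_eq_iff)

lemma canonical_tits_ovoid_eq:
  "canonical_tits_ovoid e = insert (vec.span {e4}) {vec.span {cv s t} | s t. True}"
  by (auto simp: canonical_tits_ovoid_def cv_def e4_def)

lemma card_ge_8: "CARD('r) \<ge> 8"
proof -
  have "(2::nat) ^ 3 \<le> 2 ^ (2 * e + 1)" using e by (intro power_increasing) auto
  then show ?thesis by (simp add: card_r)
qed

lemma ex_not_01: "\<exists>x::'r. x \<noteq> 0 \<and> x \<noteq> 1"
proof (rule ccontr)
  assume "\<not> ?thesis"
  then have "UNIV \<subseteq> {0, 1::'r}" by auto
  then have "CARD('r) \<le> card {0, 1::'r}" by (intro card_mono) auto
  then show False using card_ge_8 by simp
qed

text \<open>With S = \<open>2 ^ (e + 1)\<close> the exponents 1, 2, S and S + 2 are distinct and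
  less than r, both because e is at least 1. A polynomial of degree below r that vanishes on the
  whole field is zero.\<close>

lemma sparse_polynomial_zero:
  fixes a b c d :: 'r
  assumes "\<And>t. a * t + b * t ^ 2 + c * sg t + d * (sg t * t ^ 2) = 0"
  shows "a = 0 \<and> b = 0 \<and> c = 0 \<and> d = 0"
proof -
  define S :: nat where "S = 2 ^ (e + 1)"
  have S4: "S \<ge> 4" using e power_increasing[of 2 "e + 1" "2::nat"] by (simp add: S_def)
  have "S + 2 < CARD('r)"
  proof -
    have "S * 2 \<le> S * 2 ^ e" using e power_increasing[of 1 e "2::nat"] by simp
    also have "S * 2 ^ e = CARD('r)" by (simp add: card_r S_def mult_2 power_add distrib_right)
    finally show ?thesis using S4 by linarith
  qed
  define p where "p = monom a 1 + monom b 2 + monom c S + monom d (S + 2)"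
  have "poly p t = 0" for t
    using assms[of t] by (simp add: p_def poly_monom tits_sigma_def S_def power_add power2_eq_square mult_ac)
  then have roots: "{t. poly p t = 0} = UNIV" by auto
  have "p = 0"
  proof (rule ccontr)
    assume "p \<noteq> 0"
    then have "CARD('r) \<le> degree p" using card_poly_roots_bound[of p] roots by simp
    also have "degree p \<le> S + 2"
      unfolding p_def using S4 by (intro degree_add_le) (auto intro: order_trans[OF degree_monom_le])
    finally show False using \<open>S + 2 < CARD('r)\<close> by simp
  qed
  then have "coeff p n = 0" for n by simp
  from this[of 1] this[of 2] this[of S] this[of "S + 2"] show ?thesis
    using S4 by (simp add: p_def)
qed

text \<open>Expansion by \<open>sg_sg\<close>. The identity does double duty: it excludes further
  zeros of \<open>vh\<close>, and it is the ovoid equation after reversal of the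
  coordinates.\<close>

lemma vh_sg_identity: "sg s * vh s t ^ 2 + sg t * t ^ 2 + s * t * sg (vh s t) = vh s t * sg (vh s t)"
  by (simp add: power2_eq_square algebra_simps)

text \<open>If \<open>vh s t\<close> vanishes, only the term \<open>sg t * t ^ 2\<close> of
  \<open>vh_sg_identity\<close> survives.\<close>

lemma vh_eq_0: "vh s t = 0 \<longleftrightarrow> s = 0 \<and> t = 0"
proof
  assume v: "vh s t = 0"
  then have "sg t * t ^ 2 = 0" using vh_sg_identity[of s t] by simp
  then show "s = 0 \<and> t = 0" using v by auto
qed auto

subsection \<open>Matrices preserving the affine part of the ovoid\<close>

text \<open>Equality of vectors, not of points: the first coordinate fixes the scalar, so that each
  projectivity in question has one representative.\<close>

definition MG :: "('r ^ 4 ^ 4) set" where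
  "MG = {A. invertible A \<and> (\<forall>s t. \<exists>s' t'. A *v cv s t = cv s' t')}"

text \<open>The stabiliser of \<open>e4\<close> in the Suzuki group. The diagonal matrices
  \<open>Mm k 0 0\<close> fix \<open>cv 0 0\<close>; the matrices \<open>Mm 1 a b\<close> act
  regularly on the vectors \<open>cv s t\<close>, with \<open>cv 0 0\<close> going to
  \<open>cv a b\<close>.\<close>

definition Mm :: "'r \<Rightarrow> 'r \<Rightarrow> 'r \<Rightarrow> 'r ^ 4 ^ 4" where
  "Mm k a b = vector [vector [1, 0, 0, 0],
      vector [a, k, 0, 0],
      vector [b, sg a * k, sg k * k, 0],
      vector [vh a b, (b + sg a * a) * k, a * (sg k * k), sg k * k ^ 2]]"

lemma Mm_cv: "Mm k a b *v cv s t = cv (k * s + a) (sg k * k * t + sg a * k * s + b)"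
  by (simp add: Mm_def vec4_eq_iff matrix_vector_4 power2_eq_square algebra_simps)

lemma Mm_invertible: "k \<noteq> 0 \<Longrightarrow> invertible (Mm k a b)"
  unfolding invertible_iff_ker by (auto simp: Mm_def vec4_eq_iff matrix_vector_4)

lemma Mm_MG: "k \<noteq> 0 \<Longrightarrow> Mm k a b \<in> MG"
  by (auto simp: MG_def Mm_invertible Mm_cv)

lemma MG_one: "mat 1 \<in> MG"
  by (auto simp: MG_def invertible_def intro: exI[of _ "mat 1"])

lemma MG_mult: "A \<in> MG \<Longrightarrow> B \<in> MG \<Longrightarrow> A ** B \<in> MG"
  unfolding MG_def mem_Collect_eq matrix_vector_mul_assoc[symmetric]
  by (metis invertible_mult)

lemma MG_row:
  assumes "A \<in> MG" shows "(A *v cv s t) $ 1 = 1"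
proof -
  obtain s' t' where "A *v cv s t = cv s' t'" using assms unfolding MG_def by blast
  then show ?thesis by simp
qed

text \<open>Geometrically, every plane other than x_1 = 0 meets the affine part of the
  ovoid.\<close>

lemma row_const:
  assumes "\<And>s t. a + b * s + c * t + d * vh s t \<noteq> 0"
  shows "b = 0 \<and> c = 0 \<and> d = 0"
proof -
  have d: "d = 0"
  proof (rule ccontr)
    assume "d \<noteq> 0"
    \<comment> \<open>This choice cancels the terms linear in \<open>t\<close>; only
      \<open>d * sg t\<close> still depends on \<open>t\<close>, and \<open>sg\<close> is
      onto.\<close>
    define s where "s = c / d"
    obtain t where t: "sg t = (a + b * s) / d + sg s * s ^ 2" using sg_surj by blast
    have "a + b * s + c * t + d * vh s t = 0"
      using \<open>d \<noteq> 0\<close> by (simp add: t s_def field_simps) 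
    then show False using assms by blast
  qed
  have "b = 0"
  proof (rule ccontr)
    assume "b \<noteq> 0" then show False using assms[of "a / b" 0] d by simp
  qed
  moreover have "c = 0"
  proof (rule ccontr)
    assume "c \<noteq> 0" then show False using assms[of 0 "a / c"] d by simp
  qed
  ultimately show ?thesis using d by simp
qed

lemma MG_surj:
  assumes "A \<in> MG"
  shows "\<exists>s' t'. cv s t = A *v cv s' t'"
proof -
  let ?C = "range (\<lambda>(s, t). cv s t)"
  have C: "cv s t \<in> ?C" for s t by (auto intro: range_eqI[of _ _ "(s, t)"])
  have "A *v cv s t \<in> ?C" for s t using assms C by (auto simp: MG_def) metis
  then have "(*v) A ` ?C \<subseteq> ?C" by auto
  moreover have "inj_on ((*v) A) ?C"
    using assms by (auto simp: MG_def inj_on_def invertible_inj)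
  ultimately have "(*v) A ` ?C = ?C" by (intro endo_inj_surj) auto
  then have "cv s t \<in> (*v) A ` ?C" using C by simp
  then show ?thesis by auto
qed

text \<open>The first coordinate of \<open>A *v cv s t\<close> is a linear form without zeros on the
  affine part, hence constant. Division by this constant puts \<open>A\<close> into
  \<open>MG\<close>.\<close>

lemma row_const_matrix:
  assumes "invertible A" and A: "\<And>s t. \<exists>\<mu> s' t'. A *v cv s t = \<mu> *s cv s' t'"
  obtains c M where "c \<noteq> 0" "M \<in> MG" "A = mat c ** M"
proof -
  have ex: "\<exists>s' t'. A *v cv s t = (A *v cv s t) $ 1 *s cv s' t'" for s t
    using A[of s t] by (metis cv_nth(1) mult.right_neutral vector_smult_component)
  have "(A *v cv s t) $ 1 \<noteq> 0" for s t
    using ex[of s t] assms(1) cv_nz(1)[of s t] unfolding invertible_iff_ker by (metis vec.scale_zero_left)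
  then have "A $ 1 $ 1 + A $ 1 $ 2 * s + A $ 1 $ 3 * t + A $ 1 $ 4 * vh s t \<noteq> 0" for s t
    by (simp only: matrix_vector_4 cv_nth mult_1_right) blast
  then have z: "A $ 1 $ 2 = 0 \<and> A $ 1 $ 3 = 0 \<and> A $ 1 $ 4 = 0"
    by (intro row_const) blast
  define c where "c = A $ 1 $ 1"
  have row: "(A *v cv s t) $ 1 = c" for s t using z by (simp add: matrix_vector_4 c_def)
  have "c \<noteq> 0" using row \<open>\<And>t s. (A *v cv s t) $ 1 \<noteq> 0\<close> by metis
  define M where "M = mat (inverse c) ** A"
  have M: "M *v x = inverse c *s (A *v x)" for x
    by (simp add: M_def mat_mult_vector)
  have "M \<in> MG"
  proof -
    have "\<exists>s' t'. M *v cv s t = cv s' t'" for s t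
    proof -
      obtain s' t' where "A *v cv s t = c *s cv s' t'" using ex[of s t] row by metis
      then have "M *v cv s t = cv s' t'" using \<open>c \<noteq> 0\<close> by (simp add: M)
      then show ?thesis by blast
    qed
    moreover have "invertible M" using \<open>c \<noteq> 0\<close> assms(1) by (simp add: invertible_iff_ker M)
    ultimately show ?thesis by (simp add: MG_def)
  qed
  moreover have "A = mat c ** M" using \<open>c \<noteq> 0\<close> by (simp add: M_def vec_eq_iff mat_mult_component)
  ultimately show thesis using that \<open>c \<noteq> 0\<close> by blast
qed

text \<open>Every direction in the plane \<open>x\<^sub>1 = 0\<close> other than \<open>e4\<close> is the difference of two points of
  the ovoid, which characterises \<open>e4\<close>.\<close>

lemma MG_e4:
  assumes "A \<in> MG"
  obtains m where "m \<noteq> 0" "A *v e4 = m *s e4"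
proof -
  have inv: "invertible A" using assms by (simp add: MG_def)
  have A1: "(A *v cv s t) $ 1 = 1" for s t using assms by (simp add: MG_row)
  define d where "d = A *v e4"
  have d0: "d \<noteq> 0" using inv unfolding invertible_iff_ker d_def by auto
  have z: "A $ 1 $ 2 = 0 \<and> A $ 1 $ 3 = 0 \<and> A $ 1 $ 4 = 0"
  proof (rule row_const[of "A $ 1 $ 1"])
    show "A $ 1 $ 1 + A $ 1 $ 2 * s + A $ 1 $ 3 * t + A $ 1 $ 4 * vh s t \<noteq> 0" for s t
      using A1[of s t] by (simp only: matrix_vector_4 cv_nth mult_1_right) simp
  qed
  then have d1: "d $ 1 = 0" by (simp add: d_def matrix_vector_4)
  have "d $ 2 = 0 \<and> d $ 3 = 0"
  proof (rule ccontr)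
    assume nz: "\<not> ?thesis"
    define x y w where "x = d $ 2" "y = d $ 3" "w = d $ 4"
    \<comment> \<open>A chord of direction (0, x, y, w) is sought. If \<open>x = 0\<close>, the
      difference of heights is \<open>s * y + sg y\<close>, to be solved for \<open>s\<close>;
      otherwise \<open>s = 0\<close> is possible and \<open>t\<close> enters only through
      \<open>x * t\<close>.\<close>
    have "\<exists>s t. vh (s + x) (t + y) + vh s t = w"
    proof (cases "x = 0")
      case True
      then have "y \<noteq> 0" using nz by (simp add: x_y_w_def)
      define s where "s = (w + sg y) / y"
      have "s * y = w + sg y" using \<open>y \<noteq> 0\<close> by (simp add: s_def)
      then have "vh (s + x) (0 + y) + vh s 0 = w" using True by (simp add: ac_simps)
      then show ?thesis by blast
    next
      case False
      define t where "t = (w + x * y + sg x * x ^ 2 + sg y) / x"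
      have "x * t = w + x * y + sg x * x ^ 2 + sg y" using False by (simp add: t_def)
      then have "vh (0 + x) (t + y) + vh 0 t = w" by (simp add: distrib_left ac_simps)
      then show ?thesis by blast
    qed
    then obtain s t where st: "vh (s + x) (t + y) + vh s t = w" by blast
    have "d = cv (s + x) (t + y) - cv s t"
      unfolding vec4_eq_iff vector_minus_component cv_nth diff_eq_add st using d1
      by (simp add: x_y_w_def)
    moreover obtain s1 t1 where 1: "cv (s + x) (t + y) = A *v cv s1 t1" using MG_surj[OF assms] by blast
    moreover obtain s2 t2 where 2: "cv s t = A *v cv s2 t2" using MG_surj[OF assms] by blast
    \<comment> \<open>Pulled back by \<open>A\<close>, the chord has direction \<open>e4\<close>;
      but two vectors \<open>cv s t\<close> that agree in the second and third coordinates
      coincide.\<close>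
    ultimately have "A *v e4 = A *v (cv s1 t1 - cv s2 t2)" by (simp add: d_def vec.diff)
    then have "e4 = cv s1 t1 - cv s2 t2" using inv by (simp only: invertible_inj)
    then show False by (auto simp: vec4_eq_iff)
  qed
  then have "d = d $ 4 *s e4" using d1 by (simp add: vec4_eq_iff)
  moreover from this d0 have "d $ 4 \<noteq> 0" by auto
  ultimately show thesis using that unfolding d_def by blast
qed

text \<open>Fixing \<open>cv 0 0\<close>, and \<open>e4\<close> up to a factor \<open>m\<close>,
  leaves six other unknown entries. Comparing heights for s = 0 and for t = 0 settles four of them
  and expresses \<open>m\<close> in terms of \<open>k\<close> and of \<open>d\<close>; one mixed
  value ties \<open>d\<close> to \<open>k\<close>.\<close>

lemma MG_stabiliser:
  assumes "B \<in> MG" "B *v cv 0 0 = cv 0 0"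
  shows "\<exists>k. k \<noteq> 0 \<and> B = Mm k 0 0"
proof -
  have inv: "invertible B" using assms by (simp add: MG_def)
  obtain m where m: "m \<noteq> 0" "B *v e4 = m *s e4" using MG_e4[OF assms(1)] by blast
  have c4: "B $ 1 $ 4 = 0" "B $ 2 $ 4 = 0" "B $ 3 $ 4 = 0" "B $ 4 $ 4 = m"
    using m(2) by (auto simp: vec4_eq_iff matrix_vector_4)
  have c1: "B $ 1 $ 1 = 1" "B $ 2 $ 1 = 0" "B $ 3 $ 1 = 0" "B $ 4 $ 1 = 0"
    using assms(2) by (auto simp: vec4_eq_iff matrix_vector_4)
  have "B $ 1 $ 1 + B $ 1 $ 2 * s + B $ 1 $ 3 * t + B $ 1 $ 4 * vh s t \<noteq> 0" for s t
  proof -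
    have "(B *v cv s t) $ 1 = 1" using assms by (simp add: MG_row)
    then show ?thesis by (simp only: matrix_vector_4 cv_nth mult_1_right) simp
  qed
  then have r1: "B $ 1 $ 2 = 0" "B $ 1 $ 3 = 0" by (meson row_const)+
  define k p c d g l where kd: "k = B $ 2 $ 2" "p = B $ 2 $ 3" "c = B $ 3 $ 2" "d = B $ 3 $ 3"
    "g = B $ 4 $ 2" "l = B $ 4 $ 3"
  have eq: "vh (k * s + p * t) (c * s + d * t) = g * s + l * t + m * vh s t" for s t
  proof -
    obtain s' t' where "B *v cv s t = cv s' t'" using assms unfolding MG_def by blast
    then show ?thesis by (simp add: vec4_eq_iff matrix_vector_4 c4 c1 r1 kd)
  qed
  have "l * t + (p * d) * t ^ 2 + (sg d + m) * sg t + (sg p * p ^ 2) * (sg t * t ^ 2) = 0" for t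
    using eq[of 0 t] by (simp add: power2_eq_square algebra_simps)
  from sparse_polynomial_zero[OF this] have 1: "l = 0" "p = 0" by auto
  have "g * s + (k * c) * s ^ 2 + sg c * sg s + (sg k * k ^ 2 + m) * (sg s * s ^ 2) = 0" for s
    using eq[of s 0] by (simp add: power2_eq_square algebra_simps)
  from sparse_polynomial_zero[OF this] have 2: "g = 0" "c = 0" "sg k * k ^ 2 + m = 0" by auto
  then have mk: "m = sg k * k ^ 2" by (metis double_left add.right_neutral)
  \<comment> \<open>Here \<open>vh 1 1 = 1\<close>, as three ones add up to one. With both
    expressions for \<open>m\<close> this isolates \<open>k * d\<close>.\<close>
  have "k * d + sg k * k ^ 2 + sg d = m" using eq[of 1 1] 1 2 by simp
  moreover have "sg d = m"
    using sparse_polynomial_zero[OF \<open>\<And>t. l * t + (p * d) * t ^ 2 + (sg d + m) * sg t + (sg p * p ^ 2) * (sg t * t ^ 2) = 0\<close>]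
    by (metis double_left add.right_neutral)
  ultimately have kd': "k * d = sg k * k ^ 2" by (metis mk double_left add.commute)
  have k0: "k \<noteq> 0" using mk m by auto
  then have "d = sg k * k" using kd' by (simp add: power2_eq_square)
  then have "B = Mm k 0 0"
    using c1 c4 r1 kd 1 2 mk by (simp add: vec4_eq_iff Mm_def)
  with k0 show ?thesis by blast
qed

text \<open>These translations compose with a twist: the second parameter picks up
  \<open>sg a\<close> times the first, whence the correction \<open>sg a * a\<close>.\<close>

lemma Mm_transl_inverse: "Mm 1 a b ** Mm 1 a (b + sg a * a) = mat 1"
  by (simp add: vec4_eq_iff Mm_def matrix_matrix_4 power2_eq_square algebra_simps)

lemma MG_eq: "MG = (\<lambda>(k, a, b). Mm k a b) ` ((- {0}) \<times> UNIV \<times> UNIV)"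
proof (intro equalityI subsetI)
  fix A assume A: "A \<in> MG"
  obtain a b where ab: "A *v cv 0 0 = cv a b" using A unfolding MG_def by blast
  \<comment> \<open>The translation taking \<open>cv a b\<close> back to \<open>cv 0 0\<close>; what
    remains of \<open>A\<close> stabilises \<open>cv 0 0\<close>.\<close>
  let ?T = "Mm 1 a (b + sg a * a)"
  have "?T ** A \<in> MG" using A Mm_MG[of 1] by (intro MG_mult) auto
  moreover have "(?T ** A) *v cv 0 0 = cv 0 0"
    by (simp add: ab Mm_cv flip: matrix_vector_mul_assoc)
  ultimately obtain k where k: "k \<noteq> 0" "?T ** A = Mm k 0 0" using MG_stabiliser by blast
  have "A = Mm 1 a b ** Mm k 0 0"
    using Mm_transl_inverse[of a b] by (simp add: matrix_mul_assoc flip: k(2))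
  also have "\<dots> = Mm k a b"
    by (simp add: vec4_eq_iff Mm_def matrix_matrix_4 power2_eq_square algebra_simps)
  finally show "A \<in> (\<lambda>(k, a, b). Mm k a b) ` ((- {0}) \<times> UNIV \<times> UNIV)"
    using k(1) by (auto intro!: image_eqI[of _ _ "(k, a, b)"])
qed (use Mm_MG in auto)

lemma Mm_inj: "Mm k a b = Mm k' a' b' \<longleftrightarrow> k = k' \<and> a = a' \<and> b = b'"
  by (auto simp: Mm_def vec4_eq_iff)

lemma card_MG: "card MG = (CARD('r) - 1) * CARD('r) ^ 2"
proof -
  have "inj_on (\<lambda>(k, a, b). Mm k a b) ((- {0}) \<times> UNIV \<times> UNIV)"
    by (auto simp: inj_on_def Mm_inj)
  then show ?thesis
    by (simp add: MG_eq card_image card_cartesian_product power2_eq_square Compl_eq_Diff_UNIV card_Diff_singleton)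
qed

text \<open>The images of \<open>cv 0 0\<close> and \<open>cv 1 0\<close> already reveal
  \<open>a\<close>, \<open>b\<close> and \<open>k\<close>.\<close>

lemma MG_ext: 
  assumes "A \<in> MG" "B \<in> MG" "\<And>s t. A *v cv s t = B *v cv s t"
  shows "A = B"
proof -
  obtain k a b where A: "A = Mm k a b" using assms(1) by (auto simp: MG_eq)
  obtain k' a' b' where B: "B = Mm k' a' b'" using assms(2) by (auto simp: MG_eq)
  show ?thesis using assms(3)[of 0 0] assms(3)[of 1 0] by (simp add: A B Mm_cv cv_eq_iff)
qed

subsection \<open>Transitivity on the ovoid\<close>

abbreviation Omega :: "('r ^ 4) set set" where "Omega \<equiv> canonical_tits_ovoid e"

text \<open>Reversal of coordinates, an element of the Suzuki group that swaps the points
  \<open>e4\<close> and \<open>cv 0 0\<close> and so supplements \<open>MG\<close>, which fixes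
  \<open>e4\<close>.\<close>

definition Jm :: "'r ^ 4 ^ 4" where
  "Jm = vector [vector [0, 0, 0, 1], vector [0, 0, 1, 0], vector [0, 1, 0, 0], vector [1, 0, 0, 0]]"

lemma Jm_nth: "(Jm *v x) $ 1 = x $ 4" "(Jm *v x) $ 2 = x $ 3" "(Jm *v x) $ 3 = x $ 2" "(Jm *v x) $ 4 = x $ 1"
  by (simp_all add: Jm_def matrix_vector_4)

lemma Jm_invertible: "invertible Jm"
  unfolding invertible_iff_ker by (auto simp: vec4_eq_iff Jm_nth)

lemma Jm_e4: "Jm *v e4 = cv 0 0" "Jm *v cv 0 0 = e4"
  by (simp_all add: vec4_eq_iff Jm_nth)

text \<open>After division by \<open>v\<close>, the ovoid equation of the reversed vector is
  \<open>vh_sg_identity\<close> divided by \<open>v * sg v\<close>.\<close>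

lemma Jm_cv:
  assumes v: "vh s t = v" and "v \<noteq> 0"
  shows "Jm *v cv s t = v *s cv (t / v) (s / v)"
proof -
  have id: "s * t * sg v + sg t * t ^ 2 + sg s * v ^ 2 = v * sg v"
    using vh_sg_identity[of s t] unfolding v by (simp only: ac_simps)
  \<comment> \<open>\<open>V\<close> stands for \<open>sg v\<close> and keeps it opaque during the
    field arithmetic.\<close>
  have "v * (t / v * (s / v) + sg t / V * (t / v) ^ 2 + sg s / V) = (s * t * V + sg t * t ^ 2 + sg s * v ^ 2) / (v * V)"
    if "V \<noteq> 0" for V
    using \<open>v \<noteq> 0\<close> that by (simp add: field_simps power2_eq_square)
  from this[of "sg v"] have "v * vh (t / v) (s / v) = 1"
    using \<open>v \<noteq> 0\<close> unfolding id by simp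
  then show ?thesis using \<open>v \<noteq> 0\<close> v by (simp only: vec4_eq_iff Jm_nth cv_nth vector_smult_component) simp
qed

definition preserves_ovoid :: "'r ^ 4 ^ 4 \<Rightarrow> bool" where
  "preserves_ovoid A \<longleftrightarrow> invertible A \<and> (\<lambda>X. (*v) A ` X) ` Omega = Omega"

text \<open>\<open>A\<close> acts injectively on the finite ovoid, so mapping it into itself is
  enough.\<close>

lemma preserves_ovoidI:
  assumes "invertible A" "vec.span {A *v e4} \<in> Omega" "\<And>s t. vec.span {A *v cv s t} \<in> Omega"
  shows "preserves_ovoid A"
proof -
  have "(*v) A ` X \<in> Omega" if "X \<in> Omega" for X
  proof -
    have "X = vec.span {e4} \<or> (\<exists>s t. X = vec.span {cv s t})"
      using that by (simp add: canonical_tits_ovoid_eq)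
    then show ?thesis using assms(2,3) image_matrix_span by metis
  qed
  then have "(\<lambda>X. (*v) A ` X) ` Omega \<subseteq> Omega" by blast
  moreover have "inj_on (\<lambda>X. (*v) A ` X) Omega"
    using assms(1) by (intro inj_onI) (metis invertible_inj injI inj_image_eq_iff)
  ultimately have "(\<lambda>X. (*v) A ` X) ` Omega = Omega"
    by (intro endo_inj_surj) auto
  then show ?thesis using assms(1) by (simp add: preserves_ovoid_def)
qed

lemma MG_preserves:
  assumes "A \<in> MG" shows "preserves_ovoid A"
proof (rule preserves_ovoidI)
  show "invertible A" using assms by (simp add: MG_def)
  obtain m where "m \<noteq> 0" "A *v e4 = m *s e4" using MG_e4[OF assms] by blast
  then show "vec.span {A *v e4} \<in> Omega" by (simp add: span_singleton_scale canonical_tits_ovoid_eq)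
  fix s t
  obtain s' t' where "A *v cv s t = cv s' t'" using assms unfolding MG_def by blast
  then show "vec.span {A *v cv s t} \<in> Omega" by (auto simp: canonical_tits_ovoid_eq)
qed

lemma Jm_preserves: "preserves_ovoid Jm"
proof (rule preserves_ovoidI)
  show "vec.span {Jm *v cv s t} \<in> Omega" for s t
  proof (cases "s = 0 \<and> t = 0")
    case False
    obtain v where v: "vh s t = v" by blast
    have "v \<noteq> 0" using False vh_eq_0[of s t] v by blast
    then have "vec.span {Jm *v cv s t} = vec.span {cv (t / v) (s / v)}"
      by (simp add: Jm_cv[OF v] span_singleton_scale)
    then show ?thesis by (auto simp: canonical_tits_ovoid_eq)
  qed (simp add: Jm_e4 canonical_tits_ovoid_eq)
qed (auto simp: Jm_e4 canonical_tits_ovoid_eq Jm_invertible)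

lemma preserves_comp:
  assumes "preserves_ovoid A" "preserves_ovoid B" shows "preserves_ovoid (A ** B)"
proof -
  have "(\<lambda>X. (*v) (A ** B) ` X) ` Omega = (\<lambda>X. (*v) A ` X) ` (\<lambda>X. (*v) B ` X) ` Omega"
    by (simp add: image_image flip: matrix_vector_mul_assoc)
  then show ?thesis using assms by (simp add: preserves_ovoid_def invertible_mult)
qed

lemma ovoid_to_e4:
  assumes "Q \<in> Omega"
  obtains A where "preserves_ovoid A" "(*v) A ` Q = vec.span {e4}"
proof (cases "Q = vec.span {e4}")
  case True
  then show ?thesis using that[of "mat 1"] MG_preserves[OF MG_one] by simp
next
  case False
  then obtain s t where Q: "Q = vec.span {cv s t}" using assms by (auto simp: canonical_tits_ovoid_eq)
  \<comment> \<open>\<open>?T\<close> moves \<open>cv s t\<close> to \<open>cv 0 0\<close>, and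
    \<open>Jm\<close> carries that on to \<open>e4\<close>.\<close>
  let ?T = "Mm 1 s (t + sg s * s)"
  have T: "?T *v cv s t = cv 0 0"  by (simp add: Mm_cv)
  have "preserves_ovoid (Jm ** ?T)"
    by (intro preserves_comp Jm_preserves MG_preserves Mm_MG) simp
  moreover have "(*v) (Jm ** ?T) ` Q = vec.span {e4}"
    unfolding Q image_matrix_span by (simp add: T Jm_e4 flip: matrix_vector_mul_assoc)
  ultimately show ?thesis using that by blast
qed

end

section \<open>Projective points and the maps induced by matrices\<close>

lemma pg_points_eq: "pg_points = {vec.span {v} | v. v \<noteq> (0 :: 'a::field^'n)}"
proof (intro equalityI subsetI)
  fix U :: "('a^'n) set" assume "U \<in> pg_points"
  then have U: "vec.subspace U" "vec.dim U = 1" by (auto simp: pg_points_def)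
  obtain B where B: "B \<subseteq> U" "vec.independent B" "U \<subseteq> vec.span B" "card B = vec.dim U"
    using vec.basis_exists by blast
  then obtain v where "B = {v}" using U(2) by (metis card_1_singletonE)
  then have "v \<noteq> 0" "U = vec.span {v}"
    using B U(1) vec.span_minimal[of "{v}" U] by auto
  then show "U \<in> {vec.span {v} | v. v \<noteq> 0}" by blast
qed (auto simp: pg_points_def)

lemma span_in_pg_points [simp]: "vec.span {v} \<in> pg_points \<longleftrightarrow> v \<noteq> 0"
  by (auto simp: pg_points_def)

definition pg_map :: "'a::field^'n^'n \<Rightarrow> ('a^'n) set \<Rightarrow> ('a^'n) set" where
  "pg_map A = restrict (\<lambda>X. (*v) A ` X) pg_points"

lemma pg_map_span: "v \<noteq> 0 \<Longrightarrow> pg_map A (vec.span {v}) = vec.span {A *v v}"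
  by (simp add: pg_map_def image_matrix_span)

lemma invertible_nz: "invertible A \<Longrightarrow> A *v v = 0 \<longleftrightarrow> v = 0" for A :: "'a::field^'n^'n"
  using invertible_inj[of A v 0] by simp

lemma pg_map_compose:
  assumes "invertible B"
  shows "compose pg_points (pg_map A) (pg_map B) = pg_map (A ** B)"
proof
  fix X
  show "compose pg_points (pg_map A) (pg_map B) X = pg_map (A ** B) X"
  proof (cases "X \<in> pg_points")
    case True
    then obtain v where "X = vec.span {v}" "v \<noteq> 0" by (auto simp: pg_points_eq)
    then show ?thesis using assms
      by (simp add: compose_def pg_map_span invertible_nz matrix_vector_mul_assoc)
  qed (simp add: compose_def pg_map_def)
qed

lemma pg_map_one: "pg_map (mat 1) = restrict id pg_points"
  by (simp add: pg_map_def id_def)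

lemma pg_map_Bij:
  assumes "invertible A" shows "pg_map A \<in> Bij pg_points"
proof -
  obtain B where B: "A ** B = mat 1" "B ** A = mat 1" using assms unfolding invertible_def by blast
  then have iB: "invertible B" unfolding invertible_def by blast
  have map: "pg_map C X \<in> pg_points" if "invertible C" "X \<in> pg_points" for C :: "'a^'n^'n" and X
    using that by (auto simp: pg_points_eq pg_map_span invertible_nz)
  have inv: "pg_map C (pg_map D X) = X" if "C ** D = mat 1" "invertible D" "X \<in> pg_points" for C D :: "'a^'n^'n" and X
    using fun_cong[OF pg_map_compose[OF that(2), of C], of X] that by (simp add: compose_def pg_map_one)
  have "bij_betw (pg_map A) pg_points pg_points"
    by (rule bij_betw_byWitness[where f' = "pg_map B"]) (use map[OF assms] map[OF iB] inv[OF B(1) iB] inv[OF B(2) assms] in \<open>simp_all add: image_subset_iff\<close>)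
  then show ?thesis by (auto simp: Bij_def pg_map_def)
qed

lemma carrier_PGL: "carrier PGL = {pg_map A | A. invertible A}"
  by (simp add: PGL_def pg_map_def)

section \<open>The group FH in coordinates\<close>

context tits_field
begin

lemma Omega_points: "Omega \<subseteq> pg_points"
  by (auto simp: canonical_tits_ovoid_eq)

definition MGgrp :: "('r ^ 4 ^ 4) monoid" where
  "MGgrp = \<lparr>carrier = MG, monoid.mult = (**), one = mat 1\<rparr>"

text \<open>A change of coordinates from the canonical ovoid with marked point \<open>Q\<close> to
  \<open>\<O>\<close> with marked point \<open>P\<close>. \<open>Q\<close> stays free because two
  choices of it are made.\<close>

definition adapted :: "'r ^ 4 ^ 4 \<Rightarrow> ('r ^ 4) set set \<Rightarrow> ('r ^ 4) set \<Rightarrow> ('r ^ 4) set \<Rightarrow> bool" where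
  "adapted M \<O> Q P \<longleftrightarrow> invertible M \<and> (\<lambda>X. (*v) M ` X) ` Omega = \<O> \<and> (*v) M ` Q = P"

text \<open>Both \<open>Q\<close> and the preimage of \<open>P\<close> can be moved to
  \<open>e4\<close> within the canonical ovoid. One move followed by the inverse of the other
  corrects the matrix that the definition of \<open>\<O>\<close> supplies.\<close>

lemma ex_adapted:
  assumes "tits_ovoid e \<O>" "P \<in> \<O>" "Q \<in> Omega"
  obtains M where "adapted M \<O> Q P"
proof -
  obtain A where A: "invertible A" "\<O> = pg_map A ` Omega"
    using assms(1) by (auto simp: tits_ovoid_def carrier_PGL)
  have img: "pg_map A X = (*v) A ` X" if "X \<in> Omega" for X
    using that Omega_points by (auto simp: pg_map_def)
  obtain Q' where Q': "Q' \<in> Omega" "P = (*v) A ` Q'" using assms(2) A(2) img by auto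
  obtain B where B: "preserves_ovoid B" "(*v) B ` Q' = vec.span {e4}" using ovoid_to_e4[OF Q'(1)] .
  obtain C where C: "preserves_ovoid C" "(*v) C ` Q = vec.span {e4}" using ovoid_to_e4[OF assms(3)] .
  obtain B' where B': "B ** B' = mat 1" "B' ** B = mat 1"
    using B(1) unfolding preserves_ovoid_def invertible_def by blast
  have cancel: "(*v) B' ` (*v) B ` X = X" for X
    by (simp add: image_image matrix_vector_mul_assoc B')
  have "(\<lambda>X. (*v) (A ** B' ** C) ` X) ` Omega = (\<lambda>X. (*v) A ` X) ` (\<lambda>X. (*v) B' ` X) ` (\<lambda>X. (*v) C ` X) ` Omega"
    by (simp add: image_image flip: matrix_vector_mul_assoc)
  also have "(\<lambda>X. (*v) C ` X) ` Omega = (\<lambda>X. (*v) B ` X) ` Omega"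
    using B(1) C(1) by (simp add: preserves_ovoid_def)
  also have "(\<lambda>X. (*v) B' ` X) ` (\<lambda>X. (*v) B ` X) ` Omega = Omega"
    by (simp only: image_image[of "\<lambda>X. (*v) B' ` X"] cancel image_ident)
  also have "(\<lambda>X. (*v) A ` X) ` Omega = \<O>" using A(2) img by auto
  finally have 1: "(\<lambda>X. (*v) (A ** B' ** C) ` X) ` Omega = \<O>" .
  have "(*v) (A ** B' ** C) ` Q = (*v) A ` (*v) B' ` (*v) C ` Q"
    by (simp add: image_image flip: matrix_vector_mul_assoc)
  also have "\<dots> = P" by (simp only: C(2) B(2)[symmetric] cancel Q'(2))
  finally have 2: "(*v) (A ** B' ** C) ` Q = P" .
  have "invertible (A ** B' ** C)"
    using A(1) B' C(1) by (auto simp: preserves_ovoid_def intro!: invertible_mult) (auto simp: invertible_def)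
  with 1 2 have "adapted (A ** B' ** C) \<O> Q P" by (simp add: adapted_def)
  then show thesis by (rule that)
qed

lemma FH_eq: "FH \<O> P = BijGroup pg_points\<lparr>carrier := {g \<in> carrier PGL. g ` \<O> = \<O> \<and> g P = P}\<rparr>"
  by (simp add: FH_def Sz_stabiliser_def PGL_def conj_assoc)

text \<open>Conjugation by \<open>M\<close> transports the question to the canonical ovoid and the
  point \<open>e4\<close>. There \<open>row_const_matrix\<close> applies, and the scalar it splits
  off is invisible in PGL.\<close>

lemma carrier_FH:
  assumes ad: "adapted M \<O> (vec.span {e4}) P" and N: "M ** N = mat 1" "N ** M = mat 1"
  shows "carrier (FH \<O> P) = (\<lambda>A. pg_map (M ** A ** N)) ` MG"
proof -
  have iM: "invertible M" and \<O>: "\<O> = (\<lambda>X. (*v) M ` X) ` Omega" and P: "P = vec.span {M *v e4}"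
    using ad by (auto simp: adapted_def image_matrix_span)
  have iN: "invertible N" using N unfolding invertible_def by blast
  have act: "pg_map B ((*v) M ` vec.span {v}) = (*v) M ` vec.span {(N ** B ** M) *v v}" if "v \<noteq> 0" for B v
    using that iM by (simp add: image_matrix_span pg_map_span invertible_nz matrix_vector_mul_assoc matrix_mul_assoc N(1))
  have injM: "(*v) M ` X = (*v) M ` Y \<longleftrightarrow> X = Y" for X Y
    using iM by (intro inj_image_eq_iff injI) (simp add: invertible_inj)
  show ?thesis
  proof (intro equalityI subsetI)
    fix g assume "g \<in> carrier (FH \<O> P)"
    then obtain B where B: "invertible B" "g = pg_map B" "g ` \<O> = \<O>" "g P = P"
      by (auto simp: FH_eq carrier_PGL)
    define A where "A = N ** B ** M"
    have iA: "invertible A" using iM iN B(1) by (simp add: A_def invertible_mult)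
    have "(*v) M ` vec.span {A *v e4} = (*v) M ` vec.span {e4}"
      using B(2,4) act[of e4 B] by (simp add: P A_def flip: image_matrix_span)
    then have Ae4: "vec.span {A *v e4} = vec.span {e4}" by (simp only: injM)
    have "\<exists>\<mu> s' t'. A *v cv s t = \<mu> *s cv s' t'" for s t
    proof -
      have "g ((*v) M ` vec.span {cv s t}) \<in> \<O>"
      proof -
        have "(*v) M ` vec.span {cv s t} \<in> \<O>" unfolding \<O> canonical_tits_ovoid_eq by blast
        then show ?thesis using B(3) by blast
      qed
      then have "vec.span {A *v cv s t} \<in> Omega"
        using act[of "cv s t" B] B(2) by (auto simp: \<O> A_def injM)
      \<comment> \<open>The point \<open>e4\<close> is already the image of itself.\<close>
      moreover have "vec.span {A *v cv s t} \<noteq> vec.span {e4}"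
      proof
        assume "vec.span {A *v cv s t} = vec.span {e4}"
        then have "vec.span {A *v cv s t} = vec.span {A *v e4}" using Ae4 by simp
        then obtain c where "c \<noteq> 0" "A *v cv s t = A *v (c *s e4)"
          using iA by (auto simp: span_singleton_eq_iff invertible_nz vec.scale)
        then have "cv s t = c *s e4" using iA by (simp only: invertible_inj)
        then show False by (auto simp: vec4_eq_iff)
      qed
      ultimately obtain s' t' where "vec.span {A *v cv s t} = vec.span {cv s' t'}"
        by (auto simp: canonical_tits_ovoid_eq)
      then show ?thesis using iA by (auto simp: span_singleton_eq_iff invertible_nz)
    qed
    then obtain c A' where A': "c \<noteq> 0" "A' \<in> MG" "A = mat c ** A'"
      using row_const_matrix[OF iA] by metis
    have Bv: "B *v v = c *s ((M ** A' ** N) *v v)" for v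
    proof -
      have "B = M ** A ** N" by (simp add: A_def matrix_mul_assoc N) (simp add: N flip: matrix_mul_assoc)
      then have "B *v v = M *v (A *v (N *v v))" by (simp flip: matrix_vector_mul_assoc)
      also have "\<dots> = c *s (M *v (A' *v (N *v v)))" by (simp add: A'(3) mat_mult_vector vec.scale)
      finally show ?thesis by (simp add: matrix_vector_mul_assoc matrix_mul_assoc)
    qed
    have "g = pg_map (M ** A' ** N)"
    proof
      fix X show "g X = pg_map (M ** A' ** N) X"
      proof (cases "X \<in> pg_points")
        case True
        then obtain v where "X = vec.span {v}" "v \<noteq> 0" by (auto simp: pg_points_eq)
        then show ?thesis using A'(1) by (simp add: B(2) pg_map_span Bv span_singleton_scale)
      qed (simp add: B(2) pg_map_def)
    qed
    then show "g \<in> (\<lambda>A. pg_map (M ** A ** N)) ` MG" using A'(2) by blast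
  next
    fix g assume "g \<in> (\<lambda>A. pg_map (M ** A ** N)) ` MG"
    then obtain A where A: "A \<in> MG" and g: "g = pg_map (M ** A ** N)" by blast
    have iA: "invertible A" and pA: "(\<lambda>X. (*v) A ` X) ` Omega = Omega"
      using MG_preserves[OF A] by (auto simp: preserves_ovoid_def)
    have NAM: "N ** (M ** A ** N) ** M = A" by (simp add: matrix_mul_assoc N) (simp add: N flip: matrix_mul_assoc)
    have gM: "g ((*v) M ` X) = (*v) M ` (*v) A ` X" if X: "X \<in> Omega" for X
    proof -
      obtain v where v: "X = vec.span {v}" "v \<noteq> 0"
        using X Omega_points by (auto simp: pg_points_eq)
      show ?thesis using act[OF v(2), of "M ** A ** N"] unfolding NAM by (simp add: g v(1) image_matrix_span[of A])
    qed
    have "g ` \<O> = (\<lambda>X. (*v) M ` X) ` (\<lambda>X. (*v) A ` X) ` Omega"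
      unfolding \<O> image_image using gM by (intro image_cong) (auto simp: image_image)
    then have "g ` \<O> = \<O>" unfolding pA \<O> .
    moreover obtain m where "m \<noteq> 0" "A *v e4 = m *s e4" using MG_e4[OF A] .
    then have "g P = P"
      using gM[of "vec.span {e4}"] by (simp add: P image_matrix_span canonical_tits_ovoid_eq span_singleton_scale vec.scale)
    moreover have "g \<in> carrier PGL" using iA iM iN by (auto simp: g carrier_PGL invertible_mult)
    ultimately show "g \<in> carrier (FH \<O> P)" by (simp add: FH_eq)
  qed
qed

lemma MG_compose:
  fixes M N :: "'r ^ 4 ^ 4"
  assumes N: "M ** N = mat 1" "N ** M = mat 1" and "A \<in> MG" "B \<in> MG"
  shows "compose pg_points (pg_map (M ** A ** N)) (pg_map (M ** B ** N)) = pg_map (M ** (A ** B) ** N)"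
proof -
  have "invertible M" "invertible N" using N unfolding invertible_def by blast+
  then have "invertible (M ** B ** N)" using assms(4) by (simp add: MG_def invertible_mult)
  moreover have "(M ** A ** N) ** (M ** B ** N) = M ** A ** (N ** M) ** B ** N" by (simp add: matrix_mul_assoc)
  then have "(M ** A ** N) ** (M ** B ** N) = M ** (A ** B) ** N" by (simp add: N matrix_mul_assoc)
  ultimately show ?thesis by (simp add: pg_map_compose)
qed

lemma pg_map_MG_inj:
  fixes M N :: "'r ^ 4 ^ 4"
  assumes N: "M ** N = mat 1" "N ** M = mat 1"
  shows "inj_on (\<lambda>A. pg_map (M ** A ** N)) MG"
proof (rule inj_onI)
  fix A B assume A: "A \<in> MG" and B: "B \<in> MG" and eq: "pg_map (M ** A ** N) = pg_map (M ** B ** N)"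
  have iM: "invertible M" using N unfolding invertible_def by blast
  show "A = B"
  proof (rule MG_ext[OF A B])
    fix s t
    have NM: "N *v (M *v v) = v" for v by (simp add: matrix_vector_mul_assoc N)
    have "pg_map (M ** C ** N) (vec.span {M *v cv s t}) = vec.span {M *v (C *v cv s t)}" for C
    proof -
      have "M *v cv s t \<noteq> 0" using iM by (simp add: invertible_nz)
      then have "pg_map (M ** C ** N) (vec.span {M *v cv s t}) = vec.span {(M ** C ** N) *v (M *v cv s t)}"
        by (rule pg_map_span)
      then show ?thesis by (simp only: matrix_vector_mul_assoc[symmetric] NM)
    qed
    then have "vec.span {M *v (A *v cv s t)} = vec.span {M *v (B *v cv s t)}" using eq by metis
    moreover have "M *v (A *v cv s t) \<noteq> 0" using iM A by (simp add: invertible_nz MG_def)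
    ultimately obtain c where "M *v (A *v cv s t) = M *v (c *s (B *v cv s t))"
      by (auto simp: span_singleton_eq_iff vec.scale)
    then have "A *v cv s t = c *s (B *v cv s t)" using iM by (simp only: invertible_inj)
    \<comment> \<open>Both first coordinates are 1, which pins the projective factor.\<close>
    moreover from this have "c = 1" using MG_row[OF A, of s t] MG_row[OF B, of s t] by simp
    ultimately show "A *v cv s t = B *v cv s t" by simp
  qed
qed

lemma group_FH:
  assumes ad: "adapted M \<O> (vec.span {e4}) P"
  shows "group (FH \<O> P)"
proof -
  obtain N where N: "M ** N = mat 1" "N ** M = mat 1" using ad by (auto simp: adapted_def invertible_def)
  let ?C = "{g \<in> carrier PGL. g ` \<O> = \<O> \<and> g P = P}"
  have C: "?C = (\<lambda>A. pg_map (M ** A ** N)) ` MG"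
    using carrier_FH[OF ad N] by (simp add: FH_eq)
  show ?thesis
    unfolding FH_eq
  proof (rule finite_BijGroup_group)
    show "?C \<subseteq> Bij pg_points" by (auto simp: carrier_PGL pg_map_Bij)
    show "restrict id pg_points \<in> ?C" unfolding C
      using N MG_one by (auto intro!: image_eqI[of _ _ "mat 1"] simp: pg_map_one)
    show "compose pg_points f g \<in> ?C" if "f \<in> ?C" "g \<in> ?C" for f g
      using that unfolding C by (auto simp: MG_compose[OF N] intro!: imageI MG_mult)
  qed simp
qed

lemma FH_iso:
  assumes ad: "adapted M \<O> (vec.span {e4}) P" and N: "M ** N = mat 1" "N ** M = mat 1"
  shows "(\<lambda>A. pg_map (M ** A ** N)) \<in> iso MGgrp (FH \<O> P)"
proof -
  have "invertible M" "invertible N" using N unfolding invertible_def by blast+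
  then have "pg_map (M ** A ** N) \<in> Bij pg_points" if "A \<in> MG" for A
    using that by (intro pg_map_Bij) (simp add: MG_def invertible_mult)
  then have "pg_map (M ** (A ** B) ** N) = pg_map (M ** A ** N) \<otimes>\<^bsub>FH \<O> P\<^esub> pg_map (M ** B ** N)"
    if "A \<in> MG" "B \<in> MG" for A B
    using that by (simp add: FH_eq BijGroup_compose MG_compose[OF N])
  then show ?thesis
    using carrier_FH[OF ad N] pg_map_MG_inj[OF N] by (auto simp: iso_def hom_def bij_betw_def MGgrp_def)
qed

end

section \<open>Coordinates with respect to a hyperplane at infinity\<close>

lemma in_span_pair: "v \<in> vec.span {a, b} \<longleftrightarrow> (\<exists>c d. v = c *s a + d *s b)" for v :: "'a::field^'n"
proof -
  have "v \<in> vec.span {a, b} \<longleftrightarrow> (\<exists>c d. v - c *s a = d *s b)"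
    by (auto simp: vec.span_insert vec.span_singleton image_iff)
  then show ?thesis by (simp add: diff_eq_eq add.commute)
qed

lemma in_span_single: "v \<in> vec.span {a} \<longleftrightarrow> (\<exists>c. v = c *s a)" for v :: "'a::field^'n"
  by (auto simp: vec.span_singleton)

lemma span_single_subset: "vec.subspace U \<Longrightarrow> vec.span {v} \<subseteq> U \<longleftrightarrow> v \<in> U" for v :: "'a::field^'n"
  by (meson empty_subsetI insert_subset order_trans vec.span_minimal vec.span_superset)

lemma pg_lines_eq: "pg_lines = {vec.span {a, b} | a b. a \<noteq> (0 :: 'a::field^'n) \<and> b \<notin> vec.span {a}}"
proof (intro equalityI subsetI)
  fix U :: "('a^'n) set" assume "U \<in> pg_lines"
  then have U: "vec.subspace U" "vec.dim U = 2" by (auto simp: pg_lines_def)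
  obtain B where B: "B \<subseteq> U" "vec.independent B" "U \<subseteq> vec.span B" "card B = vec.dim U"
    using vec.basis_exists by blast
  then obtain a b where ab: "B = {a, b}" "a \<noteq> b" using U(2) by (metis card_2_iff)
  have "U = vec.span {a, b}" using B U(1) ab vec.span_minimal[of B U] by auto
  moreover have "a \<noteq> 0" using B(2) ab vec.dependent_zero by blast
  moreover have "b \<notin> vec.span {a}"
  proof -
    have "{a, b} - {b} = {a}" using ab by auto
    then show ?thesis using B(2) ab unfolding vec.dependent_def by auto
  qed
  ultimately show "U \<in> {vec.span {a, b} | a b. a \<noteq> 0 \<and> b \<notin> vec.span {a}}" by blast
next
  fix U assume "U \<in> {vec.span {a, b} | a b. a \<noteq> (0 :: 'a^'n) \<and> b \<notin> vec.span {a}}"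
  then obtain a b where U: "U = vec.span {a, b}" "a \<noteq> 0" "b \<notin> vec.span {a}" by blast
  then have "vec.independent {b, a}" by (intro vec.independent_insertI) (simp_all add: vec.independent_empty)
  moreover have "a \<noteq> b" using U(3) vec.span_base by blast
  ultimately show "U \<in> pg_lines"
    using U(1) vec.dim_span_eq_card_independent[of "{b, a}"] by (simp add: pg_lines_def insert_commute)
qed

lemma points_on_nonempty_union:
  assumes "vec.subspace U" "U \<noteq> {0 :: 'a::field^'n}"
  shows "\<Union> (points_on U) = U"
proof (intro equalityI subsetI)
  fix v assume v: "v \<in> U"
  obtain w where w: "w \<in> U" "w \<noteq> 0" using assms vec.subspace_0 by blast
  define u where "u = (if v = 0 then w else v)"
  have u: "u \<in> U" "u \<noteq> 0" using v w by (auto simp: u_def)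
  then have "vec.span {u} \<in> points_on U" using assms(1) by (simp add: points_on_def span_single_subset)
  moreover have "v \<in> vec.span {u}" by (auto simp: u_def intro: vec.span_base vec.span_zero)
  ultimately show "v \<in> \<Union> (points_on U)" by blast
qed (auto simp: points_on_def)

lemma points_on_point:
  assumes "p \<in> pg_points" shows "points_on p = {p :: ('a::field^'n) set}"
proof -
  obtain v where v: "p = vec.span {v}" "v \<noteq> 0" using assms by (auto simp: pg_points_eq)
  have "q = p" if "q \<in> pg_points" "q \<subseteq> p" for q
  proof -
    obtain u where u: "q = vec.span {u}" "u \<noteq> 0" using \<open>q \<in> pg_points\<close> by (auto simp: pg_points_eq)
    then have "u \<in> vec.span {v}" using that v vec.span_base by blast
    then obtain c where "u = c *s v" by (auto simp: in_span_single)
    then show ?thesis using u v by (metis span_singleton_scale vec.scale_zero_left)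
  qed
  then show ?thesis using assms by (auto simp: points_on_def)
qed

lemma line_not_point: "l \<in> pg_lines \<Longrightarrow> l \<notin> pg_points"
  by (simp add: pg_lines_def pg_points_def)

definition vmap :: "('a \<Rightarrow> 'a) \<Rightarrow> 'a^'n \<Rightarrow> 'a^'n" where "vmap \<tau> x = (\<chi> i. \<tau> (x $ i))"

definition mmap :: "('a \<Rightarrow> 'a) \<Rightarrow> 'a^'n^'m \<Rightarrow> 'a^'n^'m" where "mmap \<tau> A = (\<chi> i j. \<tau> (A $ i $ j))"

lemma vmap_nth [simp]: "vmap \<tau> x $ i = \<tau> (x $ i)" by (simp add: vmap_def)

lemma mmap_nth [simp]: "mmap \<tau> A $ i $ j = \<tau> (A $ i $ j)" by (simp add: mmap_def)

lemma vmap_simps: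
  fixes \<tau> :: "'a::field \<Rightarrow> 'a"
  assumes "\<tau> \<in> field_auts"
  shows "vmap \<tau> (x + y) = vmap \<tau> x + vmap \<tau> y" "vmap \<tau> (x - y) = vmap \<tau> x - vmap \<tau> y" "vmap \<tau> (c *s x) = \<tau> c *s vmap \<tau> x"
    "vmap \<tau> x = 0 \<longleftrightarrow> x = 0" "vmap \<tau> 0 = 0" "vmap \<tau> (A *v x) = mmap \<tau> A *v vmap \<tau> x"
    "mmap \<tau> (A ** B) = mmap \<tau> A ** mmap \<tau> B" "mmap \<tau> (mat c) = mat (\<tau> c)" "vmap \<tau> x = vmap \<tau> y \<longleftrightarrow> x = y"
    "vmap \<tau> (axis i c) = axis i (\<tau> c)"
  by (auto simp: vec_eq_iff field_auts_simps[OF assms] field_autsD[OF assms] matrix_vector_mult_def matrix_matrix_mult_def mat_def axis_def)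

lemma vmap_id [simp]: "vmap id x = x" "mmap id A = A" "vmap (\<lambda>c. c) x = x" "mmap (\<lambda>c. c) A = A"
  by (simp_all add: vec_eq_iff)

lemma vmap_comp: "vmap \<tau> (vmap \<rho> x) = vmap (\<tau> \<circ> \<rho>) x" "mmap \<tau> (mmap \<rho> A) = mmap (\<tau> \<circ> \<rho>) A"
  by (simp_all add: vec_eq_iff)

lemma mmap_invertible:
  assumes "\<tau> \<in> field_auts" "invertible A" shows "invertible (mmap \<tau> A)"
  using assms(2) unfolding invertible_def by (metis vmap_simps(7,8)[OF assms(1)] field_auts_simps(2)[OF assms(1)])

lemma mult_axis: "(A *v axis i 1) $ j = A $ j $ i" for A :: "'a::comm_semiring_1^'n^'m"
  by (simp add: matrix_vector_mult_def axis_def if_distrib cong: if_cong)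

text \<open>A vector \<open>w0\<close> off a hyperplane and a basis \<open>b\<close> of that
  hyperplane. The index type \<open>'n\<close> belongs to the ambient space, \<open>'m\<close> to
  the hyperplane.\<close>

locale frame =
  fixes w0 :: "'q::{field,finite}^'n" and b :: "'m::finite \<Rightarrow> 'q^'n"
  assumes frame_indep: "\<And>c x. c *s w0 + (\<Sum>i\<in>UNIV. x $ i *s b i) = 0 \<Longrightarrow> c = 0 \<and> x = 0"
    and frame_spans: "\<And>v. \<exists>c x. v = c *s w0 + (\<Sum>i\<in>UNIV. x $ i *s b i)"
begin

definition B :: "'q^'m \<Rightarrow> 'q^'n" where "B x = (\<Sum>i\<in>UNIV. x $ i *s b i)"

definition Hyp :: "('q^'n) set" where "Hyp = range B"

lemma B_simps [simp]: "B 0 = 0"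
  by (simp add: B_def)

lemma B_add: "B (x + y) = B x + B y" and B_scale: "B (c *s x) = c *s B x" and B_diff: "B (x - y) = B x - B y"
  by (simp_all add: B_def vec.scale_left_distrib vec.scale_left_diff_distrib sum.distrib sum_subtractf vec.scale_sum_right)

lemma coords_eq_iff: "c *s w0 + B x = d *s w0 + B y \<longleftrightarrow> c = d \<and> x = y"
proof
  assume "c *s w0 + B x = d *s w0 + B y"
  then have "(c - d) *s w0 + B (x - y) = 0" by (simp add: B_diff vec.scale_left_diff_distrib algebra_simps)
  then show "c = d \<and> x = y" using frame_indep[of "c - d" "x - y"] by (simp add: B_def)
qed simp

lemma B_eq_iff: "B x = B y \<longleftrightarrow> x = y" and B_eq_0_iff [simp]: "B x = 0 \<longleftrightarrow> x = 0"
  and coords_eq_0_iff: "c *s w0 + B x = 0 \<longleftrightarrow> c = 0 \<and> x = 0"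
  and coords_eq_B: "c *s w0 + B x = B y \<longleftrightarrow> c = 0 \<and> x = y"
  and w0_B_nz [simp]: "w0 + B x \<noteq> 0"
  using coords_eq_iff[of 0 x 0 y] coords_eq_iff[of 0 x 0 0] coords_eq_iff[of c x 0 0] coords_eq_iff[of c x 0 y] coords_eq_iff[of 1 x 0 0]
  by auto

lemma coords_ex: "\<exists>c x. v = c *s w0 + B x"
  using frame_spans[of v] by (simp add: B_def)

definition wcoord :: "'q^'n \<Rightarrow> 'q" where "wcoord v = (SOME c. \<exists>x. v = c *s w0 + B x)"

definition hcoord :: "'q^'n \<Rightarrow> 'q^'m" where "hcoord v = (SOME x. v = wcoord v *s w0 + B x)"

lemma coords_decomp: "v = wcoord v *s w0 + B (hcoord v)"
proof -
  have "\<exists>x. v = wcoord v *s w0 + B x" unfolding wcoord_def by (rule someI_ex) (rule coords_ex)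
  then show ?thesis unfolding hcoord_def by (rule someI_ex)
qed

lemma coord_simps [simp]: "wcoord (c *s w0 + B x) = c" "hcoord (c *s w0 + B x) = x"
  using coords_decomp[of "c *s w0 + B x"] by (simp_all add: coords_eq_iff)

lemma subspace_Hyp: "vec.subspace Hyp"
  by (auto simp: Hyp_def vec.subspace_def B_add[symmetric] B_scale[symmetric] image_iff intro: exI[of _ 0] B_simps[symmetric])

lemma in_Hyp [simp]: "B x \<in> Hyp" "c *s w0 + B x \<in> Hyp \<longleftrightarrow> c = 0" "w0 + B x \<notin> Hyp"
  using coords_eq_B[of 1 x] by (auto simp: Hyp_def image_iff coords_eq_B)

text \<open>The coefficient of \<open>w0\<close> is normalised to 1, so affine points are the
  vectors \<open>x\<close> themselves, while directions count only up to a nonzero factor.\<close>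

definition aff :: "'q^'m \<Rightarrow> ('q^'n) set" where "aff x = vec.span {w0 + B x}"

definition inf :: "'q^'m \<Rightarrow> ('q^'n) set" where "inf x = vec.span {B x}"

definition ln :: "'q^'m \<Rightarrow> 'q^'m \<Rightarrow> ('q^'n) set" where "ln x d = vec.span {w0 + B x, B d}"

lemma subspace_aff [simp]: "vec.subspace (aff x)" "vec.subspace (inf x)" "vec.subspace (ln x d)"
  by (simp_all add: aff_def inf_def ln_def)

lemma aff_point [simp]: "aff x \<in> pg_points" "inf x \<in> pg_points \<longleftrightarrow> x \<noteq> 0"
  by (simp_all add: aff_def inf_def)

lemma aff_not_Hyp [simp]: "\<not> aff x \<subseteq> Hyp" "inf x \<subseteq> Hyp"
  by (simp_all add: aff_def inf_def span_single_subset subspace_Hyp)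

lemma points_cases:
  assumes "p \<in> pg_points"
  obtains x where "p = aff x" | x where "x \<noteq> 0" "p = inf x"
proof -
  obtain v where v: "p = vec.span {v}" "v \<noteq> 0" using assms by (auto simp: pg_points_eq)
  obtain c x where cx: "v = c *s w0 + B x" using coords_ex by blast
  show thesis
  proof (cases "c = 0")
    case True then show thesis using that(2)[of x] v cx by (auto simp: inf_def)
  next
    case False
    then have "v = c *s (w0 + B (inverse c *s x))" by (simp add: cx B_scale vec.scale_right_distrib)
    then have "p = aff (inverse c *s x)" using False by (simp add: v(1) aff_def span_singleton_scale)
    then show thesis by (rule that(1))
  qed
qed

lemma points_not_Hyp: "{p \<in> pg_points. \<not> p \<subseteq> Hyp} = range aff"
proof (intro equalityI subsetI)
  fix p assume "p \<in> {p \<in> pg_points. \<not> p \<subseteq> Hyp}"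
  then have p: "p \<in> pg_points" "\<not> p \<subseteq> Hyp" by blast+
  from p(1) show "p \<in> range aff"
  proof (cases rule: points_cases)
    case (2 x)
    then show ?thesis using aff_not_Hyp(2)[of x] p(2) by simp
  qed simp
qed auto

lemma points_on_Hyp: "points_on Hyp = {inf x | x. x \<noteq> 0}"
proof (intro equalityI subsetI)
  fix p assume "p \<in> points_on Hyp"
  then have p: "p \<in> pg_points" "p \<subseteq> Hyp" by (simp_all add: points_on_def)
  from p(1) show "p \<in> {inf x | x. x \<noteq> 0}"
  proof (cases rule: points_cases)
    case (1 x)
    then show ?thesis using aff_not_Hyp(1)[of x] p(2) by simp
  qed blast
next
  fix p assume "p \<in> {inf x | x. x \<noteq> 0}"
  then obtain x where "x \<noteq> 0" "p = inf x" by blast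
  then show "p \<in> points_on Hyp" by (simp add: points_on_def)
qed

text \<open>Incidence with affine points is the case \<open>c = 1\<close>, incidence with points at
  infinity the case \<open>c = 0\<close>.\<close>

lemma in_ln: "c *s w0 + B y \<in> ln x d \<longleftrightarrow> (\<exists>k. y = c *s x + k *s d)"
proof -
  have "c *s w0 + B y = c' *s (w0 + B x) + k *s B d \<longleftrightarrow> c' = c \<and> y = c *s x + k *s d" for c' k
  proof -
    have "c' *s (w0 + B x) + k *s B d = c' *s w0 + B (c' *s x + k *s d)"
      by (simp add: B_add B_scale vec.scale_right_distrib add.assoc)
    then show ?thesis using coords_eq_iff[of c y c' "c' *s x + k *s d"] by auto
  qed
  then show ?thesis by (auto simp: ln_def in_span_pair)
qed

lemma aff_sub_ln: "aff y \<subseteq> ln x d \<longleftrightarrow> (\<exists>k. y = x + k *s d)"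
  using in_ln[of 1 y x d] by (simp add: aff_def span_single_subset)

lemma inf_sub_ln: "inf y \<subseteq> ln x d \<longleftrightarrow> (\<exists>k. y = k *s d)"
  using in_ln[of 0 y x d] by (simp add: inf_def span_single_subset)

lemma aff_eq_iff [simp]: "aff x = aff y \<longleftrightarrow> x = y"
proof
  assume "aff x = aff y"
  then have "w0 + B x \<in> vec.span {w0 + B y}" unfolding aff_def using vec.span_base by blast
  then obtain c where "1 *s w0 + B x = c *s w0 + B (c *s y)"
    by (auto simp: in_span_single B_scale vec.scale_right_distrib)
  then show "x = y" unfolding coords_eq_iff by simp
qed simp

lemma inf_eq_iff: "x \<noteq> 0 \<Longrightarrow> inf x = inf y \<longleftrightarrow> (\<exists>c. c \<noteq> 0 \<and> x = c *s y)"
  using span_singleton_eq_iff[of "B x" "B y"] by (simp add: inf_def B_eq_iff flip: B_scale)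

lemma aff_neq_inf [simp]: "aff x \<noteq> inf y" "inf y \<noteq> aff x"
  using aff_not_Hyp by metis+

lemma ln_line [simp]: "d \<noteq> 0 \<Longrightarrow> ln x d \<in> pg_lines"
proof -
  assume d: "d \<noteq> 0"
  have "B d \<notin> vec.span {w0 + B x}"
  proof
    assume "B d \<in> vec.span {w0 + B x}"
    then obtain c where "c *s w0 + B (c *s x) = 0 *s w0 + B d"
      by (auto simp: in_span_single B_scale vec.scale_right_distrib)
    then show False unfolding coords_eq_iff using d by auto
  qed
  then show ?thesis unfolding ln_def pg_lines_eq using w0_B_nz by blast
qed

lemma ln_not_Hyp [simp]: "\<not> ln x d \<subseteq> Hyp"
  using in_ln[of 1 x x d] in_Hyp(3)[of x] by (auto intro: exI[of _ 0])

lemma lines_cases: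
  assumes "l \<in> pg_lines" "\<not> l \<subseteq> Hyp"
  obtains x d where "d \<noteq> 0" "l = ln x d"
proof -
  have l: "vec.subspace l" "vec.dim l = 2" using assms by (auto simp: pg_lines_def)
  obtain v where v: "v \<in> l" "v \<notin> Hyp" using assms by blast
  obtain c y where cy: "v = c *s w0 + B y" using coords_ex by blast
  then have c: "c \<noteq> 0" using v by auto
  define x where "x = inverse c *s y"
  have wx: "w0 + B x \<in> l"
    using vec.subspace_scale[OF l(1) v(1), of "inverse c"] c
    by (simp add: cy x_def B_scale vec.scale_right_distrib)
  have "\<not> l \<subseteq> vec.span {w0 + B x}"
  proof
    assume "l \<subseteq> vec.span {w0 + B x}"
    then have "vec.dim l \<le> card {w0 + B x}" by (rule vec.dim_le_card) simp
    then show False using l by simp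
  qed
  then obtain u where u: "u \<in> l" "u \<notin> vec.span {w0 + B x}" by blast
  obtain c' z where cz: "u = c' *s w0 + B z" using coords_ex by blast
  \<comment> \<open>Cancelling the \<open>w0\<close>-part of a second vector of the line leaves its
    point at infinity.\<close>
  define d where "d = z - c' *s x"
  have ud: "u - c' *s (w0 + B x) = B d"
    by (simp add: cz d_def B_diff B_scale vec.scale_right_distrib)
  then have "B d \<in> l" using vec.subspace_diff[OF l(1) u(1) vec.subspace_scale[OF l(1) wx, of c']] by simp
  have "d \<noteq> 0" using ud u(2) by (auto simp: in_span_single)
  have "ln x d \<subseteq> l"
    unfolding ln_def by (rule vec.span_minimal) (use wx \<open>B d \<in> l\<close> l(1) in auto)
  moreover have "vec.dim (ln x d) = 2" using ln_line[OF \<open>d \<noteq> 0\<close>, of x] by (simp add: pg_lines_def)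
  ultimately have "ln x d = l" using l(1,2) by (intro vec.subspace_dim_equal) simp_all
  then show thesis using that[of d x] \<open>d \<noteq> 0\<close> by simp
qed

lemma ln_shift:
  assumes "d \<noteq> 0" "y = x + k *s d" "d' = c *s d" "c \<noteq> 0"
  shows "ln y d' = ln x d"
proof -
  have "c' *s w0 + B z \<in> ln y d' \<longleftrightarrow> c' *s w0 + B z \<in> ln x d" for c' z
  proof -
    have "(\<exists>j. z = c' *s x + (c' * k + j * c) *s d) \<longleftrightarrow> (\<exists>j. z = c' *s x + j *s d)"
    proof
      assume "\<exists>j. z = c' *s x + j *s d"
      then obtain j where "z = c' *s x + j *s d" by blast
      then show "\<exists>j. z = c' *s x + (c' * k + j * c) *s d"
        using assms(4) by (intro exI[of _ "(j - c' * k) / c"]) simp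
    qed blast
    then show ?thesis
      by (simp add: in_ln assms(2,3) vec.scale_right_distrib vec.scale_left_distrib add.assoc)
  qed
  then show ?thesis using coords_ex by (metis (no_types, opaque_lifting) subsetI subset_antisym)
qed

lemma ln_eqD:
  assumes "d \<noteq> 0" "ln y d' = ln x d"
  shows "\<exists>k. y = x + k *s d" "\<exists>c. d' = c *s d"
  using assms aff_sub_ln[of y y d'] aff_sub_ln[of y x d] inf_sub_ln[of d' y d'] inf_sub_ln[of d' x d]
  by (auto intro: exI[of _ 0] exI[of _ 1])

text \<open>On affine coordinates this map is \<open>x \<mapsto> A x\<^sup>\<tau> + w\<close>; its restriction to the hyperplane is \<open>x \<mapsto> A x\<^sup>\<tau>\<close>.\<close>

definition sl :: "('q \<Rightarrow> 'q) \<Rightarrow> 'q^'m^'m \<Rightarrow> 'q^'m \<Rightarrow> 'q^'n \<Rightarrow> 'q^'n" where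
  "sl \<tau> A w v = \<tau> (wcoord v) *s (w0 + B w) + B (A *v vmap \<tau> (hcoord v))"

lemma sl_coords: "sl \<tau> A w (c *s w0 + B x) = \<tau> c *s w0 + B (\<tau> c *s w + A *v vmap \<tau> x)"
  by (simp add: sl_def B_add B_scale vec.scale_right_distrib add.assoc)

context
  fixes \<tau> :: "'q \<Rightarrow> 'q" and A :: "'q^'m^'m" and w :: "'q^'m"
  assumes \<tau>: "\<tau> \<in> field_auts" and A: "invertible A"
begin

lemma sl_add: "sl \<tau> A w (u + v) = sl \<tau> A w u + sl \<tau> A w v"
proof -
  obtain c x d y where uv: "u = c *s w0 + B x" "v = d *s w0 + B y" using coords_ex by metis
  have "u + v = (c + d) *s w0 + B (x + y)" by (simp add: uv B_add vec.scale_left_distrib)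
  then have "sl \<tau> A w (u + v) = \<tau> (c + d) *s w0 + B (\<tau> (c + d) *s w + A *v vmap \<tau> (x + y))"
    by (simp only: sl_coords)
  also have "\<dots> = sl \<tau> A w u + sl \<tau> A w v"
    by (simp add: uv sl_coords B_add B_scale vec.scale_left_distrib field_autsD[OF \<tau>] vmap_simps[OF \<tau>] vec.add)
  finally show ?thesis .
qed

lemma sl_scale: "sl \<tau> A w (k *s u) = \<tau> k *s sl \<tau> A w u"
proof -
  obtain c x where u: "u = c *s w0 + B x" using coords_ex by metis
  have "k *s u = (k * c) *s w0 + B (k *s x)" by (simp add: u B_scale vec.scale_right_distrib)
  then have "sl \<tau> A w (k *s u) = \<tau> (k * c) *s w0 + B (\<tau> (k * c) *s w + A *v vmap \<tau> (k *s x))"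
    by (simp only: sl_coords)
  also have "\<dots> = \<tau> k *s sl \<tau> A w u"
    by (simp add: u sl_coords B_add B_scale vec.scale_right_distrib field_autsD[OF \<tau>] vmap_simps[OF \<tau>] vec.scale)
  finally show ?thesis .
qed

lemma sl_eq_0: "sl \<tau> A w u = 0 \<longleftrightarrow> u = 0"
proof -
  obtain c x where u: "u = c *s w0 + B x" using coords_ex by metis
  show ?thesis
    by (auto simp: u sl_coords coords_eq_0_iff field_auts_simps[OF \<tau>] invertible_nz[OF A] vmap_simps[OF \<tau>])
qed

lemma sl_inj: "inj (sl \<tau> A w)"
proof (rule injI)
  fix u v assume "sl \<tau> A w u = sl \<tau> A w v"
  moreover have "sl \<tau> A w u = sl \<tau> A w (u - v) + sl \<tau> A w v" by (simp flip: sl_add)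
  ultimately show "u = v" using sl_eq_0[of "u - v"] by simp
qed

lemma sl_span_single: "sl \<tau> A w ` vec.span {u} = vec.span {sl \<tau> A w u}"
proof -
  have "surj \<tau>" using field_autsD(1)[OF \<tau>] by (simp add: bij_is_surj)
  have "range (\<lambda>k. \<tau> k *s sl \<tau> A w u) = (\<lambda>k. k *s sl \<tau> A w u) ` range \<tau>" by (simp add: image_image)
  then show ?thesis by (simp add: vec.span_singleton image_image sl_scale \<open>surj \<tau>\<close>)
qed

lemma sl_span_pair: "sl \<tau> A w ` vec.span {u, v} = vec.span {sl \<tau> A w u, sl \<tau> A w v}"
proof (intro equalityI subsetI)
  fix y assume "y \<in> vec.span {sl \<tau> A w u, sl \<tau> A w v}"
  then obtain c d where "y = c *s sl \<tau> A w u + d *s sl \<tau> A w v" by (auto simp: in_span_pair)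
  moreover obtain c' d' where "c = \<tau> c'" "d = \<tau> d'" using field_autsD(1)[OF \<tau>] by (metis bij_pointE)
  ultimately have "y = sl \<tau> A w (c' *s u + d' *s v)" by (simp add: sl_add sl_scale)
  moreover have "c' *s u + d' *s v \<in> vec.span {u, v}" unfolding in_span_pair by blast
  ultimately show "y \<in> sl \<tau> A w ` vec.span {u, v}" by blast
qed (auto simp: in_span_pair sl_add sl_scale, blast)

lemma sl_aff: "sl \<tau> A w ` aff x = aff (A *v vmap \<tau> x + w)"
  using sl_coords[of \<tau> A w 1 x] by (simp add: aff_def sl_span_single field_auts_simps[OF \<tau>] add.commute)

lemma sl_B: "sl \<tau> A w (B x) = B (A *v vmap \<tau> x)"
  using sl_coords[of \<tau> A w 0 x] by (simp add: field_auts_simps[OF \<tau>])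

lemma sl_w0: "sl \<tau> A w (w0 + B x) = w0 + B (A *v vmap \<tau> x + w)"
  using sl_coords[of \<tau> A w 1 x] by (simp add: field_auts_simps[OF \<tau>] add.commute)

lemma sl_inf: "sl \<tau> A w ` inf x = inf (A *v vmap \<tau> x)"
  by (simp add: inf_def sl_span_single sl_B)

lemma sl_ln: "sl \<tau> A w ` ln x d = ln (A *v vmap \<tau> x + w) (A *v vmap \<tau> d)"
  by (simp add: ln_def sl_span_pair sl_B sl_w0)

lemma sl_point: "p \<in> pg_points \<Longrightarrow> sl \<tau> A w ` p \<in> pg_points"
  unfolding pg_points_eq using sl_eq_0 sl_span_single by fastforce

lemma sl_line:
  assumes "l \<in> pg_lines" shows "sl \<tau> A w ` l \<in> pg_lines"
proof -
  obtain u v where l: "l = vec.span {u, v}" "u \<noteq> 0" "v \<notin> vec.span {u}" using assms by (auto simp: pg_lines_eq)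
  have "sl \<tau> A w v \<notin> sl \<tau> A w ` vec.span {u}" using l(3) sl_inj by (simp add: inj_image_mem_iff)
  then show ?thesis using l(1,2) sl_eq_0[of u] by (auto simp: pg_lines_eq sl_span_pair sl_span_single)
qed

lemma sl_image_inj: "sl \<tau> A w ` X = sl \<tau> A w ` Y \<longleftrightarrow> X = Y"
  using sl_inj by (rule inj_image_eq_iff)

lemma sl_image_subset: "sl \<tau> A w ` X \<subseteq> sl \<tau> A w ` Y \<longleftrightarrow> X \<subseteq> Y"
  using sl_inj by (rule inj_image_subset_iff)

end

lemma sl_comp:
  assumes "\<tau> \<in> field_auts" "\<rho> \<in> field_auts"
  shows "sl \<tau> A w (sl \<rho> C u v) = sl (\<tau> \<circ> \<rho>) (A ** mmap \<tau> C) (A *v vmap \<tau> u + w) v"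
proof -
  obtain c x where v: "v = c *s w0 + B x" using coords_ex by metis
  show ?thesis
    by (simp add: v sl_coords vmap_simps[OF assms(1)] vec.add vec.scale vec.scale_right_distrib
        vmap_comp matrix_vector_mul_assoc[symmetric] add_ac)
qed

lemma sl_ident: "sl id (mat 1) 0 v = v"
  by (simp add: sl_def flip: coords_decomp)

text \<open>\<open>D\<close> is the set of points when the map serves as a collineation, and the set
  of vertices when it acts on the graph.\<close>

definition act :: "('q^'n) set set \<Rightarrow> ('q \<Rightarrow> 'q) \<Rightarrow> 'q^'m^'m \<Rightarrow> 'q^'m \<Rightarrow> ('q^'n) set \<Rightarrow> ('q^'n) set" where
  "act D \<tau> A w = restrict (\<lambda>X. sl \<tau> A w ` X) D"

lemma act_compose:
  assumes "\<tau> \<in> field_auts" "\<rho> \<in> field_auts" "\<And>X. X \<in> D \<Longrightarrow> sl \<rho> C u ` X \<in> D"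
  shows "compose D (act D \<tau> A w) (act D \<rho> C u) = act D (\<tau> \<circ> \<rho>) (A ** mmap \<tau> C) (A *v vmap \<tau> u + w)"
  using assms(3) by (auto simp: act_def compose_def fun_eq_iff image_image sl_comp[OF assms(1,2)])

lemma act_ident: "act D id (mat 1) 0 = restrict id D"
  by (auto simp: act_def fun_eq_iff sl_ident)

lemma act_Bij:
  assumes "\<tau> \<in> field_auts" "invertible A" "\<And>X. X \<in> D \<Longrightarrow> sl \<tau> A w ` X \<in> D"
  shows "act D \<tau> A w \<in> Bij D"
proof -
  have "inj_on (act D \<tau> A w) D" using sl_image_inj[OF assms(1,2)] by (auto simp: act_def inj_on_def)
  moreover have "act D \<tau> A w ` D \<subseteq> D" using assms(3) by (auto simp: act_def)
  ultimately have "bij_betw (act D \<tau> A w) D D" by (simp add: bij_betw_def endo_inj_surj)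
  then show ?thesis by (auto simp: Bij_def act_def)
qed

text \<open>The origin shows the translation, the unit vectors, which \<tau> fixes, show the matrix,
  and the constant vectors show \<tau>. Affine points alone suffice.\<close>

lemma act_eqD:
  assumes "\<tau> \<in> field_auts" "\<rho> \<in> field_auts" "invertible A" "invertible C" "range aff \<subseteq> D"
    "act D \<tau> A w = act D \<rho> C u"
  shows "\<tau> = \<rho>" "A = C" "w = u"
proof -
  have eq: "A *v vmap \<tau> x + w = C *v vmap \<rho> x + u" for x
  proof -
    have "act D \<tau> A w (aff x) = act D \<rho> C u (aff x)" using assms by simp
    then show ?thesis using assms(5) by (simp add: act_def range_subsetD sl_aff assms(1-4))
  qed
  from this[of 0] show w: "w = u" using assms by (simp add: vmap_simps)
  have eq': "A *v vmap \<tau> x = C *v vmap \<rho> x" for x using eq[of x] w by simp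
  have AC: "A *v axis i 1 = C *v axis i 1" for i
    using eq'[of "axis i 1"] by (simp add: vmap_simps assms field_auts_simps)
  have "A $ j $ i = C $ j $ i" for i j using arg_cong[OF AC[of i], of "\<lambda>v. v $ j"] by (simp add: mult_axis)
  then show "A = C" by (simp add: vec_eq_iff)
  then have "vmap \<tau> x = vmap \<rho> x" for x :: "'q^'m" using eq'[of x] invertible_inj[OF assms(3)] by simp
  from this[of "vec c" for c] have "\<tau> c = \<rho> c" for c by (simp add: vec_eq_iff)
  then show "\<tau> = \<rho>" by blast
qed

end

section \<open>The fundamental theorem of affine geometry\<close>

lemma ex_not_multiple:
  fixes x :: "'a::field^'n"
  assumes "CARD('n) \<ge> 2" "x \<noteq> 0"
  obtains z where "z \<noteq> 0" "\<And>c. z \<noteq> c *s x"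
proof -
  obtain i where i: "x $ i \<noteq> 0" using assms(2) by (auto simp: vec_eq_iff)
  have "\<exists>j. j \<noteq> i"
  proof (rule ccontr)
    assume "\<not> ?thesis"
    then have "(UNIV :: 'n set) = {i}" by auto
    then have "CARD('n) = card {i}" by (rule arg_cong)
    then show False using assms(1) by simp
  qed
  then obtain j where j: "j \<noteq> i" ..
  have z: "axis j 1 \<noteq> c *s x" for c
  proof
    assume eq: "axis j 1 = c *s x"
    from arg_cong[OF eq, of "\<lambda>v. v $ i"] have "c = 0" using i j by (simp add: axis_def)
    with arg_cong[OF eq, of "\<lambda>v. v $ j"] show False by (simp add: axis_def)
  qed
  from z[of 0] z show thesis by (intro that[of "axis j 1"]) auto
qed

text \<open>Additivity comes from parallelograms: for independent \<open>x\<close> and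
  \<open>y\<close>, the vector \<open>x + y\<close> is where the line through \<open>x\<close> in
  direction \<open>y\<close> meets the line through \<open>y\<close> in direction \<open>x\<close>.
  The same independence shows that one function \<tau> serves all directions.\<close>

theorem parallelism_preserving_semilinear:
  fixes F :: "'q::{field,finite}^'m \<Rightarrow> 'q^'m"
  assumes inj: "inj F" and F0: "F 0 = 0" and dim: "CARD('m) \<ge> 2"
    and par: "\<And>x y x' y'. x \<noteq> y \<Longrightarrow> x' \<noteq> y' \<Longrightarrow>
      (\<exists>c. c \<noteq> 0 \<and> x - y = c *s (x' - y')) \<longleftrightarrow> (\<exists>d. d \<noteq> 0 \<and> F x - F y = d *s (F x' - F y'))"
  obtains \<tau> A where "\<tau> \<in> field_auts" "invertible A" "\<And>x. F x = A *v vmap \<tau> x"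
proof -
  have F_eq_0: "F x = 0 \<longleftrightarrow> x = 0" for x using inj F0 by (metis injD)
  have par0: "\<exists>d. d \<noteq> 0 \<and> F x - F y = d *s F z" if "x \<noteq> y" "z \<noteq> 0" "x - y = c *s z" "c \<noteq> 0" for x y z c
    using par[of x y z 0] that by (auto simp: F0)
  have indep: "a = 0 \<and> b = 0" if "x \<noteq> 0" "y \<noteq> 0" "\<And>c. y \<noteq> c *s x" "a *s F x = b *s F y" for a b x y
  proof -
    have "b = 0"
    proof (rule ccontr)
      assume "b \<noteq> 0"
      have "inverse b *s (b *s F y) = inverse b *s (a *s F x)" using that(4) by simp
      then have "F y = (inverse b * a) *s F x" using \<open>b \<noteq> 0\<close> by simp
      moreover have "inverse b * a \<noteq> 0" using calculation that(2) F_eq_0 by (metis vec.scale_zero_left)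
      ultimately have "\<exists>c. c \<noteq> 0 \<and> y - 0 = c *s (x - 0)"
        using that(1,2) by (subst par) (auto simp: F0 intro!: exI[of _ "inverse b * a"])
      then show False using that(3) by auto
    qed
    then show ?thesis using that F_eq_0 by auto
  qed
  have add1: "F (x + y) = F x + F y" if "x \<noteq> 0" "y \<noteq> 0" "\<And>c. y \<noteq> c *s x" for x y
  proof -
    have ne: "x + y \<noteq> x" "x + y \<noteq> y" using that by simp_all
    obtain d where d: "F (x + y) - F x = d *s F y" using par0[OF ne(1) \<open>y \<noteq> 0\<close>, of 1] by auto
    obtain c where c: "F (x + y) - F y = c *s F x" using par0[OF ne(2) \<open>x \<noteq> 0\<close>, of 1] by auto
    have "F (x + y) = F x + d *s F y" "F (x + y) = F y + c *s F x" using d c by (simp_all add: diff_eq_eq add.commute)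
    then have eq: "F x + d *s F y = F y + c *s F x" by metis
    have "(1 - c) *s F x = (F x + d *s F y) - d *s F y - c *s F x" by (simp add: vec.scale_left_diff_distrib)
    also have "\<dots> = (1 - d) *s F y" unfolding eq by (simp add: vec.scale_left_diff_distrib)
    finally have "(1 - c) *s F x = (1 - d) *s F y" .
    then have "1 - d = 0" using indep that by blast
    then show ?thesis using \<open>F (x + y) = F x + d *s F y\<close> by simp
  qed
  have add: "F (x + y) = F x + F y" for x y
  proof (cases "x = 0 \<or> y = 0 \<or> (\<forall>c. y \<noteq> c *s x)")
    case True
    then consider "x = 0" | "y = 0" | "x \<noteq> 0" "y \<noteq> 0" "\<forall>c. y \<noteq> c *s x" by blast
    then show ?thesis
    proof cases
      case 3 then show ?thesis by (intro add1) simp_all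
    qed (simp_all add: F0)
  next
    case False
    then obtain c where c: "y = c *s x" and nz: "x \<noteq> 0" "y \<noteq> 0" by blast
    \<comment> \<open>For parallel \<open>x\<close> and \<open>y\<close> a vector \<open>z\<close>
      off their line is inserted; apart from the case \<open>x + y = 0\<close>, the sums that are
      split have nonparallel summands.\<close>
    obtain z where z: "z \<noteq> 0" "\<And>k. z \<noteq> k *s x" using ex_not_multiple[OF dim nz(1)] by blast
    have "z + y \<noteq> k *s x" for k
      using z(2)[of "k - c"] c by (auto simp: vec.scale_left_diff_distrib eq_diff_eq)
    moreover from this[of 0] have "z + y \<noteq> 0" by simp
    ultimately have 1: "F (x + (z + y)) = F x + F (z + y)" using add1[of x "z + y"] nz by blast
    have "z \<noteq> k *s y" for k using z(2)[of "k * c"] c by simp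
    then have 2: "F (y + z) = F y + F z" using add1[of y z] nz z by blast
    have 3: "F ((x + y) + z) = F (x + y) + F z"
    proof (cases "x + y = 0")
      case True then show ?thesis by (simp add: F0)
    next
      case False
      have "x + y = (1 + c) *s x" by (simp add: c vec.scale_left_distrib)
      then have "z \<noteq> k *s (x + y)" for k using z(2)[of "k * (1 + c)"] by simp
      then show ?thesis using add1[of "x + y" z] z False by blast
    qed
    have "F (x + y) + F z = F x + F y + F z" using 1 2 3 by (simp add: add_ac)
    then show ?thesis by simp
  qed
  have sc: "\<exists>d. F (c *s x) = d *s F x" for c x
  proof (cases "c = 0 \<or> x = 0")
    case True then show ?thesis by (auto simp: F0 intro: exI[of _ 0])
  next
    case False then show ?thesis using par0[of "c *s x" 0 x c] by (auto simp: F0)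
  qed
  \<comment> \<open>The image of \<open>c *s (u + v)\<close> carries a single factor, which must fit
    both summands.\<close>
  have transfer: "F (c *s v) = d *s F v"
    if "F (c *s u) = d *s F u" "u \<noteq> 0" "v \<noteq> 0" "\<And>k. v \<noteq> k *s u" for c d u v
  proof -
    obtain d1 d2 where d: "F (c *s v) = d1 *s F v" "F (c *s (u + v)) = d2 *s F (u + v)" using sc by metis
    then have "d *s F u + d1 *s F v = d2 *s F u + d2 *s F v"
      using that(1) by (simp add: vec.scale_right_distrib add)
    then have "(d - d2) *s F u = (d2 - d1) *s F v"
      by (simp add: vec.scale_left_diff_distrib diff_eq_eq) (simp add: algebra_simps)
    then have "d - d2 = 0 \<and> d2 - d1 = 0" using indep that by blast
    then show ?thesis using d(1) by simp
  qed
  obtain u :: "'q^'m" where u: "u \<noteq> 0" by (metis axis_eq_0_iff zero_neq_one)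
  obtain v where v: "v \<noteq> 0" "\<And>k. v \<noteq> k *s u" using ex_not_multiple[OF dim u] by blast
  define \<tau> where "\<tau> c = (SOME d. F (c *s u) = d *s F u)" for c
  have \<tau>u: "F (c *s u) = \<tau> c *s F u" for c unfolding \<tau>_def by (rule someI_ex) (rule sc)
  have \<tau>: "F (c *s x) = \<tau> c *s F x" for c x
  proof (cases "x = 0")
    case False
    show ?thesis
    proof (cases "\<exists>k. x = k *s u")
      case True
      then obtain k where k: "x = k *s u" "k \<noteq> 0" using False by auto
      \<comment> \<open>Multiples of \<open>u\<close> are reached by a detour over
        \<open>v\<close>.\<close>
      have "F (c *s v) = \<tau> c *s F v" using transfer[OF \<tau>u u v] .
      moreover have "x \<noteq> j *s v" for j
      proof
        assume eq: "x = j *s v"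
        then have "j \<noteq> 0" using False by auto
        then have "v = (inverse j * k) *s u" using eq k by (metis vec.scale_scale vec.scale_one field_class.field_inverse)
        then show False using v by blast
      qed
      ultimately show ?thesis using transfer[of c v "\<tau> c" x] v False by blast
    next
      case F: False
      then show ?thesis using transfer[OF \<tau>u u False] by blast
    qed
  qed (simp add: F0)
  have Fu: "F u \<noteq> 0" using u F_eq_0 by blast
  have "\<tau> (a + b) *s F u = (\<tau> a + \<tau> b) *s F u" for a b
    unfolding \<tau>[symmetric] vec.scale_left_distrib add by simp
  then have \<tau>_add: "\<tau> (a + b) = \<tau> a + \<tau> b" for a b using Fu by simp
  have "\<tau> (a * b) *s F u = (\<tau> a * \<tau> b) *s F u" for a b
    by (simp flip: vec.scale_scale \<tau>)
  then have \<tau>_mult: "\<tau> (a * b) = \<tau> a * \<tau> b" for a b using Fu by simp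
  have "inj \<tau>"
  proof (rule injI)
    fix a b assume "\<tau> a = \<tau> b"
    then have "F (a *s u) = F (b *s u)" by (simp add: \<tau>)
    then have "a *s u = b *s u" using inj by (simp add: inj_eq)
    then show "a = b" using u by simp
  qed
  then have aut: "\<tau> \<in> field_auts"
    using \<tau>_add \<tau>_mult by (simp add: field_auts_def bij_def finite_UNIV_inj_surj)
  define A where "A = (\<chi> i j. F (axis j 1) $ i)"
  have Fsum: "F (\<Sum>j\<in>S. g j) = (\<Sum>j\<in>S. F (g j))" if "finite S" for S and g :: "'m \<Rightarrow> 'q^'m"
    using that by (induction S) (simp_all add: F0 add)
  have FA: "F x = A *v vmap \<tau> x" for x
  proof -
    have "F x = F (\<Sum>j\<in>UNIV. x $ j *s axis j 1)" by (simp only: basis_expansion)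
    also have "\<dots> = (\<Sum>j\<in>UNIV. \<tau> (x $ j) *s F (axis j 1))" by (simp add: Fsum \<tau>)
    also have "\<dots> = A *v vmap \<tau> x"
      by (simp add: vec_eq_iff A_def matrix_vector_mult_def sum_component mult.commute)
    finally show ?thesis .
  qed
  have "invertible A"
    unfolding invertible_iff_ker
  proof (intro allI impI)
    fix y assume "A *v y = 0"
    \<comment> \<open>The preimage of \<open>y\<close> under the coordinatewise \<tau>; a kernel
      vector of \<open>A\<close> thus becomes a zero of \<open>F\<close>.\<close>
    define x where "x = (\<chi> i. inv_into UNIV \<tau> (y $ i))"
    have "vmap \<tau> x = y" using aut by (simp add: vec_eq_iff x_def field_autsD bij_is_surj surj_f_inv_f)
    then have "x = 0" using \<open>A *v y = 0\<close> FA[of x] F_eq_0 by simp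
    then show "y = 0" using \<open>vmap \<tau> x = y\<close> by (auto simp: vmap_simps[OF aut])
  qed
  then show thesis using that[OF aut _ FA] by blast
qed

section \<open>Collineations that map affine points to affine points\<close>

context frame
begin

text \<open>There are finitely many lines, so an injective map of lines to lines permutes
  them.\<close>

lemma act_collineation:
  assumes "\<tau> \<in> field_auts" "invertible A"
  shows "act pg_points \<tau> A w \<in> collineations"
proof -
  let ?f = "act pg_points \<tau> A w"
  have bij: "?f \<in> Bij pg_points" by (rule act_Bij) (use assms sl_point in auto)
  have on: "?f ` points_on l = points_on (sl \<tau> A w ` l)" if "l \<in> pg_lines" for l
  proof (intro equalityI subsetI)
    fix p assume "p \<in> ?f ` points_on l"
    then show "p \<in> points_on (sl \<tau> A w ` l)"
      by (auto simp: points_on_def act_def sl_point[OF assms])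
  next
    fix p assume p: "p \<in> points_on (sl \<tau> A w ` l)"
    have "?f ` pg_points = pg_points" using bij by (simp add: Bij_def bij_betw_def)
    moreover have "p \<in> pg_points" using p by (simp add: points_on_def)
    ultimately obtain p' where p': "p' \<in> pg_points" "p = ?f p'" by blast
    then have "p' \<subseteq> l" using p sl_image_subset[OF assms, of w p' l] by (simp add: points_on_def act_def)
    then show "p \<in> ?f ` points_on l" using p' by (auto simp: points_on_def)
  qed
  have "(`) ?f ` (points_on ` pg_lines) \<subseteq> points_on ` pg_lines"
    using on sl_line[OF assms] by auto
  moreover have "inj_on ((`) ?f) (points_on ` pg_lines)"
  proof (rule inj_on_subset)
    show "inj_on ((`) ?f) (Pow pg_points)"
      using bij by (intro inj_on_image_Pow) (simp add: Bij_def bij_betw_def)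
    show "points_on ` pg_lines \<subseteq> Pow pg_points" by (auto simp: points_on_def)
  qed
  ultimately have "(`) ?f ` (points_on ` pg_lines) = points_on ` pg_lines"
    by (intro endo_inj_surj) auto
  then show ?thesis using bij by (simp add: collineations_def)
qed

text \<open>The line joining two affine points contains one point at infinity, so \<open>f\<close>
  takes the direction of \<open>x - y\<close> to that of \<open>F x - F y\<close>. Hence
  \<open>F\<close>, shifted so as to fix 0, preserves and reflects parallelism.\<close>

theorem collineation_eq_act:
  assumes f: "f \<in> collineations" and dim: "CARD('m) \<ge> 2" and aff: "\<And>x. \<exists>y. f (aff x) = aff y"
  obtains \<tau> A w where "\<tau> \<in> field_auts" "invertible A" "f = act pg_points \<tau> A w"
proof -
  have bij: "bij_betw f pg_points pg_points" and ext: "f \<in> extensional pg_points"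
    and lines: "(`) f ` (points_on ` pg_lines) = points_on ` pg_lines"
    using f by (auto simp: collineations_def Bij_def)
  have inj: "f p = f p' \<longleftrightarrow> p = p'" if "p \<in> pg_points" "p' \<in> pg_points" for p p'
    using bij that by (auto simp: bij_betw_def inj_on_def)
  define F where "F x = (SOME y. f (aff x) = aff y)" for x
  have F: "f (aff x) = aff (F x)" for x unfolding F_def by (rule someI_ex) (rule aff)
  have injF: "inj F"
  proof (rule injI)
    fix x y assume "F x = F y"
    then have "f (aff x) = f (aff y)" by (simp add: F)
    then show "x = y" by (simp add: inj)
  qed
  then have surjF: "surj F" by (simp add: finite_UNIV_inj_surj)
  have finf: "\<exists>d'. d' \<noteq> 0 \<and> f (inf d) = inf d'" if "d \<noteq> 0" for d
  proof -
    have "f (inf d) \<in> pg_points" using bij that by (auto simp: bij_betw_def)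
    then show ?thesis
    proof (cases rule: points_cases)
      case (1 x)
      \<comment> \<open>Every affine point is already the image of an affine point, which leaves
        none for a point at infinity.\<close>
      obtain y where "x = F y" using surjF by blast
      then have "f (inf d) = f (aff y)" using 1 F by simp
      then show ?thesis using inj[of "inf d" "aff y"] that by simp
    qed blast
  qed
  have dir: "f (inf (x - y)) = inf (F x - F y)" if "x \<noteq> y" for x y
  proof -
    have nz: "x - y \<noteq> 0" using that by simp
    let ?l = "ln y (x - y)"
    have "f ` points_on ?l \<in> points_on ` pg_lines" using lines ln_line[OF nz, of y] by blast
    then obtain l' where l': "l' \<in> pg_lines" "f ` points_on ?l = points_on l'" by blast
    have "aff x \<subseteq> ?l" unfolding aff_sub_ln by (rule exI[of _ 1]) simp
    moreover have "aff y \<subseteq> ?l" unfolding aff_sub_ln by (rule exI[of _ 0]) simp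
    moreover have "inf (x - y) \<subseteq> ?l" unfolding inf_sub_ln by (rule exI[of _ 1]) simp
    ultimately have on: "f (aff x) \<in> points_on l'" "f (aff y) \<in> points_on l'" "f (inf (x - y)) \<in> points_on l'"
      unfolding l'(2)[symmetric] using nz by (auto simp: points_on_def)
    have "\<not> l' \<subseteq> Hyp" using on(1) aff_not_Hyp(1)[of "F x"] unfolding points_on_def F by blast
    then obtain u d where ud: "d \<noteq> 0" "l' = ln u d" using lines_cases[OF l'(1)] by blast
    obtain d' where d': "d' \<noteq> 0" "f (inf (x - y)) = inf d'" using finf[OF nz] by blast
    obtain k where k: "F x = u + k *s d" using on(1) by (auto simp: points_on_def F ud(2) aff_sub_ln)
    obtain k' where k': "F y = u + k' *s d" using on(2) by (auto simp: points_on_def F ud(2) aff_sub_ln)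
    obtain j where j: "d' = j *s d" using on(3) by (auto simp: points_on_def d'(2) ud(2) inf_sub_ln)
    have FF: "F x - F y = (k - k') *s d" by (simp add: k k' vec.scale_left_diff_distrib)
    have "F x \<noteq> F y" using injF that by (simp add: inj_eq)
    then have kk: "k - k' \<noteq> 0" using FF by auto
    have "d' = (j / (k - k')) *s (F x - F y)" using kk by (simp add: FF j)
    moreover have "j / (k - k') \<noteq> 0" using j d' kk by auto
    ultimately show ?thesis unfolding d'(2) inf_eq_iff[OF d'(1)] by blast
  qed
  let ?G = "\<lambda>x. F x - F 0"
  have G1: "inj ?G" using injF by (simp add: inj_def)
  have G2: "(\<exists>c. c \<noteq> 0 \<and> x - y = c *s (x' - y')) \<longleftrightarrow> (\<exists>d. d \<noteq> 0 \<and> ?G x - ?G y = d *s (?G x' - ?G y'))"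
    if "x \<noteq> y" "x' \<noteq> y'" for x y x' y'
  proof -
    have "F x - F y \<noteq> 0" using injF that by (simp add: inj_eq)
    have "(\<exists>c. c \<noteq> 0 \<and> x - y = c *s (x' - y')) \<longleftrightarrow> inf (x - y) = inf (x' - y')"
      using that by (simp add: inf_eq_iff)
    also have "\<dots> \<longleftrightarrow> inf (F x - F y) = inf (F x' - F y')"
      using that inj[of "inf (x - y)" "inf (x' - y')"] by (simp flip: dir)
    finally show ?thesis using \<open>F x - F y \<noteq> 0\<close> by (simp add: inf_eq_iff)
  qed
  obtain \<tau> A where \<tau>A: "\<tau> \<in> field_auts" "invertible A" "\<And>x. ?G x = A *v vmap \<tau> x"
    by (rule parallelism_preserving_semilinear[OF G1 _ dim G2]) auto
  have "f = act pg_points \<tau> A (F 0)"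
  proof (rule extensionalityI[OF ext])
    show "act pg_points \<tau> A (F 0) \<in> extensional pg_points" by (simp add: act_def)
    fix p :: "('q^'n) set" assume "p \<in> pg_points"
    then show "f p = act pg_points \<tau> A (F 0) p"
    proof (cases rule: points_cases)
      case (1 x)
      then show ?thesis using \<tau>A(3)[of x] by (simp add: F act_def sl_aff[OF \<tau>A(1,2)] diff_eq_eq)
    next
      case (2 x)
      then show ?thesis using dir[of x 0] \<tau>A(3)[of x] by (simp add: act_def sl_inf[OF \<tau>A(1,2)])
    qed
  qed
  with \<tau>A show thesis by (intro that)
qed

lemma collineation_image_act:
  assumes "\<tau> \<in> field_auts" "invertible A" "vec.subspace U" "U \<noteq> {0}"
  shows "collineation_image (act pg_points \<tau> A w) U = sl \<tau> A w ` U"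
proof -
  have "collineation_image (act pg_points \<tau> A w) U = (\<Union>p\<in>points_on U. sl \<tau> A w ` p)"
    unfolding collineation_image_def by (intro SUP_cong) (auto simp: act_def points_on_def)
  also have "\<dots> = sl \<tau> A w ` \<Union> (points_on U)" by blast
  finally show ?thesis using points_on_nonempty_union[OF assms(3,4)] by simp
qed

end

section \<open>Linear representation graphs\<close>

text \<open>Removing a pair of \<open>x\<close> and \<open>f x\<close> keeps the hypotheses and
  lowers the cardinality by two.\<close>

lemma even_card_involution:
  assumes "finite S" "\<And>x. x \<in> S \<Longrightarrow> f x \<in> S \<and> f (f x) = x \<and> f x \<noteq> x"
  shows "even (card S)"
  using assms
proof (induction S rule: finite_psubset_induct)
  case (psubset S)
  show ?case
  proof (cases "S = {}")
    case False
    then obtain x where x: "x \<in> S" by blast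
    let ?T = "S - {x, f x}"
    have fx: "f x \<in> S" "f (f x) = x" "f x \<noteq> x" using psubset.prems x by blast+
    have "even (card ?T)"
    proof (rule psubset.IH)
      show "?T \<subset> S" using x by blast
      fix y assume y: "y \<in> ?T"
      then have "f y \<in> S \<and> f (f y) = y \<and> f y \<noteq> y" using psubset.prems by blast
      moreover have "f y \<noteq> x" "f y \<noteq> f x" using y calculation fx by auto
      ultimately show "f y \<in> ?T \<and> f (f y) = y \<and> f y \<noteq> y" by blast
    qed
    moreover have "card {x, f x} \<le> card S" using x fx psubset.hyps by (intro card_mono) auto
    then have "card S = card ?T + card {x, f x}"
      using x fx psubset.hyps by (subst card_Diff_subset) simp_all
    ultimately show ?thesis using fx(3) by simp
  qed simp
qed

lemma card_image_cong_inj: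
  assumes "\<And>x y. x \<in> S \<Longrightarrow> y \<in> S \<Longrightarrow> h x = h y \<longleftrightarrow> g x = g y"
  shows "card (h ` S) = card (g ` S)"
proof -
  have "bij_betw (\<lambda>z. g (inv_into S h z)) (h ` S) (g ` S)"
    unfolding bij_betw_def
  proof
    show "inj_on (\<lambda>z. g (inv_into S h z)) (h ` S)"
      by (intro inj_onI) (metis assms f_inv_into_f inv_into_into)
    have "g (inv_into S h (h x)) = g x" if "x \<in> S" for x
      using assms[of "inv_into S h (h x)" x] that by (simp add: f_inv_into_f inv_into_into)
    then show "(\<lambda>z. g (inv_into S h z)) ` h ` S = g ` S" by (force simp: image_image)
  qed
  then show ?thesis by (rule bij_betw_same_card)
qed

text \<open>For distinct vertices this is distance two: points joined by a line of the graph, or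
  lines that meet off the hyperplane.\<close>

definition common_nbrs :: "'v graph \<Rightarrow> 'v \<Rightarrow> 'v \<Rightarrow> bool" where
  "common_nbrs \<Gamma> u v \<longleftrightarrow> (\<exists>n\<in>fst \<Gamma>. {u, n} \<in> snd \<Gamma> \<and> {v, n} \<in> snd \<Gamma>)"

text \<open>The parity of the cardinality of this set separates the two vertex classes: if \<open>u\<close> is a point,
  it is even for every \<open>v \<noteq> u\<close>.\<close>

definition linked :: "'v graph \<Rightarrow> 'v \<Rightarrow> 'v \<Rightarrow> 'v set" where
  "linked \<Gamma> u v = {w \<in> fst \<Gamma>. w \<noteq> u \<and> w \<noteq> v \<and> common_nbrs \<Gamma> u w \<and> common_nbrs \<Gamma> v w}"

text \<open>\<open>linked\<close> is expressed through adjacency alone, so automorphisms transport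
  it.\<close>

lemma card_linked_automorphism:
  assumes f: "f \<in> graph_automorphisms \<Gamma>" and u: "u \<in> fst \<Gamma>" and v: "v \<in> fst \<Gamma>"
  shows "card (linked \<Gamma> (f u) (f v)) = card (linked \<Gamma> u v)"
proof -
  have bij: "bij_betw f (fst \<Gamma>) (fst \<Gamma>)"
    and E: "\<And>u v. u \<in> fst \<Gamma> \<Longrightarrow> v \<in> fst \<Gamma> \<Longrightarrow> {u, v} \<in> snd \<Gamma> \<longleftrightarrow> {f u, f v} \<in> snd \<Gamma>"
    using f by (auto simp: graph_automorphisms_def Bij_def)
  have inj: "inj_on f (fst \<Gamma>)" and img: "f ` fst \<Gamma> = fst \<Gamma>" using bij by (auto simp: bij_betw_def)
  have cn: "common_nbrs \<Gamma> (f a) (f b) \<longleftrightarrow> common_nbrs \<Gamma> a b" if "a \<in> fst \<Gamma>" "b \<in> fst \<Gamma>" for a b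
  proof -
    have "common_nbrs \<Gamma> (f a) (f b) \<longleftrightarrow> (\<exists>n\<in>f ` fst \<Gamma>. {f a, n} \<in> snd \<Gamma> \<and> {f b, n} \<in> snd \<Gamma>)"
      by (simp add: common_nbrs_def img)
    also have "\<dots> \<longleftrightarrow> common_nbrs \<Gamma> a b" using E that by (auto simp: common_nbrs_def)
    finally show ?thesis .
  qed
  have "f ` linked \<Gamma> u v = linked \<Gamma> (f u) (f v)"
  proof (intro equalityI subsetI)
    fix w assume "w \<in> f ` linked \<Gamma> u v"
    then show "w \<in> linked \<Gamma> (f u) (f v)"
      using cn u v inj img by (auto simp: linked_def inj_on_eq_iff)
  next
    fix w assume w: "w \<in> linked \<Gamma> (f u) (f v)"
    then have "w \<in> f ` fst \<Gamma>" unfolding img by (simp add: linked_def)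
    then obtain w' where w': "w' \<in> fst \<Gamma>" "w = f w'" by blast
    then have "w' \<in> linked \<Gamma> u v" using w cn u v by (auto simp: linked_def)
    then show "w \<in> f ` linked \<Gamma> u v" using w' by blast
  qed
  moreover have "inj_on f (linked \<Gamma> u v)" using inj by (rule inj_on_subset) (auto simp: linked_def)
  ultimately show ?thesis by (metis card_image)
qed

text \<open>\<open>KD\<close> is the cone of all nonzero coordinate vectors on the points of
  \<open>K\<close>; membership of a direction is then independent of its representative.\<close>

locale lin_rep = frame w0 b for w0 :: "'q::{field,finite}^'n" and b :: "'m::finite \<Rightarrow> 'q^'n" +
  fixes KD :: "('q^'m) set"
  assumes KD_nz: "0 \<notin> KD" and KD_scale: "\<And>c d. d \<in> KD \<Longrightarrow> c \<noteq> 0 \<Longrightarrow> c *s d \<in> KD"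
begin

definition V :: "('q^'n) set set" where "V = range aff \<union> {ln x d | x d. d \<in> KD}"

definition E :: "('q^'n) set set set" where "E = {{aff x, ln x d} | x d. d \<in> KD}"

lemma KD_nz': "d \<in> KD \<Longrightarrow> d \<noteq> 0"
  using KD_nz by blast

lemma aff_neq_ln [simp]: "d \<in> KD \<Longrightarrow> aff x \<noteq> ln y d" "d \<in> KD \<Longrightarrow> ln y d \<noteq> aff x"
  using line_not_point[OF ln_line[OF KD_nz', of d y]] aff_point(1)[of x] by metis+

lemma aff_in_V [simp]: "aff x \<in> V" and ln_in_V: "d \<in> KD \<Longrightarrow> ln x d \<in> V"
  by (auto simp: V_def)

lemma V_cases:
  assumes "v \<in> V"
  obtains x where "v = aff x" | x d where "d \<in> KD" "v = ln x d"
  using assms by (auto simp: V_def)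

lemma V_subspace:
  assumes "v \<in> V" shows "vec.subspace v \<and> v \<noteq> {0}"
  using assms
proof (cases rule: V_cases)
  case (1 x)
  have "w0 + B x \<in> aff x" by (simp add: aff_def vec.span_base)
  then show ?thesis unfolding 1 using w0_B_nz[of x] by auto
next
  case (2 x d)
  have "w0 + B x \<in> ln x d" by (simp add: ln_def vec.span_base)
  then show ?thesis unfolding 2 using w0_B_nz[of x] by auto
qed

lemma lines_V: "{l \<in> pg_lines. \<not> l \<subseteq> Hyp \<and> (\<exists>k\<in>inf ` KD. k \<subseteq> l)} = {ln x d | x d. d \<in> KD}"
proof (intro equalityI subsetI)
  fix l assume "l \<in> {l \<in> pg_lines. \<not> l \<subseteq> Hyp \<and> (\<exists>k\<in>inf ` KD. k \<subseteq> l)}"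
  then obtain d' where l: "l \<in> pg_lines" "\<not> l \<subseteq> Hyp" and d': "d' \<in> KD" "inf d' \<subseteq> l" by blast
  obtain x d where xd: "d \<noteq> 0" "l = ln x d" using lines_cases[OF l] by blast
  obtain c where c: "d' = c *s d" using d'(2) by (auto simp: xd(2) inf_sub_ln)
  then have "c \<noteq> 0" using KD_nz'[OF d'(1)] by auto
  then have "d = inverse c *s d'" using c by simp
  then have "d \<in> KD" using KD_scale[OF d'(1), of "inverse c"] \<open>c \<noteq> 0\<close> by simp
  then show "l \<in> {ln x d | x d. d \<in> KD}" using xd by blast
next
  fix l assume "l \<in> {ln x d | x d. d \<in> KD}"
  then obtain x d where d: "d \<in> KD" "l = ln x d" by blast
  moreover have "inf d \<subseteq> l" unfolding d(2) inf_sub_ln by (rule exI[of _ 1]) simp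
  ultimately show "l \<in> {l \<in> pg_lines. \<not> l \<subseteq> Hyp \<and> (\<exists>k\<in>inf ` KD. k \<subseteq> l)}" using KD_nz' by auto
qed

lemma E_iff: 
  assumes "d \<in> KD" shows "{aff y, ln x d} \<in> E \<longleftrightarrow> (\<exists>k. y = x + k *s d)"
proof
  assume "{aff y, ln x d} \<in> E"
  then obtain x' d' where d': "d' \<in> KD" "{aff y, ln x d} = {aff x', ln x' d'}" by (auto simp: E_def)
  then have "aff y = aff x'" "ln x d = ln x' d'"
    using assms by (auto simp: doubleton_eq_iff)
  then have "aff y \<subseteq> ln x d" unfolding aff_sub_ln[of y x' d'] by (auto simp: aff_sub_ln intro: exI[of _ 0])
  then show "\<exists>k. y = x + k *s d" by (simp add: aff_sub_ln)
next
  assume "\<exists>k. y = x + k *s d"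
  then obtain k where "y = x + k *s d" by blast
  then have "ln y d = ln x d" using ln_shift[of d y x k d 1] KD_nz'[OF assms] by simp
  then have "{aff y, ln x d} = {aff y, ln y d}" by simp
  then show "{aff y, ln x d} \<in> E" using assms unfolding E_def by blast
qed

lemma Gamma_eq: "Gamma Hyp (inf ` KD) = (V, E)"
proof -
  have "E = {{p, l} | p l. p \<in> range aff \<and> l \<in> {ln x d | x d. d \<in> KD} \<and> p \<subseteq> l}"
  proof (intro equalityI subsetI)
    fix e assume "e \<in> E"
    then obtain x d where "d \<in> KD" "e = {aff x, ln x d}" by (auto simp: E_def)
    moreover have "aff x \<subseteq> ln x d" unfolding aff_sub_ln by (rule exI[of _ 0]) simp
    ultimately show "e \<in> {{p, l} | p l. p \<in> range aff \<and> l \<in> {ln x d | x d. d \<in> KD} \<and> p \<subseteq> l}" by blast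
  next
    fix e assume "e \<in> {{p, l} | p l. p \<in> range aff \<and> l \<in> {ln x d | x d. d \<in> KD} \<and> p \<subseteq> l}"
    then obtain y x d where "d \<in> KD" "e = {aff y, ln x d}" "aff y \<subseteq> ln x d" by blast
    then show "e \<in> E" by (simp add: E_iff aff_sub_ln)
  qed
  then show ?thesis
    by (simp only: Gamma_def Let_def points_not_Hyp lines_V V_def)
qed

lemma E_aff_cases:
  assumes "{aff x, n} \<in> E" obtains d where "d \<in> KD" "n = ln x d"
proof -
  obtain x' d' where "d' \<in> KD" "{aff x, n} = {aff x', ln x' d'}" using assms by (auto simp: E_def)
  then show thesis using that[of d'] by (auto simp: doubleton_eq_iff)
qed

lemma E_ln_cases:
  assumes "{ln x d, n} \<in> E" "d \<in> KD" obtains k where "n = aff (x + k *s d)"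
proof -
  obtain x' d' where d': "d' \<in> KD" "{ln x d, n} = {aff x', ln x' d'}" using assms by (auto simp: E_def)
  then have "n = aff x'" using assms(2) by (auto simp: doubleton_eq_iff)
  moreover from this obtain k where "x' = x + k *s d" using assms E_iff[of d x' x] by (auto simp: insert_commute)
  ultimately show thesis using that by blast
qed

lemma edges_at_aff: "{e \<in> E. aff y \<in> e} = (\<lambda>d. {aff y, ln y d}) ` KD"
  by (auto simp: E_def)

lemma edges_at_ln:
  assumes "d \<in> KD" shows "{e \<in> E. ln x d \<in> e} = range (\<lambda>k. {aff (x + k *s d), ln x d})"
proof (intro equalityI subsetI)
  fix e assume "e \<in> {e \<in> E. ln x d \<in> e}"
  then obtain x' d' where e: "e \<in> E" "d' \<in> KD" "e = {aff x', ln x' d'}" "ln x d \<in> e" by (auto simp: E_def)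
  then have "e = {aff x', ln x d}" using assms by auto
  then show "e \<in> range (\<lambda>k. {aff (x + k *s d), ln x d})" using e(1) E_iff[OF assms, of x' x] by auto
next
  fix e assume "e \<in> range (\<lambda>k. {aff (x + k *s d), ln x d})"
  then show "e \<in> {e \<in> E. ln x d \<in> e}" using E_iff[OF assms] by auto
qed

text \<open>A line has q affine points, one per scalar, and an affine point lies on one line per
  point of \<open>K\<close>. The hypothesis makes both numbers agree.\<close>

lemma regular:
  assumes "card (inf ` KD) = CARD('q)"
  shows "regular_graph (V, E)"
  unfolding regular_graph_def
proof (intro exI[of _ "CARD('q)"] ballI conjI)
  fix v assume "v \<in> fst (V, E)"
  then have "v \<in> V" by simp
  then show "card {e \<in> snd (V, E). v \<in> e} = CARD('q)"
  proof (cases rule: V_cases)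
    case (1 y)
    have "{aff y, ln y d} = {aff y, ln y d'} \<longleftrightarrow> inf d = inf d'" if dd: "d \<in> KD" "d' \<in> KD" for d d'
    proof
      assume "{aff y, ln y d} = {aff y, ln y d'}"
      then have "ln y d = ln y d'" using dd by (auto simp: doubleton_eq_iff)
      then obtain c where "d = c *s d'" using ln_eqD(2)[OF KD_nz'[OF dd(2)]] by blast
      then show "inf d = inf d'" 
        using KD_nz'[OF dd(1)] by (subst inf_eq_iff) (auto intro!: exI[of _ c])
    next
      assume "inf d = inf d'"
      then obtain c where "c \<noteq> 0" "d = c *s d'" using KD_nz' dd by (auto simp: inf_eq_iff)
      then show "{aff y, ln y d} = {aff y, ln y d'}"
        using ln_shift[of d' y y 0 d c] KD_nz' dd by simp
    qed
    then have "card ((\<lambda>d. {aff y, ln y d}) ` KD) = card (inf ` KD)" by (intro card_image_cong_inj)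
    then show ?thesis using assms by (simp add: 1 edges_at_aff)
  next
    case (2 x d)
    have "inj (\<lambda>k. {aff (x + k *s d), ln x d})"
      using 2(1) KD_nz' by (auto simp: inj_def doubleton_eq_iff)
    then show ?thesis by (simp add: 2 edges_at_ln card_image)
  qed
qed simp

lemma sl_V:
  assumes "\<tau> \<in> field_auts" "invertible A" "\<And>d. d \<in> KD \<Longrightarrow> A *v vmap \<tau> d \<in> KD" "X \<in> V"
  shows "sl \<tau> A w ` X \<in> V"
  using assms(4) by (cases rule: V_cases) (use assms in \<open>auto simp: sl_aff sl_ln intro!: ln_in_V\<close>)

lemma act_graph_automorphism:
  assumes "\<tau> \<in> field_auts" "invertible A" "\<And>d. d \<in> KD \<Longrightarrow> A *v vmap \<tau> d \<in> KD"
  shows "act V \<tau> A w \<in> graph_automorphisms (V, E)"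
proof -
  let ?f = "act V \<tau> A w"
  have bij: "?f \<in> Bij V" by (rule act_Bij) (use assms sl_V in auto)
  have EV: "e \<subseteq> V" if "e \<in> E" for e using that by (auto simp: E_def intro: ln_in_V)
  have "?f ` e \<in> E" if eE: "e \<in> E" for e
  proof -
    obtain x d where e: "d \<in> KD" "e = {aff x, ln x d}" using eE unfolding E_def by blast
    then have "?f ` e = {aff (A *v vmap \<tau> x + w), ln (A *v vmap \<tau> x + w) (A *v vmap \<tau> d)}"
      by (simp add: act_def ln_in_V sl_aff[OF assms(1,2)] sl_ln[OF assms(1,2)])
    then show ?thesis using assms(3)[OF e(1)] by (auto simp: E_def)
  qed
  then have "(`) ?f ` E \<subseteq> E" by blast
  moreover have injP: "inj_on ((`) ?f) (Pow V)"
    using bij by (intro inj_on_image_Pow) (simp add: Bij_def bij_betw_def)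
  then have "inj_on ((`) ?f) E" by (rule inj_on_subset) (use EV in auto)
  ultimately have img: "(`) ?f ` E = E" by (intro endo_inj_surj) auto
  have "{u, v} \<in> E \<longleftrightarrow> {?f u, ?f v} \<in> E" if "u \<in> V" "v \<in> V" for u v
  proof
    assume "{u, v} \<in> E"
    then have "?f ` {u, v} \<in> (`) ?f ` E" by (rule imageI)
    then show "{?f u, ?f v} \<in> E" unfolding img by simp
  next
    assume "{?f u, ?f v} \<in> E"
    then have "?f ` {u, v} \<in> (`) ?f ` E" unfolding img by simp
    then obtain e where e: "e \<in> E" "?f ` {u, v} = ?f ` e" by blast
    have "{u, v} = e" using injP e(2) by (rule inj_onD) (use EV[OF e(1)] \<open>u \<in> V\<close> \<open>v \<in> V\<close> in auto)
    then show "{u, v} \<in> E" using e by simp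
  qed
  then show ?thesis using bij by (simp add: graph_automorphisms_def)
qed

text \<open>A collineation inducing an automorphism maps an affine point to a vertex that is also a
  point, hence to an affine point; so it is semilinear. Lines through the origin show that its
  linear part preserves \<open>KD\<close>.\<close>

lemma carrier_geometric_Aut:
  assumes dim: "CARD('m) \<ge> 2"
  shows "carrier (geometric_Aut (V, E)) =
    {act V \<tau> A w | \<tau> A w. \<tau> \<in> field_auts \<and> invertible A \<and> (\<forall>d\<in>KD. A *v vmap \<tau> d \<in> KD)}" (is "_ = ?R")
proof (intro equalityI subsetI)
  fix \<alpha> assume "\<alpha> \<in> carrier (geometric_Aut (V, E))"
  then obtain f where \<alpha>: "\<alpha> \<in> graph_automorphisms (V, E)" and f: "f \<in> collineations"
    and \<alpha>f: "\<And>v. v \<in> V \<Longrightarrow> \<alpha> v = collineation_image f v"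
    by (auto simp: geometric_Aut_def)
  have \<alpha>V: "\<alpha> v \<in> V" if "v \<in> V" for v
    using \<alpha> that by (auto simp: graph_automorphisms_def Bij_def bij_betw_def)
  have fp: "f p \<in> pg_points" if "p \<in> pg_points" for p
    using f that by (auto simp: collineations_def Bij_def bij_betw_def)
  have "\<exists>y. f (aff x) = aff y" for x
  proof -
    have "f (aff x) = \<alpha> (aff x)" using \<alpha>f[of "aff x"] by (simp add: collineation_image_def points_on_point)
    then have "f (aff x) \<in> V" using \<alpha>V by simp
    then show ?thesis
    proof (cases rule: V_cases)
      case (2 y d)
      then show ?thesis using fp[of "aff x"] line_not_point[OF ln_line[OF KD_nz', of d y]] by simp
    qed blast
  qed
  then obtain \<tau> A w where t: "\<tau> \<in> field_auts" "invertible A" "f = act pg_points \<tau> A w"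
    using collineation_eq_act[OF f dim] by blast
  have \<alpha>sl: "\<alpha> v = sl \<tau> A w ` v" if "v \<in> V" for v
  proof -
    have "vec.subspace v" "v \<noteq> {0}" using V_subspace[OF that] by simp_all
    then show ?thesis using collineation_image_act[OF t(1,2)] \<alpha>f[OF that] t(3) by simp
  qed
  have "A *v vmap \<tau> d \<in> KD" if d: "d \<in> KD" for d
  proof -
    have "ln w (A *v vmap \<tau> d) \<in> V"
      using \<alpha>V[OF ln_in_V[OF d, of 0]] by (simp add: \<alpha>sl ln_in_V d sl_ln[OF t(1,2)] vmap_simps[OF t(1)])
    moreover have nz: "A *v vmap \<tau> d \<noteq> 0"
      using KD_nz'[OF d] by (simp add: invertible_nz[OF t(2)] vmap_simps[OF t(1)])
    ultimately obtain x' d' where d': "d' \<in> KD" "ln w (A *v vmap \<tau> d) = ln x' d'"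
      using line_not_point[OF ln_line[OF nz, of w]] by (auto elim!: V_cases)
    then obtain c where c: "A *v vmap \<tau> d = c *s d'" using ln_eqD(2)[OF KD_nz'] by blast
    then have "c \<noteq> 0" using nz by auto
    then show ?thesis using KD_scale[OF d'(1)] c by simp
  qed
  moreover have "\<alpha> = act V \<tau> A w"
  proof (rule extensionalityI[of _ V])
    show "\<alpha> \<in> extensional V" using \<alpha> by (auto simp: graph_automorphisms_def Bij_def)
  qed (auto simp: act_def \<alpha>sl)
  ultimately show "\<alpha> \<in> ?R" using t by blast
next
  fix \<alpha> assume "\<alpha> \<in> ?R"
  then obtain \<tau> A w where \<alpha>: "\<alpha> = act V \<tau> A w" and t: "\<tau> \<in> field_auts" "invertible A" "\<And>d. d \<in> KD \<Longrightarrow> A *v vmap \<tau> d \<in> KD"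
    by blast
  have "\<alpha> v = collineation_image (act pg_points \<tau> A w) v" if "v \<in> V" for v
  proof -
    have "vec.subspace v" "v \<noteq> {0}" using V_subspace[OF that] by simp_all
    then show ?thesis using collineation_image_act[OF t(1,2)] that by (simp add: \<alpha> act_def)
  qed
  then show "\<alpha> \<in> carrier (geometric_Aut (V, E))"
    using act_graph_automorphism[OF t] act_collineation[OF t(1,2)] by (auto simp: geometric_Aut_def \<alpha>)
qed

lemma edge_transitive:
  assumes "\<And>d d'. d \<in> KD \<Longrightarrow> d' \<in> KD \<Longrightarrow>
    \<exists>A c. invertible A \<and> (\<forall>k\<in>KD. A *v k \<in> KD) \<and> c \<noteq> 0 \<and> A *v d = c *s d'"
  shows "edge_transitive (V, E)"
  unfolding edge_transitive_def
proof (intro ballI)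
  fix e e' assume "e \<in> snd (V, E)" "e' \<in> snd (V, E)"
  then obtain x d x' d' where e: "d \<in> KD" "e = {aff x, ln x d}" and e': "d' \<in> KD" "e' = {aff x', ln x' d'}"
    by (auto simp: E_def)
  obtain A c where A: "invertible A" "\<And>k. k \<in> KD \<Longrightarrow> A *v k \<in> KD" "c \<noteq> 0" "A *v d = c *s d'"
    using assms[OF e(1) e'(1)] by blast
  \<comment> \<open>The translation part moves \<open>A *v x\<close> to \<open>x'\<close>.\<close>
  let ?f = "act V id A (x' - A *v x)"
  have "?f ` e = {aff x', ln x' (c *s d')}"
    using e A by (simp add: act_def ln_in_V sl_aff sl_ln field_auts_id)
  also have "\<dots> = e'" using ln_shift[of d' x' x' 0 "c *s d'" c] KD_nz'[OF e'(1)] A(3) e'(2) by simp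
  finally have "?f ` e = e'" .
  moreover have "?f \<in> graph_automorphisms (V, E)"
    using act_graph_automorphism[OF field_auts_id(1) A(1)] A(2) by simp
  ultimately show "\<exists>f\<in>graph_automorphisms (V, E). f ` e = e'" by blast
qed

lemma common_nbrs_aff_aff:
  assumes "x \<noteq> y" shows "common_nbrs (V, E) (aff x) (aff y) \<longleftrightarrow> y - x \<in> KD"
proof
  assume "common_nbrs (V, E) (aff x) (aff y)"
  then obtain n where n: "{aff x, n} \<in> E" "{aff y, n} \<in> E" by (auto simp: common_nbrs_def)
  obtain d where d: "d \<in> KD" "n = ln x d" using E_aff_cases[OF n(1)] .
  then obtain k where k: "y = x + k *s d" using n(2) E_iff by auto
  then have "k \<noteq> 0" using assms by auto
  then show "y - x \<in> KD" using KD_scale[OF d(1)] k by simp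
next
  assume d: "y - x \<in> KD"
  have "{aff x, ln x (y - x)} \<in> E" unfolding E_iff[OF d] by (rule exI[of _ 0]) simp
  moreover have "{aff y, ln x (y - x)} \<in> E" unfolding E_iff[OF d] by (rule exI[of _ 1]) simp
  ultimately show "common_nbrs (V, E) (aff x) (aff y)" using ln_in_V[OF d] by (auto simp: common_nbrs_def)
qed

lemma common_nbrs_aff_ln: "d \<in> KD \<Longrightarrow> \<not> common_nbrs (V, E) (aff x) (ln y d)"
  by (auto simp: common_nbrs_def elim!: E_aff_cases E_ln_cases)

lemma common_nbrs_sym: "common_nbrs \<Gamma> u v = common_nbrs \<Gamma> v u"
  by (auto simp: common_nbrs_def)

lemma common_nbrs_ln_ln:
  assumes "d \<in> KD" "d' \<in> KD"
  shows "common_nbrs (V, E) (ln x d) (ln y d') \<longleftrightarrow> (\<exists>a b. x + a *s d = y + b *s d')"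
proof
  assume "common_nbrs (V, E) (ln x d) (ln y d')"
  then obtain n where n: "{ln x d, n} \<in> E" "{ln y d', n} \<in> E" by (auto simp: common_nbrs_def)
  obtain a where "n = aff (x + a *s d)" using E_ln_cases[OF n(1) assms(1)] .
  moreover obtain b where "n = aff (y + b *s d')" using E_ln_cases[OF n(2) assms(2)] .
  ultimately have "x + a *s d = y + b *s d'" by simp
  then show "\<exists>a b. x + a *s d = y + b *s d'" by blast
next
  assume "\<exists>a b. x + a *s d = y + b *s d'"
  then obtain a b where eq: "x + a *s d = y + b *s d'" by blast
  have "{ln x d, aff (x + a *s d)} \<in> E"
    unfolding insert_commute[of "ln x d"] E_iff[OF assms(1)] by blast
  moreover have "{ln y d', aff (x + a *s d)} \<in> E"
    unfolding insert_commute[of "ln y d'"] E_iff[OF assms(2)] eq by blast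
  ultimately show "common_nbrs (V, E) (ln x d) (ln y d')" by (auto simp: common_nbrs_def)
qed

text \<open>The involution settles the case that \<open>v\<close> is a point. If \<open>v\<close> is
  a line, bipartiteness prevents any vertex from sharing neighbours with both, and the set is
  empty.\<close>

lemma even_linked_aff:
  assumes char2: "\<And>c::'q. c + c = 0" and v: "v \<in> V" "v \<noteq> aff x"
  shows "even (card (linked (V, E) (aff x) v))"
  using v(1)
proof (cases rule: V_cases)
  case (1 y)
  have dbl: "a + a = 0" for a :: "'q^'m" using char2 by (simp add: vec_eq_iff)
  then have neg: "- a = a" for a :: "'q^'m" by (rule minus_unique)
  have "x \<noteq> y" using v 1 by auto
  let ?S = "{z. z - x \<in> KD \<and> z - y \<in> KD}"
  have "linked (V, E) (aff x) v = aff ` ?S"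
  proof (intro equalityI subsetI)
    fix u assume u: "u \<in> linked (V, E) (aff x) v"
    then have "u \<in> V" by (simp add: linked_def)
    then show "u \<in> aff ` ?S"
    proof (cases rule: V_cases)
      case z: (1 z)
      then show ?thesis using u common_nbrs_aff_aff[of x z] common_nbrs_aff_aff[of y z] by (auto simp: linked_def 1)
    next
      case (2 z d)
      then show ?thesis using u common_nbrs_aff_ln by (auto simp: linked_def)
    qed
  next
    fix u assume "u \<in> aff ` ?S"
    then obtain z where z: "u = aff z" "z - x \<in> KD" "z - y \<in> KD" by blast
    then have "z \<noteq> x" "z \<noteq> y" using KD_nz by auto
    then show "u \<in> linked (V, E) (aff x) v"
      using z common_nbrs_aff_aff[of x z] common_nbrs_aff_aff[of y z] by (auto simp: linked_def 1)
  qed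
  moreover have "card (aff ` ?S) = card ?S" by (rule card_image) (simp add: inj_on_def)
  moreover have "even (card ?S)"
  proof (rule even_card_involution)
    fix z assume z: "z \<in> ?S"
    have sub: "a - b = a + b" for a b :: "'q^'m" by (metis neg diff_conv_add_uminus)
    have cancel: "a + (a + b) = b" for a b :: "'q^'m" by (simp add: dbl flip: add.assoc)
    \<comment> \<open>In characteristic 2 the involution interchanges the two membership conditions;
      it moves every \<open>z\<close> because \<open>x + y\<close> is nonzero.\<close>
    have e1: "x + y + z - x = z - y" using sub[of z y] by (simp add: add.commute)
    have e2: "x + y + z - y = z - x" using sub[of z x] by (simp add: add.commute)
    have "x + y \<noteq> 0" using \<open>x \<noteq> y\<close> by (metis neg eq_neg_iff_add_eq_0)
    then have e3: "x + y + z \<noteq> z" by simp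
    show "x + y + z \<in> ?S \<and> x + y + (x + y + z) = z \<and> x + y + z \<noteq> z"
      using z e3 by (intro conjI) (simp_all only: mem_Collect_eq e1 e2 cancel not_False_eq_True simp_thms)
  qed simp
  ultimately show ?thesis by simp
next
  case (2 y d)
  have "u \<notin> linked (V, E) (aff x) v" for u
  proof
    assume u: "u \<in> linked (V, E) (aff x) v"
    then have "u \<in> V" by (simp add: linked_def)
    then show False
    proof (cases rule: V_cases)
      case (1 z)
      then show False
        using u common_nbrs_aff_ln[OF 2(1)] common_nbrs_sym[of "(V, E)" v] by (simp add: linked_def 2(2))
    next
      case (2 z d')
      then show False using u common_nbrs_aff_ln[OF 2(1)] by (simp add: linked_def)
    qed
  qed
  then have "linked (V, E) (aff x) v = {}" by blast
  then show ?thesis by simp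
qed

text \<open>An automorphism from the point \<open>aff 0\<close> to \<open>l\<close> would pull
  \<open>m\<close> back to a vertex different from \<open>aff 0\<close>, where the count is
  even.\<close>

lemma not_vertex_transitive:
  assumes "\<And>c::'q. c + c = 0" and "l \<in> V" "m \<in> V" "l \<noteq> m" "odd (card (linked (V, E) l m))"
  shows "\<not> vertex_transitive (V, E)"
proof
  assume "vertex_transitive (V, E)"
  then have "\<forall>u\<in>V. \<forall>v\<in>V. \<exists>f\<in>graph_automorphisms (V, E). f u = v" by (simp add: vertex_transitive_def)
  then obtain f where f: "f \<in> graph_automorphisms (V, E)" "f (aff 0) = l"
    using assms(2) aff_in_V[of 0] by blast
  have "f ` V = V" using f(1) by (auto simp: graph_automorphisms_def Bij_def bij_betw_def)
  then have "m \<in> f ` V" using assms(3) by simp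
  then obtain v where v: "v \<in> V" "f v = m" by blast
  then have "card (linked (V, E) l m) = card (linked (V, E) (aff 0) v)"
    using card_linked_automorphism[OF f(1), of "aff 0" v] f(2) by simp
  moreover have "v \<noteq> aff 0" using assms(4) v f by auto
  ultimately show False using even_linked_aff[OF assms(1) v(1)] assms(5) by simp
qed

end

section \<open>The linear representation of the Tits ovoid minus a point\<close>

locale ovoid_rep = frame w0 b + tits_field e r
  for w0 :: "'q::{field,finite}^'n" and b :: "4 \<Rightarrow> 'q^'n" and e :: nat and r :: "'r::{field,finite} itself" +
  fixes \<iota> :: "'r \<Rightarrow> 'q"
  assumes \<iota>: "field_embedding \<iota>" and card_q: "CARD('q) = CARD('r) ^ 2"
begin

lemmas \<iota>_simps = field_embeddingD[OF \<iota>]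

lemma card_q_power: "CARD('q) = 2 ^ (2 * (2 * e + 1))"
  by (simp add: card_q card_r flip: power_mult)

lemma double_q: "x + x = 0" and diff_q: "x - y = x + y" for x y :: 'q
  using char_two_minus[OF card_q_power] by auto

definition emb :: "'r^4 \<Rightarrow> 'q^4" where "emb v = (\<chi> i. \<iota> (v $ i))"

definition memb :: "'r^4^4 \<Rightarrow> 'q^4^4" where "memb M = (\<chi> i j. \<iota> (M $ i $ j))"

lemma emb_nth [simp]: "emb v $ i = \<iota> (v $ i)" by (simp add: emb_def)

lemma memb_nth [simp]: "memb M $ i $ j = \<iota> (M $ i $ j)" by (simp add: memb_def)

lemma emb_simps:
  "emb (x + y) = emb x + emb y" "emb (x - y) = emb x - emb y" "emb (c *s x) = \<iota> c *s emb x" "emb 0 = 0"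
  "emb (M *v x) = memb M *v emb x" "memb (M ** N) = memb M ** memb N" "memb (mat c) = mat (\<iota> c)"
  "emb x = emb y \<longleftrightarrow> x = y" "emb x = 0 \<longleftrightarrow> x = 0" "memb M = memb N \<longleftrightarrow> M = N"
  by (auto simp: vec_eq_iff \<iota>_simps diff_q matrix_vector_mult_def matrix_matrix_mult_def mat_def)

lemma memb_invertible: "invertible (memb M) \<longleftrightarrow> invertible M"
proof
  assume "invertible M"
  then show "invertible (memb M)"
    unfolding invertible_def by (metis emb_simps(6,7) \<iota>_simps(1))
next
  assume "invertible (memb M)"
  then show "invertible M" unfolding invertible_iff_ker by (metis emb_simps(4,5,9))
qed

text \<open>The factor is a quotient of two coordinates in the small field. Points of the Baer
  subspace are thus already told apart over F_r.\<close>

lemma span_emb: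
  assumes "v \<noteq> 0" "emb v = c *s emb w"
  shows "\<exists>k. k \<noteq> 0 \<and> c = \<iota> k \<and> v = k *s w"
proof -
  obtain i where i: "v $ i \<noteq> 0" using assms(1) by (auto simp: vec_eq_iff)
  have vi: "\<iota> (v $ j) = c * \<iota> (w $ j)" for j using arg_cong[OF assms(2), of "\<lambda>x. x $ j"] by simp
  then have wi: "w $ i \<noteq> 0" using i by (metis \<iota>_simps(2,7) mult_zero_right)
  define k where "k = v $ i * inverse (w $ i)"
  have ck: "c = \<iota> k" using vi[of i] wi by (simp add: k_def \<iota>_simps)
  then have "emb v = emb (k *s w)" using assms(2) by (simp add: emb_simps)
  then have "v = k *s w" by (simp only: emb_simps(8))
  then show ?thesis using ck assms(1) by auto
qed

text \<open>\<open>Q\<close> is the removed point in canonical coordinates. The generators have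
  coordinates in F_r, but the cone over them is taken over F_q.\<close>

definition dirs :: "('r^4) set \<Rightarrow> ('q^4) set" where
  "dirs Q = {c *s emb v | c v. c \<noteq> 0 \<and> v \<noteq> 0 \<and> vec.span {v} \<in> Omega \<and> vec.span {v} \<noteq> Q}"

lemma lin_rep_dirs: "lin_rep w0 b (dirs Q)"
proof
  show "0 \<notin> dirs Q" by (auto simp: dirs_def emb_simps)
  show "c *s d \<in> dirs Q" if "d \<in> dirs Q" "c \<noteq> 0" for c d
    using that unfolding dirs_def mem_Collect_eq by (metis mult_eq_0_iff vec.scale_scale)
qed

lemma dirs_e4: "dirs (vec.span {e4}) = {c *s emb (cv s t) | c s t. c \<noteq> 0}"
proof (intro equalityI subsetI)
  fix d assume "d \<in> dirs (vec.span {e4})"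
  then obtain c v where d: "d = c *s emb v" "c \<noteq> 0" "v \<noteq> 0" "vec.span {v} \<in> Omega" "vec.span {v} \<noteq> vec.span {e4}"
    by (auto simp: dirs_def)
  then obtain s t where "vec.span {v} = vec.span {cv s t}" by (auto simp: canonical_tits_ovoid_eq)
  then obtain k where "k \<noteq> 0" "v = k *s cv s t" using d(3) by (auto simp: span_singleton_eq_iff)
  then have "d = (c * \<iota> k) *s emb (cv s t)" "c * \<iota> k \<noteq> 0" using d by (simp_all add: emb_simps \<iota>_simps)
  then show "d \<in> {c *s emb (cv s t) | c s t. c \<noteq> 0}" by blast
next
  fix d assume "d \<in> {c *s emb (cv s t) | c s t. c \<noteq> 0}"
  then obtain c s t where d: "d = c *s emb (cv s t)" "c \<noteq> 0" by blast
  have "vec.span {cv s t} \<noteq> vec.span {e4}"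
  proof
    assume "vec.span {cv s t} = vec.span {e4}"
    then obtain k where "cv s t = k *s e4" by (auto simp: span_singleton_eq_iff)
    then show False by (auto simp: vec4_eq_iff)
  qed
  moreover have "vec.span {cv s t} \<in> Omega" by (auto simp: canonical_tits_ovoid_eq)
  ultimately show "d \<in> dirs (vec.span {e4})" using d cv_nz(1) unfolding dirs_def by blast
qed

abbreviation KD :: "('q^4) set" where "KD \<equiv> dirs (vec.span {e4})"

sublocale lin_rep w0 b KD by (rule lin_rep_dirs)

lemma emb_cv_KD: "emb (cv s t) \<in> KD"
  unfolding dirs_e4 by (rule CollectI) (metis one_neq_zero vec.scale_one)

lemma emb_cv_eq: "emb (cv s t) = c *s emb (cv s' t') \<Longrightarrow> c = 1 \<and> s = s' \<and> t = t'"
proof -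
  assume eq: "emb (cv s t) = c *s emb (cv s' t')"
  have "\<iota> 1 = c * \<iota> 1" using arg_cong[OF eq, of "\<lambda>x. x $ 1"] by simp
  then have "c = 1" by (simp add: \<iota>_simps(1))
  then show ?thesis using eq by (simp add: emb_simps cv_eq_iff)
qed

text \<open>One direction for each pair of \<open>s\<close> and \<open>t\<close>, so r^2 = q of
  them: the coincidence behind regularity.\<close>

lemma card_directions: "card (inf ` KD) = CARD('q)"
proof -
  have "inf ` KD = (\<lambda>(s, t). inf (emb (cv s t))) ` UNIV"
  proof (intro equalityI subsetI)
    fix k assume "k \<in> inf ` KD"
    then obtain c s t where k: "k = inf (c *s emb (cv s t))" "c \<noteq> 0" by (auto simp: dirs_e4)
    then have "k = inf (emb (cv s t))" by (subst k(1), subst inf_eq_iff) (auto simp: emb_simps)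
    then show "k \<in> (\<lambda>(s, t). inf (emb (cv s t))) ` UNIV" by (auto intro!: image_eqI[of _ _ "(s, t)"])
  next
    fix k assume "k \<in> (\<lambda>(s, t). inf (emb (cv s t))) ` UNIV"
    then obtain s t where "k = inf (emb (cv s t))" by auto
    then show "k \<in> inf ` KD" using emb_cv_KD by blast
  qed
  moreover have "inj (\<lambda>(s, t). inf (emb (cv s t)))"
  proof (rule injI, clarsimp)
    fix s t s' t' assume "inf (emb (cv s t)) = inf (emb (cv s' t'))"
    then obtain c where "emb (cv s t) = c *s emb (cv s' t')" by (auto simp: inf_eq_iff emb_simps)
    then show "s = s' \<and> t = t'" using emb_cv_eq by blast
  qed
  ultimately show ?thesis by (simp add: card_image card_q power2_eq_square)
qed

section \<open>Semilinear maps that preserve the directions\<close>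

lemma ex_subfield_aut:
  assumes "\<tau> \<in> field_auts"
  obtains \<rho> :: "'r \<Rightarrow> 'r" where "\<rho> \<in> field_auts" "\<And>x. \<tau> (\<iota> x) = \<iota> (\<rho> x)"
proof -
  define \<rho> where "\<rho> x = (SOME y. \<tau> (\<iota> x) = \<iota> y)" for x
  have \<rho>: "\<tau> (\<iota> x) = \<iota> (\<rho> x)" for x
    unfolding \<rho>_def by (rule someI_ex) (use field_auts_range_embedding[OF \<iota> assms, of "\<iota> x"] in auto)
  have "inj \<rho>"
  proof (rule injI)
    fix x y assume "\<rho> x = \<rho> y"
    then have "\<tau> (\<iota> x) = \<tau> (\<iota> y)" by (simp add: \<rho>)
    then show "x = y" by (simp add: field_auts_simps[OF assms] \<iota>_simps)
  qed
  moreover have "\<iota> (\<rho> (x + y)) = \<iota> (\<rho> x + \<rho> y)" "\<iota> (\<rho> (x * y)) = \<iota> (\<rho> x * \<rho> y)" for x y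
    by (simp_all add: \<iota>_simps field_autsD[OF assms] flip: \<rho>)
  then have "\<rho> (x + y) = \<rho> x + \<rho> y" "\<rho> (x * y) = \<rho> x * \<rho> y" for x y
    by (simp_all only: \<iota>_simps(6))
  ultimately have "\<rho> \<in> field_auts" by (simp add: field_auts_def bij_def finite_UNIV_inj_surj)
  then show thesis using \<rho> by (rule that)
qed

text \<open>\<open>sg\<close> is a power map, so field automorphisms commute with it and preserve
  the ovoid equation.\<close>

lemma vmap_cv:
  assumes "\<rho> \<in> field_auts" shows "vmap \<rho> (cv s t) = cv (\<rho> s) (\<rho> t)"
  by (simp add: vec4_eq_iff tits_sigma_def field_auts_simps[OF assms] field_autsD[OF assms])

lemma mmap_MG:
  assumes \<rho>: "\<rho> \<in> field_auts" and M: "M \<in> MG" shows "mmap \<rho> M \<in> MG"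
proof -
  have "\<exists>s' t'. mmap \<rho> M *v cv s t = cv s' t'" for s t
  proof -
    obtain s0 t0 where st: "s = \<rho> s0" "t = \<rho> t0" using field_autsD(1)[OF \<rho>] by (metis bij_pointE)
    obtain s1 t1 where "M *v cv s0 t0 = cv s1 t1" using M unfolding MG_def by blast
    then have "mmap \<rho> M *v cv s t = cv (\<rho> s1) (\<rho> t1)"
      by (simp add: st vmap_simps(6)[OF \<rho>, symmetric] flip: vmap_cv[OF \<rho>])
    then show ?thesis by blast
  qed
  then show ?thesis using M by (simp add: MG_def mmap_invertible[OF \<rho>])
qed

lemma vmap_emb: "(\<And>x. \<tau> (\<iota> x) = \<iota> (\<rho> x)) \<Longrightarrow> vmap \<tau> (emb v) = emb (vmap \<rho> v)"
  "(\<And>x. \<tau> (\<iota> x) = \<iota> (\<rho> x)) \<Longrightarrow> mmap \<tau> (memb M) = memb (mmap \<rho> M)"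
  by (simp_all add: vec_eq_iff)

lemma memb_MG_KD:
  assumes "\<tau> \<in> field_auts" "M \<in> MG" "c \<noteq> 0" "d \<in> KD"
  shows "(mat c ** memb M) *v vmap \<tau> d \<in> KD"
proof -
  obtain \<rho> :: "'r \<Rightarrow> 'r" where \<rho>: "\<rho> \<in> field_auts" "\<And>x. \<tau> (\<iota> x) = \<iota> (\<rho> x)" using ex_subfield_aut[OF assms(1)] by blast
  obtain k s t where d: "d = k *s emb (cv s t)" "k \<noteq> 0" using assms(4) by (auto simp: dirs_e4)
  obtain s' t' where M: "M *v cv (\<rho> s) (\<rho> t) = cv s' t'" using assms(2) unfolding MG_def by blast
  have "(mat c ** memb M) *v vmap \<tau> d = (c * \<tau> k) *s emb (cv s' t')"
    by (simp add: mat_mult_vector d vmap_simps[OF assms(1)] vmap_emb(1)[of \<tau> \<rho>, OF \<rho>(2)] vmap_cv[OF \<rho>(1)] vec.scale M flip: emb_simps)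
  moreover have "c * \<tau> k \<noteq> 0" using assms(3) d(2) by (simp add: field_auts_simps[OF assms(1)])
  ultimately show ?thesis unfolding dirs_e4 by blast
qed

text \<open>The affine part of the ovoid contains five points in general position, so a linear map over
  the large field that preserves it is, up to a scalar, defined over the small field.\<close>

lemma linear_preserving_KD:
  assumes A: "invertible A" and pres: "\<And>s t. \<exists>\<mu> s' t'. A *v emb (cv s t) = \<mu> *s emb (cv s' t')"
  obtains c M where "c \<noteq> 0" "M \<in> MG" "A = mat c ** memb M"
proof -
  have "\<exists>\<mu> z. \<mu> \<noteq> 0 \<and> A *v emb (cv s t) = \<mu> *s emb z" for s t
  proof -
    obtain \<mu> s' t' where "A *v emb (cv s t) = \<mu> *s emb (cv s' t')" using pres by blast
    moreover have "A *v emb (cv s t) \<noteq> 0" using A by (simp add: invertible_nz emb_simps)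
    ultimately show ?thesis by (metis vec.scale_zero_left)
  qed
  then obtain lam w where w: "\<And>s t. lam s t \<noteq> 0" "\<And>s t. A *v emb (cv s t) = lam s t *s emb (w s t)" by metis
  \<comment> \<open>The fifth point is \<open>cv s 0\<close>. With \<open>u = sg s * s ^ 2\<close>,
    general position requires \<open>u\<close>, \<open>1 + u\<close> and \<open>u + s\<close> to be
    nonzero, so \<open>s\<close> is taken outside {0, 1}.\<close>
  obtain s :: 'r where s: "s \<noteq> 0" "s \<noteq> 1" using ex_not_01 by blast
  define u where "u = sg s * s ^ 2"
  have u0: "u \<noteq> 0" using s by (simp add: u_def)
  have u1: "u \<noteq> 1"
  proof
    assume "u = 1"
    then have "sg s * s ^ 2 = 1" by (simp add: u_def)
    \<comment> \<open>\<open>sg\<close> maps \<open>sg s * s ^ 2\<close> to \<open>sg s\<close>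
      times itself.\<close>
    moreover have "s ^ 2 * (sg s) ^ 2 = 1" using arg_cong[OF calculation, of sg] by simp
    then have "sg s * (sg s * s ^ 2) = 1" by (simp add: power2_eq_square mult_ac)
    ultimately have "sg s = 1" by simp
    then show False using sg_inj[of s 1] s by simp
  qed
  have us: "u \<noteq> s"
  proof
    assume "u = s"
    then have "s * (sg s * s) = s * 1" by (simp add: u_def power2_eq_square mult_ac)
    then have ss: "sg s * s = 1" using s(1) by (simp only: mult_cancel_left) simp
    have "s ^ 2 * sg s = 1" using arg_cong[OF ss, of sg] by simp
    then have "s * (sg s * s) = 1" by (simp add: power2_eq_square mult_ac)
    then show False using ss s by simp
  qed
  define v :: "4 \<Rightarrow> 'r^4" where "v i = (if i = 1 then cv 0 0 else if i = 2 then cv 1 0 else if i = 3 then cv 0 1 else cv 1 1)" for i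
  define wi :: "4 \<Rightarrow> 'r^4" where "wi i = (if i = 1 then w 0 0 else if i = 2 then w 1 0 else if i = 3 then w 0 1 else w 1 1)" for i
  define l :: "4 \<Rightarrow> 'q" where "l i = (if i = 1 then lam 0 0 else if i = 2 then lam 1 0 else if i = 3 then lam 0 1 else lam 1 1)" for i
  \<comment> \<open>Coefficients of \<open>cv s 0\<close> with respect to the four vectors
    \<open>v i\<close>; the last two are equal.\<close>
  define c :: "4 \<Rightarrow> 'r" where "c i = (if i = 1 then 1 + u else if i = 2 then u else u + s)" for i
  have "1 + 1 + 1 = (1 :: 'r)" by (simp only: double add_0_left)
  then have v11: "cv 1 1 $ 4 = 1" by simp
  have l0: "l i \<noteq> 0" for i using w(1) by (simp add: l_def)
  have c0: "c i \<noteq> 0" for i using u0 u1 us by (auto simp: c_def)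
  have Av: "A *v emb (v i) = l i *s emb (wi i)" for i using w(2) by (simp add: v_def l_def wi_def)
  have sum5: "emb (cv s 0) = (\<Sum>i\<in>UNIV. \<iota> (c i) *s emb (v i))"
  proof -
    have "cv s 0 = (\<Sum>i\<in>UNIV. c i *s v i)"
      by (simp add: sum_4 v_def c_def vec4_eq_iff v11 u_def)
    then show ?thesis by (simp add: sum_4 emb_simps)
  qed
  have vindep: "y = 0" if "(\<Sum>i\<in>UNIV. y $ i *s emb (v i)) = 0" for y :: "'q^4"
  proof -
    have "y $ 1 + y $ 2 + y $ 3 + y $ 4 = 0" "y $ 2 + y $ 4 = 0" "y $ 3 + y $ 4 = 0" "y $ 2 + y $ 3 + y $ 4 = 0"
      using arg_cong[OF that, of "\<lambda>x. x $ 1"] arg_cong[OF that, of "\<lambda>x. x $ 2"]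
        arg_cong[OF that, of "\<lambda>x. x $ 3"] arg_cong[OF that, of "\<lambda>x. x $ 4"]
      by (simp_all add: sum_4 v_def \<iota>_simps v11)
    then show ?thesis by (simp add: vec4_eq_iff) (simp add: add.assoc)
  qed
  define W :: "'r^4^4" where "W = (\<chi> i j. wi j $ i)"
  have W: "memb W *v y = (\<Sum>i\<in>UNIV. y $ i *s emb (wi i))" for y
    by (simp add: vec_eq_iff matrix_vector_mult_def W_def sum_component mult.commute)
  have "invertible (memb W)"
    unfolding invertible_iff_ker
  proof (intro allI impI)
    fix y assume "memb W *v y = 0"
    then have "0 = (\<Sum>i\<in>UNIV. (y $ i / l i) *s (A *v emb (v i)))" using l0 by (simp add: W Av)
    also have "\<dots> = A *v (\<Sum>i\<in>UNIV. (\<chi> i. y $ i / l i) $ i *s emb (v i))" by (simp add: vec.sum vec.scale)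
    finally have "0 = A *v (\<Sum>i\<in>UNIV. (\<chi> i. y $ i / l i) $ i *s emb (v i))" .
    from iffD1[OF invertible_nz[OF A] this[symmetric]]
    have "(\<Sum>i\<in>UNIV. (\<chi> i. y $ i / l i) $ i *s emb (v i)) = 0" .
    then have "(\<chi> i. y $ i / l i) = (0 :: 'q^4)" by (rule vindep)
    then show "y = 0" using l0 by (simp add: vec_eq_iff)
  qed
  then have iW: "invertible W" by (simp add: memb_invertible)
  then obtain W' where W': "W ** W' = mat 1" unfolding invertible_def by blast
  define L where "L = lam s 0"
  have L0: "L \<noteq> 0" using w(1) by (simp add: L_def)
  \<comment> \<open>The image of the fifth point has coordinates in F_r with respect to the vectors
    \<open>wi i\<close>, which come from F_r. This makes each factor \<open>l i\<close> an
    F_r-multiple of the common factor \<open>L\<close>.\<close>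
  have "memb W *v (\<chi> i. \<iota> (c i) * l i / L) = inverse L *s (A *v emb (cv s 0))"
    by (simp add: W sum5 vec.sum vec.scale Av vec.scale_sum_right field_simps)
  also have "\<dots> = emb (w s 0)" using L0 by (simp add: w(2) L_def)
  also have "\<dots> = memb W *v emb (W' *v w s 0)"
    by (simp add: matrix_vector_mul_assoc W' flip: emb_simps(5))
  finally have eqn: "(\<chi> i. \<iota> (c i) * l i / L) = emb (W' *v w s 0)"
    using invertible_inj[OF \<open>invertible (memb W)\<close>] by blast
  define n where "n i = (W' *v w s 0) $ i / c i" for i
  have ln: "l i = L * \<iota> (n i)" for i
  proof -
    have e: "\<iota> (c i) * l i / L = \<iota> ((W' *v w s 0) $ i)" using arg_cong[OF eqn, of "\<lambda>x. x $ i"] by simp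
    have ci: "\<iota> (c i) \<noteq> 0" using c0[of i] by (simp only: \<iota>_simps(7) not_False_eq_True)
    have "L * \<iota> (n i) = L * ((\<iota> (c i) * l i / L) * inverse (\<iota> (c i)))"
      unfolding e n_def by (simp add: divide_inverse \<iota>_simps(4,10))
    also have "\<dots> = l i" using L0 ci by simp
    finally show ?thesis by simp
  qed
  define z where "z i = n i *s wi i" for i
  have Az: "A *v emb (v i) = L *s emb (z i)" for i by (simp add: Av ln z_def emb_simps)
  \<comment> \<open>The columns are the standard basis vectors written in terms of the
    \<open>v i\<close>, with each \<open>v i\<close> replaced by its rescaled image
    \<open>z i\<close>.\<close>
  define M0 :: "'r^4^4" where "M0 = (\<chi> i j. (if j = 1 then z 1 else if j = 2 then z 4 - z 3 else if j = 3 then z 4 - z 2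
      else z 2 + z 3 - z 4 - z 1) $ i)"
  have ax: "axis 1 1 = emb (v 1)" "axis 2 1 = emb (v 4) - emb (v 3)" "axis 3 1 = emb (v 4) - emb (v 2)"
    "axis 4 1 = emb (v 2) + emb (v 3) - emb (v 4) - emb (v 1)"
  proof -
    have "cv 0 0 $ 4 = 0" "cv 1 0 $ 4 = 1" "cv 0 1 $ 4 = 1" by simp_all
    moreover have "(2 :: 'q) = 0" by (metis double_q one_add_one)
    ultimately show "axis 1 1 = emb (v 1)" "axis 2 1 = emb (v 4) - emb (v 3)" "axis 3 1 = emb (v 4) - emb (v 2)"
      "axis 4 1 = emb (v 2) + emb (v 3) - emb (v 4) - emb (v 1)"
      by (simp_all add: vec4_eq_iff axis_def v_def \<iota>_simps v11 del: cv_nth(4))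
  qed
  have col: "memb M0 *v axis 1 1 = emb (z 1)" "memb M0 *v axis 2 1 = emb (z 4) - emb (z 3)"
    "memb M0 *v axis 3 1 = emb (z 4) - emb (z 2)"
    "memb M0 *v axis 4 1 = emb (z 2) + emb (z 3) - emb (z 4) - emb (z 1)"
    by (simp_all add: vec_eq_iff mult_axis M0_def \<iota>_simps diff_q)
  have "\<forall>j. A *v axis j 1 = L *s (memb M0 *v axis j 1)"
    unfolding forall_4 col unfolding ax
    by (simp add: vec.diff vec.add Az vec.scale_right_diff_distrib vec.scale_right_distrib)
  then have "A *v axis j 1 = L *s (memb M0 *v axis j 1)" for j by blast
  then have AM: "A = mat L ** memb M0"
    by (simp add: vec_eq_iff mult_axis mat_mult_component)
  have "invertible (memb M0)"
    using A L0 by (simp add: AM invertible_iff_ker mat_mult_vector)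
  then have iM: "invertible M0" by (simp add: memb_invertible)
  have "\<exists>\<mu> s' t'. M0 *v cv s t = \<mu> *s cv s' t'" for s t
  proof -
    obtain \<mu> s' t' where "A *v emb (cv s t) = \<mu> *s emb (cv s' t')" using pres by blast
    then have "L *s emb (M0 *v cv s t) = \<mu> *s emb (cv s' t')" by (simp add: AM mat_mult_vector emb_simps)
    then have "inverse L *s (L *s emb (M0 *v cv s t)) = inverse L *s (\<mu> *s emb (cv s' t'))" by simp
    then have "emb (M0 *v cv s t) = (inverse L * \<mu>) *s emb (cv s' t')" using L0 by simp
    moreover have "M0 *v cv s t \<noteq> 0" using iM by (simp add: invertible_nz)
    ultimately show ?thesis using span_emb by blast
  qed
  then obtain k M where M: "k \<noteq> 0" "M \<in> MG" "M0 = mat k ** M" using row_const_matrix[OF iM] by metis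
  have "A = mat (L * \<iota> k) ** memb M"
    by (simp add: AM M(3) vec_eq_iff mat_mult_component emb_simps \<iota>_simps mult.assoc)
  then show thesis using that[of "L * \<iota> k" M] M L0 by (simp add: \<iota>_simps)
qed

text \<open>Reduction to the linear case: \<tau> restricts to a permutation of the small field and
  therefore permutes the vectors \<open>emb (cv s t)\<close>.\<close>

lemma preserves_KD_iff:
  assumes \<tau>: "\<tau> \<in> field_auts"
  shows "invertible A \<and> (\<forall>d\<in>KD. A *v vmap \<tau> d \<in> KD) \<longleftrightarrow> (\<exists>c M. c \<noteq> 0 \<and> M \<in> MG \<and> A = mat c ** memb M)"
proof
  assume A: "invertible A \<and> (\<forall>d\<in>KD. A *v vmap \<tau> d \<in> KD)"
  obtain \<rho> :: "'r \<Rightarrow> 'r" where \<rho>: "\<rho> \<in> field_auts" "\<And>x. \<tau> (\<iota> x) = \<iota> (\<rho> x)" using ex_subfield_aut[OF \<tau>] by blast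
  have "\<exists>\<mu> s' t'. A *v emb (cv s t) = \<mu> *s emb (cv s' t')" for s t
  proof -
    obtain s0 t0 where "s = \<rho> s0" "t = \<rho> t0" using field_autsD(1)[OF \<rho>(1)] by (metis bij_pointE)
    then have "emb (cv s t) = vmap \<tau> (emb (cv s0 t0))" by (simp add: vmap_emb(1)[of \<tau> \<rho>, OF \<rho>(2)] vmap_cv[OF \<rho>(1)])
    then have "A *v emb (cv s t) \<in> KD" using A emb_cv_KD by simp
    then show ?thesis unfolding dirs_e4 by blast
  qed
  then show "\<exists>c M. c \<noteq> 0 \<and> M \<in> MG \<and> A = mat c ** memb M"
    using linear_preserving_KD A by metis
next
  assume "\<exists>c M. c \<noteq> 0 \<and> M \<in> MG \<and> A = mat c ** memb M"
  then obtain c M where M: "c \<noteq> 0" "M \<in> MG" "A = mat c ** memb M" by blast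
  then have "invertible (memb M)" by (simp add: memb_invertible MG_def)
  then have "invertible A" using M(1) by (simp add: M(3) invertible_iff_ker mat_mult_vector)
  then show "invertible A \<and> (\<forall>d\<in>KD. A *v vmap \<tau> d \<in> KD)" using memb_MG_KD[OF \<tau> M(2,1)] by (simp add: M(3))
qed

lemma edge_transitive_KD: "edge_transitive (V, E)"
proof (rule edge_transitive)
  fix d d' assume "d \<in> KD" "d' \<in> KD"
  then obtain k s t k' s' t' where d: "d = k *s emb (cv s t)" "k \<noteq> 0" "d' = k' *s emb (cv s' t')" "k' \<noteq> 0"
    unfolding dirs_e4 by blast
  \<comment> \<open>\<open>Mm_cv\<close> with \<open>k = 1\<close>, solved for the image
    \<open>cv s' t'\<close>.\<close>
  let ?M = "Mm 1 (s + s') (t' + t + sg (s + s') * s)"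
  have "?M *v cv s t = cv s' t'" by (simp add: Mm_cv cv_eq_iff algebra_simps)
  then have "memb ?M *v d = (k / k') *s d'" using d by (simp add: vec.scale flip: emb_simps)
  moreover have M: "?M \<in> MG" by (simp add: Mm_MG)
  then have "\<forall>k\<in>KD. memb ?M *v k \<in> KD" using memb_MG_KD[OF field_auts_id(1) M, of 1] by simp
  moreover have "invertible (memb ?M)" using M by (simp add: memb_invertible MG_def)
  ultimately show "\<exists>A c. invertible A \<and> (\<forall>k\<in>KD. A *v k \<in> KD) \<and> c \<noteq> 0 \<and> A *v d = c *s d'"
    using d by (metis divide_eq_0_iff)
qed

end

context ovoid_rep
begin

text \<open>With the removed point off the plane \<open>x\<^sub>2 = 0\<close>, that plane meets the point set in an oval of
  \<open>r + 1\<close> points; the transversals of two skew lines spanning with it a solid then correspond to the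
  \<open>r - 1\<close> remaining points of the oval, which is an odd number.\<close>

lemma not_vertex_transitive_dirs: "\<not> vertex_transitive (Gamma Hyp (inf ` dirs (vec.span {cv 1 0})))"
proof -
  let ?D = "dirs (vec.span {cv 1 0})"
  interpret L: lin_rep w0 b ?D by (rule lin_rep_dirs)
  have eq_span: "vec.span {v} = vec.span {w} \<Longrightarrow> v \<noteq> 0 \<Longrightarrow> \<exists>k. v = k *s w" for v w :: "'r^4"
    by (auto simp: span_singleton_eq_iff)
  have inD: "emb v \<in> ?D" if "v \<noteq> 0" "vec.span {v} \<in> Omega" "\<And>k. v \<noteq> k *s cv 1 0" for v
  proof -
    have "vec.span {v} \<noteq> vec.span {cv 1 0}" using eq_span that(1,3) by blast
    then show ?thesis
      unfolding dirs_def using that(1,2) by (intro CollectI exI[of _ 1] exI[of _ v]) simp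
  qed
  have cD: "emb (cv 0 t) \<in> ?D" for t
    by (rule inD) (auto simp: canonical_tits_ovoid_eq vec4_eq_iff)
  have eD: "emb e4 \<in> ?D"
    by (rule inD) (auto simp: canonical_tits_ovoid_eq vec4_eq_iff)
  have Dcases: "(\<exists>c. c \<noteq> 0 \<and> d = c *s emb e4) \<or> (\<exists>c s t. c \<noteq> 0 \<and> d = c *s emb (cv s t))" if "d \<in> ?D" for d
  proof -
    obtain c v where d: "d = c *s emb v" "c \<noteq> 0" "v \<noteq> 0" "vec.span {v} \<in> Omega"
      using \<open>d \<in> ?D\<close> unfolding dirs_def by blast
    then have "vec.span {v} = vec.span {e4} \<or> (\<exists>s t. vec.span {v} = vec.span {cv s t})"
      by (simp add: canonical_tits_ovoid_eq)
    then have "\<exists>k w. v = k *s w \<and> (w = e4 \<or> (\<exists>s t. w = cv s t))" using eq_span d(3) by metis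
    then obtain k w where kw: "v = k *s w" "w = e4 \<or> (\<exists>s t. w = cv s t)" by blast
    then have "k \<noteq> 0" using d(3) by auto
    then have "c * \<iota> k \<noteq> 0" "d = (c * \<iota> k) *s emb w" using d kw by (simp_all add: emb_simps \<iota>_simps)
    then show ?thesis using kw(2) by metis
  qed
  define e3 :: "'q^4" where "e3 = vector [0, 0, 1, 0]"
  \<comment> \<open>A transversal has direction proportional to some
    \<open>e3 + b' *s emb e4 + a *s emb (cv 0 0)\<close>. The second coordinate is zero and the
    third is not, which excludes \<open>e4\<close> and \<open>cv 0 0\<close> and leaves the
    directions \<open>cv 0 t\<close> with \<open>t\<close> nonzero.\<close>
  let ?l = "ln 0 (emb (cv 0 0))" and ?m = "ln e3 (emb e4)"
  \<comment> \<open>On the way from \<open>?l\<close> to \<open>?m\<close> the third coordinate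
    changes by 1, which determines the multiple \<open>inverse (\<iota> t)\<close> and with it the
    point on \<open>?l\<close>.\<close>
  define n where "n t = ln (inverse (\<iota> t) *s emb (cv 0 0)) (emb (cv 0 t))" for t :: 'r
  have nt: "emb (cv 0 t) \<noteq> c *s emb (cv 0 t')" if "t \<noteq> t'" for t t' c
    using emb_cv_eq that by blast
  have ne4: "emb (cv 0 t) \<noteq> c *s emb e4" for t c
    by (auto simp: vec4_eq_iff \<iota>_simps)
  have linked: "linked (L.V, L.E) ?l ?m = n ` (- {0})"
  proof (intro equalityI subsetI)
    fix u assume u: "u \<in> linked (L.V, L.E) ?l ?m"
    then have uV: "u \<in> L.V" and ul: "common_nbrs (L.V, L.E) ?l u" and um: "common_nbrs (L.V, L.E) ?m u"
      by (auto simp: linked_def)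
    from uV show "u \<in> n ` (- {0})"
    proof (cases rule: L.V_cases)
      case (1 x)
      then show ?thesis using ul L.common_nbrs_aff_ln[OF cD] common_nbrs_sym by metis
    next
      case (2 y d)
      obtain a \<alpha> where a: "0 + a *s emb (cv 0 0) = y + \<alpha> *s d"
        using ul unfolding 2(2) L.common_nbrs_ln_ln[OF cD 2(1)] by blast
      obtain b' \<beta> where b': "e3 + b' *s emb e4 = y + \<beta> *s d"
        using um unfolding 2(2) L.common_nbrs_ln_ln[OF eD 2(1)] by blast
      \<comment> \<open>In characteristic 2 this is the difference of the two parameters on the
        transversal.\<close>
      define \<delta> where "\<delta> = \<beta> + \<alpha>"
      have "e3 + b' *s emb e4 + a *s emb (cv 0 0) = (y + \<beta> *s d) + (y + \<alpha> *s d)"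
        using a b' by simp
      also have "\<dots> = \<delta> *s d"
        using double_q by (simp add: vec_eq_iff \<delta>_def algebra_simps)
      finally have D: "e3 + b' *s emb e4 + a *s emb (cv 0 0) = \<delta> *s d" .
      have D1: "a = \<delta> * d $ 1" and D2: "0 = \<delta> * d $ 2" and D3: "1 = \<delta> * d $ 3"
        using arg_cong[OF D, of "\<lambda>x. x $ 1"] arg_cong[OF D, of "\<lambda>x. x $ 2"] arg_cong[OF D, of "\<lambda>x. x $ 3"]
        by (simp_all add: e3_def \<iota>_simps)
      have "\<delta> \<noteq> 0" using D3 by auto
      from Dcases[OF 2(1)] show ?thesis
      proof
        assume "\<exists>c. c \<noteq> 0 \<and> d = c *s emb e4"
        then have "d $ 3 = 0" by (auto simp: \<iota>_simps)
        then show ?thesis using D3 by simp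
      next
        assume "\<exists>c s t. c \<noteq> 0 \<and> d = c *s emb (cv s t)"
        then obtain c s t where c: "c \<noteq> 0" "d = c *s emb (cv s t)" by blast
        have "s = 0" using D2 \<open>\<delta> \<noteq> 0\<close> c by (simp add: \<iota>_simps)
        have dt: "\<delta> * c * \<iota> t = 1" using D3 c by (simp add: mult.assoc)
        then have "\<iota> t \<noteq> 0" by auto
        then have "t \<noteq> 0" by (simp add: \<iota>_simps)
        have "a = inverse (\<iota> t)" using D1 c dt \<open>\<iota> t \<noteq> 0\<close>
          by (simp add: \<iota>_simps) (metis inverse_unique mult.commute)
        then have "n t = ln (y + \<alpha> *s d) (emb (cv 0 t))" using a by (simp add: n_def)
        moreover have "emb (cv 0 t) = inverse c *s d" using c \<open>s = 0\<close> by simp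
        ultimately have "n t = u"
          using ln_shift[of d "y + \<alpha> *s d" y \<alpha> "emb (cv 0 t)" "inverse c"] c L.KD_nz'[OF 2(1)] 2(2) by simp
        then show ?thesis using \<open>t \<noteq> 0\<close> by blast
      qed
    qed
  next
    fix u assume "u \<in> n ` (- {0})"
    then obtain t where t: "t \<noteq> 0" "u = n t" by blast
    then have it: "\<iota> t \<noteq> 0" by (simp add: \<iota>_simps)
    have "u \<noteq> ?l"
    proof
      assume "u = ?l"
      then obtain c where "emb (cv 0 t) = c *s emb (cv 0 0)"
        using ln_eqD(2)[OF L.KD_nz'[OF cD]] unfolding t n_def by blast
      then show False using nt t(1) by blast
    qed
    moreover have "u \<noteq> ?m"
    proof
      assume "u = ?m"
      then obtain c where "emb (cv 0 t) = c *s emb e4"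
        using ln_eqD(2)[OF L.KD_nz'[OF eD]] unfolding t n_def by blast
      then show False using ne4 by blast
    qed
    moreover have "common_nbrs (L.V, L.E) ?l u"
      unfolding t n_def L.common_nbrs_ln_ln[OF cD cD]
      by (rule exI[of _ "inverse (\<iota> t)"], rule exI[of _ 0]) simp
    moreover have "common_nbrs (L.V, L.E) ?m u"
      unfolding t n_def L.common_nbrs_ln_ln[OF eD cD]
    \<comment> \<open>\<open>cv 0 t\<close> is (1, 0, t, \<open>sg t\<close>). Scaled by the inverse
      of \<open>t\<close> and added to the point on \<open>?l\<close>, its first coordinate cancels
      and its third becomes 1.\<close>
    proof (rule exI[of _ "\<iota> (sg t) * inverse (\<iota> t)"], rule exI[of _ "inverse (\<iota> t)"])
      have "inverse (\<iota> t) + inverse (\<iota> t) = 0" by (rule double_q)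
      then show "e3 + (\<iota> (sg t) * inverse (\<iota> t)) *s emb e4 = inverse (\<iota> t) *s emb (cv 0 0) + inverse (\<iota> t) *s emb (cv 0 t)"
        using it by (simp add: vec4_eq_iff e3_def \<iota>_simps mult.commute)
    qed
    moreover have "u \<in> L.V" unfolding t n_def by (rule L.ln_in_V[OF cD])
    ultimately show "u \<in> linked (L.V, L.E) ?l ?m" by (simp add: linked_def)
  qed
  have "inj n"
  proof (rule injI)
    fix t t' assume "n t = n t'"
    then obtain c where "emb (cv 0 t) = c *s emb (cv 0 t')"
      using ln_eqD(2)[OF L.KD_nz'[OF cD]] unfolding n_def by blast
    then show "t = t'" using nt by blast
  qed
  then have "card (n ` (- {0})) = card (- {0::'r})" 
    by (intro card_image) (rule inj_on_subset[OF _ subset_UNIV])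
  also have "\<dots> = CARD('r) - 1" by (simp add: Compl_eq_Diff_UNIV card_Diff_singleton)
  finally have "odd (card (linked (L.V, L.E) ?l ?m))" unfolding linked by (simp add: card_r)
  moreover have "?l \<noteq> ?m"
  proof
    assume "?l = ?m"
    then obtain c where "emb (cv 0 0) = c *s emb e4" using ln_eqD(2)[OF L.KD_nz'[OF eD]] by blast
    then show False using ne4 by blast
  qed
  ultimately have "\<not> vertex_transitive (L.V, L.E)"
    using L.not_vertex_transitive[OF double_q L.ln_in_V[OF cD] L.ln_in_V[OF eD]] by blast
  then show ?thesis unfolding L.Gamma_eq .
qed

end

section \<open>The group of perspectivities\<close>

text \<open>On the sum of \<open>axis i 1\<close> and \<open>axis j y\<close> both coordinates are
  scaled alike: \<open>y = 1\<close> equates the eigenvalues of two axes, and arbitrary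
  \<open>y\<close> shows that \<tau> fixes \<open>y\<close>.\<close>

lemma scalar_matrix_if_fixes_points:
  fixes A :: "'a::field^'m^'m"
  assumes \<tau>: "\<tau> \<in> field_auts" and dim: "CARD('m) \<ge> 2"
    and fix_pts: "\<And>d. d \<noteq> 0 \<Longrightarrow> \<exists>c. c \<noteq> 0 \<and> A *v vmap \<tau> d = c *s d"
  shows "\<tau> = id" "\<exists>c. c \<noteq> 0 \<and> A = mat c"
proof -
  have "\<exists>c. c \<noteq> 0 \<and> A *v axis i 1 = c *s axis i 1" for i
    using fix_pts[of "axis i 1"] by (simp add: vmap_simps[OF \<tau>] field_auts_simps[OF \<tau>] axis_eq_0_iff)
  then obtain a where a: "\<And>i. a i \<noteq> 0" "\<And>i. A *v axis i 1 = a i *s axis i 1" by metis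
  have key: "a i = a j \<and> \<tau> x = x" if "i \<noteq> j" for i j x
  proof -
    have *: "a i = c \<and> a j * \<tau> y = c * y" 
      if "A *v vmap \<tau> (axis i 1 + axis j y) = c *s (axis i 1 + axis j y)" for c y
    proof -
      have "axis j y = y *s axis j (1 :: 'a)" by (simp add: vec_eq_iff axis_def)
      then have "A *v vmap \<tau> (axis i 1 + axis j y) = a i *s axis i 1 + (a j * \<tau> y) *s axis j 1"
        by (simp add: vmap_simps[OF \<tau>] field_auts_simps[OF \<tau>] vec.add vec.scale a(2) mult.commute)
      then have eq: "a i *s axis i 1 + (a j * \<tau> y) *s axis j 1 = c *s (axis i 1 + axis j y)" using that by simp
      show ?thesis
        using arg_cong[OF eq, of "\<lambda>v. v $ i"] arg_cong[OF eq, of "\<lambda>v. v $ j"] \<open>i \<noteq> j\<close>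
        by (simp add: axis_def)
    qed
    have nz: "axis i 1 + axis j y \<noteq> 0" for y :: 'a
    proof
      assume "axis i 1 + axis j y = 0"
      from arg_cong[OF this, of "\<lambda>v. v $ i"] show False using \<open>i \<noteq> j\<close> by (simp add: axis_def)
    qed
    obtain c where "A *v vmap \<tau> (axis i 1 + axis j 1) = c *s (axis i 1 + axis j 1)" using fix_pts[OF nz[of 1]] by blast
    from *[OF this] have aij: "a i = a j" by (simp add: field_auts_simps[OF \<tau>])
    obtain c' where "A *v vmap \<tau> (axis i 1 + axis j x) = c' *s (axis i 1 + axis j x)" using fix_pts[OF nz[of x]] by blast
    from *[OF this] have "a j * \<tau> x = a j * x" using aij by auto
    then have "\<tau> x = x" using a(1)[of j] by simp
    with aij show ?thesis by blast
  qed
  obtain i :: 'm where "True" by simp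
  obtain j where "j \<noteq> i"
  proof -
    obtain z where "z \<noteq> 0" "\<And>c. z \<noteq> c *s axis i (1::'a)"
      using ex_not_multiple[OF dim, of "axis i (1::'a)"] by (auto simp: axis_eq_0_iff)
    have "\<exists>j. j \<noteq> i"
    proof (rule ccontr)
      assume "\<nexists>j. j \<noteq> i"
      then have "z = z $ i *s axis i 1" by (auto simp: vec_eq_iff axis_def)
      then show False using \<open>\<And>c. z \<noteq> c *s axis i (1::'a)\<close> by blast
    qed
    then show thesis using that by blast
  qed
  then show "\<tau> = id" using key[of i j] by auto
  have "a j = a i" for j using key[of i j] by (cases "i = j") auto
  then have "A *v axis j 1 = a i *s axis j 1" for j using a(2) by simp
  then have "A $ k $ j = (a i *s axis j 1) $ k" for j k by (metis mult_axis)
  then have "A = mat (a i)" by (auto simp: vec_eq_iff mat_def axis_def)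
  then show "\<exists>c. c \<noteq> 0 \<and> A = mat c" using a(1) by blast
qed

context frame
begin

lemma mat_vector: "mat c *v x = c *s x" for x :: "'a::comm_semiring_1^'k"
  using mat_mult_vector[of c "mat 1" x] by simp

lemma mat_invertible: "c \<noteq> 0 \<Longrightarrow> invertible (mat c :: 'q^'m^'m)"
  by (simp add: invertible_iff_ker mat_vector)

text \<open>The points at infinity are fixed, so affine points go to affine points and the map is
  semilinear; fixing all directions makes its linear part scalar. Homotheties combined with
  translations remain.\<close>

lemma carrier_Persp:
  assumes dim: "CARD('m) \<ge> 2"
  shows "carrier (Persp Hyp) = {act pg_points id (mat c) w | c w. c \<noteq> 0}" (is "_ = ?P")
proof (intro equalityI subsetI)
  fix f assume "f \<in> carrier (Persp Hyp)"
  then have f: "f \<in> collineations" "\<And>x. x \<noteq> 0 \<Longrightarrow> f (inf x) = inf x"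
    by (auto simp: Persp_def points_on_Hyp)
  have bij: "bij_betw f pg_points pg_points" using f(1) by (simp add: collineations_def Bij_def)
  have "\<exists>y. f (aff x) = aff y" for x
  proof -
    have "f (aff x) \<in> pg_points" using bij by (auto simp: bij_betw_def)
    then show ?thesis
    proof (cases rule: points_cases)
      case (2 d)
      then have "f (aff x) = f (inf d)" using f(2) by simp
      moreover have "inj_on f pg_points" using bij by (simp add: bij_betw_def)
      ultimately have "aff x = inf d" using 2(1) by (auto dest: inj_onD)
      then show ?thesis by simp
    qed blast
  qed
  then obtain \<tau> A w where t: "\<tau> \<in> field_auts" "invertible A" "f = act pg_points \<tau> A w"
    using collineation_eq_act[OF f(1) dim] by blast
  have "\<exists>c. c \<noteq> 0 \<and> A *v vmap \<tau> d = c *s d" if "d \<noteq> 0" for d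
  proof -
    have "inf (A *v vmap \<tau> d) = inf d" using f(2)[OF that] that by (simp add: t(3) act_def sl_inf[OF t(1,2)])
    moreover have "A *v vmap \<tau> d \<noteq> 0" using that by (simp add: invertible_nz[OF t(2)] vmap_simps[OF t(1)])
    ultimately show ?thesis by (simp add: inf_eq_iff)
  qed
  from scalar_matrix_if_fixes_points[OF t(1) dim this]
  show "f \<in> ?P" using t(3) by blast
next
  fix f assume "f \<in> ?P"
  then obtain c w where f: "f = act pg_points id (mat c) w" "c \<noteq> 0" by blast
  have i: "invertible (mat c :: 'q^'m^'m)" using f(2) by (rule mat_invertible)
  have "inf (c *s x) = inf x" if "x \<noteq> 0" for x
    using that f(2) by (subst inf_eq_iff) auto
  then have "f p = p" if "p \<in> points_on Hyp" for p
    using that unfolding points_on_Hyp f(1) mem_Collect_eq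
    by (elim exE conjE) (simp add: act_def sl_inf[OF field_auts_id(1) i] mat_vector)
  then show "f \<in> carrier (Persp Hyp)"
    using act_collineation[OF field_auts_id(1) i] f(1) by (simp add: Persp_def)
qed

lemma mat_mult_mat: "mat c ** mat c' = (mat (c * c') :: 'q^'m^'m)"
  by (simp add: vec_eq_iff mat_mult_component) (simp add: mat_def)

lemma mat_compose:
  assumes "c \<noteq> 0" "c' \<noteq> 0" "\<And>X. X \<in> D \<Longrightarrow> sl id (mat c') u ` X \<in> D"
  shows "compose D (act D id (mat c) w) (act D id (mat c') u) = act D id (mat (c * c')) (c *s u + w)"
  using act_compose[OF field_auts_id(1) field_auts_id(1) assms(3)] by (simp add: mat_vector mat_mult_mat)

lemma Persp_act_point: "c \<noteq> 0 \<Longrightarrow> X \<in> pg_points \<Longrightarrow> sl id (mat c) u ` X \<in> pg_points"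
  by (rule sl_point[OF field_auts_id(1) mat_invertible])

lemma Persp_Bij: "c \<noteq> 0 \<Longrightarrow> act pg_points id (mat c) w \<in> Bij pg_points"
  by (rule act_Bij[OF field_auts_id(1) mat_invertible]) (simp_all add: Persp_act_point)

lemma group_Persp:
  assumes dim: "CARD('m) \<ge> 2"
  shows "group (Persp Hyp)"
proof -
  let ?P = "{act pg_points id (mat c) w | c w. c \<noteq> 0}"
  have P: "Persp Hyp = BijGroup pg_points\<lparr>carrier := ?P\<rparr>"
    using carrier_Persp[OF dim] by (simp add: Persp_def)
  show ?thesis
    unfolding P
  proof (rule finite_BijGroup_group)
    show "?P \<subseteq> Bij pg_points" using Persp_Bij by auto
    have "restrict id pg_points = act pg_points id (mat 1) 0" by (simp add: act_ident)
    then show "restrict id pg_points \<in> ?P" using one_neq_zero by blast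
    fix f g assume "f \<in> ?P" "g \<in> ?P"
    then obtain c w c' w' where fg: "f = act pg_points id (mat c) w" "g = act pg_points id (mat c') w'" "c \<noteq> 0" "c' \<noteq> 0"
      by blast
    have "compose pg_points f g = act pg_points id (mat (c * c')) (c *s w' + w)"
      unfolding fg(1,2) by (rule mat_compose[OF fg(3,4)]) (rule Persp_act_point[OF fg(4)])
    moreover have "c * c' \<noteq> 0" using fg by simp
    ultimately show "compose pg_points f g \<in> ?P" by blast
  qed simp
qed

lemma mat_eq_iff: "(mat c :: 'q^'m^'m) = mat d \<longleftrightarrow> c = d"
  by (auto simp: vec_eq_iff mat_def)

lemma card_Persp:
  assumes dim: "CARD('m) \<ge> 2"
  shows "card (carrier (Persp Hyp)) = (CARD('q) - 1) * CARD('q) ^ CARD('m)"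
proof -
  let ?h = "\<lambda>(c, w). act pg_points id (mat c) w"
  have "carrier (Persp Hyp) = ?h ` ((- {0}) \<times> UNIV)" unfolding carrier_Persp[OF dim] by auto
  moreover have "inj_on ?h ((- {0}) \<times> UNIV)"
  proof (rule inj_onI)
    fix p p' assume "p \<in> (- {0}) \<times> UNIV" "p' \<in> (- {0}) \<times> UNIV" "?h p = ?h p'"
    then obtain c w c' w' where p: "p = (c, w)" "p' = (c', w')" and c: "c \<noteq> 0" "c' \<noteq> 0"
      and eq: "act pg_points id (mat c) w = act pg_points id (mat c') w'" by auto
    have "range aff \<subseteq> pg_points" by auto
    from act_eqD(2,3)[OF field_auts_id(1) field_auts_id(1) mat_invertible[OF c(1)] mat_invertible[OF c(2)] this eq]
    show "p = p'" by (simp add: p mat_eq_iff)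
  qed
  ultimately show ?thesis
    by (simp add: card_image card_cartesian_product Compl_eq_Diff_UNIV card_Diff_singleton)
qed

end

section \<open>The structure of the geometric automorphism group\<close>

context lin_rep
begin

text \<open>The translation part does not occur, since translations fix every direction.\<close>

definition valid :: "('q \<Rightarrow> 'q) \<Rightarrow> 'q^'m^'m \<Rightarrow> bool" where
  "valid \<tau> A \<longleftrightarrow> \<tau> \<in> field_auts \<and> invertible A \<and> (\<forall>d\<in>KD. A *v vmap \<tau> d \<in> KD)"

lemma validD:
  assumes "valid \<tau> A"
  shows "\<tau> \<in> field_auts" "invertible A" "X \<in> V \<Longrightarrow> sl \<tau> A w ` X \<in> V" "act V \<tau> A w \<in> Bij V"
proof -
  show 1: "\<tau> \<in> field_auts" "invertible A" using assms by (auto simp: valid_def)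
  show 2: "sl \<tau> A w ` X \<in> V" if "X \<in> V" for X
    using sl_V[OF 1 _ that] assms by (auto simp: valid_def)
  show "act V \<tau> A w \<in> Bij V" by (rule act_Bij[OF 1 2])
qed

lemma valid_comp:
  assumes "valid \<tau> A" "valid \<rho> C"
  shows "valid (\<tau> \<circ> \<rho>) (A ** mmap \<tau> C)"
proof -
  note a = validD(1,2)[OF assms(1)] and c = validD(1,2)[OF assms(2)]
  have "(A ** mmap \<tau> C) *v vmap (\<tau> \<circ> \<rho>) d = A *v vmap \<tau> (C *v vmap \<rho> d)" for d
    by (simp add: vmap_simps[OF a(1)] vmap_comp matrix_vector_mul_assoc)
  then show ?thesis
    using assms a c by (simp add: valid_def field_auts_comp invertible_mult mmap_invertible)
qed

lemma act_V_compose: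
  "valid \<tau> A \<Longrightarrow> valid \<rho> C \<Longrightarrow>
    compose V (act V \<tau> A w) (act V \<rho> C u) = act V (\<tau> \<circ> \<rho>) (A ** mmap \<tau> C) (A *v vmap \<tau> u + w)"
  using act_compose[of \<tau> \<rho> V C u A w] validD by blast

lemma valid_one: "valid id (mat 1)"
  by (simp add: valid_def field_auts_id mat_invertible)

lemma valid_mat: "c \<noteq> 0 \<Longrightarrow> valid id (mat c)"
  by (simp add: valid_def field_auts_id mat_invertible mat_vector KD_scale)

lemma act_V_eqD:
  assumes "valid \<tau> A" "valid \<rho> C" "act V \<tau> A w = act V \<rho> C u"
  shows "\<tau> = \<rho>" "A = C" "w = u"
proof -
  have "range aff \<subseteq> V" by auto
  note * = act_eqD[OF validD(1)[OF assms(1)] validD(1)[OF assms(2)] validD(2)[OF assms(1)] validD(2)[OF assms(2)] this assms(3)]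
  show "\<tau> = \<rho>" by (rule *(1))
  show "A = C" by (rule *(2))
  show "w = u" by (rule *(3))
qed

lemma geometric_Aut_eq:
  assumes "CARD('m) \<ge> 2"
  shows "geometric_Aut (V, E) = BijGroup V\<lparr>carrier := {act V \<tau> A w | \<tau> A w. valid \<tau> A}\<rparr>"
  using carrier_geometric_Aut[OF assms] by (simp add: geometric_Aut_def valid_def)

lemma group_geometric_Aut:
  assumes "CARD('m) \<ge> 2"
  shows "group (geometric_Aut (V, E))"
proof -
  let ?C = "{act V \<tau> A w | \<tau> A w. valid \<tau> A}"
  show ?thesis
    unfolding geometric_Aut_eq[OF assms]
  proof (rule finite_BijGroup_group)
    show "?C \<subseteq> Bij V" using validD(4) by blast
    show "restrict id V \<in> ?C"
      using valid_one by (auto simp flip: act_ident)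
    fix f g assume "f \<in> ?C" "g \<in> ?C"
    then obtain \<tau> A w \<rho> C u where "f = act V \<tau> A w" "valid \<tau> A" "g = act V \<rho> C u" "valid \<rho> C" by blast
    then show "compose V f g \<in> ?C"
      using act_V_compose[of \<tau> A \<rho> C w u] valid_comp[of \<tau> A \<rho> C] by auto
  qed simp
qed

lemma collineation_image_act_V:
  assumes "\<tau> \<in> field_auts" "invertible A"
  shows "restrict (collineation_image (act pg_points \<tau> A w)) V = act V \<tau> A w"
  unfolding act_def[of V]
proof (rule restrict_ext)
  fix v assume "v \<in> V"
  then show "collineation_image (act pg_points \<tau> A w) v = sl \<tau> A w ` v"
    using V_subspace collineation_image_act[OF assms] by blast
qed

end

section \<open>The complement of the perspectivities\<close>

context ovoid_rep
begin

lemma valid_iff: "valid \<tau> A \<longleftrightarrow> \<tau> \<in> field_auts \<and> (\<exists>c M. c \<noteq> 0 \<and> M \<in> MG \<and> A = mat c ** memb M)"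
  using preserves_KD_iff unfolding valid_def by blast

lemma valid_memb: "\<tau> \<in> field_auts \<Longrightarrow> M \<in> MG \<Longrightarrow> valid \<tau> (memb M)"
  unfolding valid_iff by (metis matrix_mul_lid one_neq_zero)

lemma valid_mat_one: "\<tau> \<in> field_auts \<Longrightarrow> valid \<tau> (mat 1)"
  using valid_memb[OF _ MG_one] by (simp add: emb_simps \<iota>_simps)

lemma ex_mmap_memb:
  assumes "\<tau> \<in> field_auts" "M \<in> MG"
  obtains M' where "M' \<in> MG" "mmap \<tau> (memb M) = memb M'"
proof -
  obtain \<rho> :: "'r \<Rightarrow> 'r" where \<rho>: "\<rho> \<in> field_auts" "\<And>x. \<tau> (\<iota> x) = \<iota> (\<rho> x)" using ex_subfield_aut[OF assms(1)] by blast
  show thesis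
    by (rule that[OF mmap_MG[OF \<rho>(1) assms(2)]]) (rule vmap_emb(2)[of \<tau> \<rho>, OF \<rho>(2)])
qed

text \<open>The complement of \<open>Persp Hyp\<close>: no translation, and a matrix from
  \<open>MG\<close>, which excludes all scalars but 1.\<close>

definition CG :: "(('q^'n) set \<Rightarrow> ('q^'n) set) monoid" where
  "CG = BijGroup V\<lparr>carrier := {act V \<tau> (memb M) 0 | \<tau> M. \<tau> \<in> field_auts \<and> M \<in> MG}\<rparr>"

lemma carrier_CG: "carrier CG = {act V \<tau> (memb M) 0 | \<tau> M. \<tau> \<in> field_auts \<and> M \<in> MG}"
  by (simp add: CG_def)

lemma act_memb_compose:
  assumes "\<tau> \<in> field_auts" "M \<in> MG" "\<rho> \<in> field_auts" "N \<in> MG"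
  shows "compose V (act V \<tau> (memb M) 0) (act V \<rho> (memb N) 0) = act V (\<tau> \<circ> \<rho>) (memb M ** mmap \<tau> (memb N)) 0"
  using act_V_compose[OF valid_memb[OF assms(1,2)] valid_memb[OF assms(3,4)], of 0 0]
  by (simp add: vmap_simps[OF assms(1)])

lemma group_CG: "group CG"
proof -
  let ?C = "{act V \<tau> (memb M) 0 | \<tau> M. \<tau> \<in> field_auts \<and> M \<in> MG}"
  show ?thesis
    unfolding CG_def
  proof (rule finite_BijGroup_group)
    show "?C \<subseteq> Bij V"
      using validD(4)[OF valid_memb] by blast
    have "restrict id V = act V id (memb (mat 1)) 0" by (simp add: emb_simps \<iota>_simps act_ident)
    then show "restrict id V \<in> ?C"
      using MG_one field_auts_id(1) by blast
    fix f g assume "f \<in> ?C"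
      "g \<in> ?C"
    then obtain \<tau> M \<rho> N where fg: "f = act V \<tau> (memb M) 0" "g = act V \<rho> (memb N) 0"
      and t: "\<tau> \<in> field_auts" "M \<in> MG" "\<rho> \<in> field_auts" "N \<in> MG" by blast
    obtain N' where N': "N' \<in> MG" "mmap \<tau> (memb N) = memb N'" using ex_mmap_memb[OF t(1,4)] by blast
    have "compose V f g = act V (\<tau> \<circ> \<rho>) (memb (M ** N')) 0"
      by (simp add: fg act_memb_compose[OF t] N'(2) emb_simps)
    then show "compose V f g \<in> ?C"
      using MG_mult[OF t(2) N'(1)] field_auts_comp[OF t(1,3)] by blast
  qed simp
qed

lemma CG_mult:
  assumes "\<tau> \<in> field_auts" "M \<in> MG" "\<rho> \<in> field_auts" "N \<in> MG"
  shows "act V \<tau> (memb M) 0 \<otimes>\<^bsub>CG\<^esub> act V \<rho> (memb N) 0 = act V (\<tau> \<circ> \<rho>) (memb M ** mmap \<tau> (memb N)) 0"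
  using act_memb_compose[OF assms] validD(4)[OF valid_memb] assms by (simp add: CG_def BijGroup_compose)

lemma memb_one: "memb (mat 1) = mat 1"
  by (simp add: emb_simps \<iota>_simps)

text \<open>Maps with trivial \<tau> form a copy of \<open>FH\<close>. The coordinatewise
  automorphisms form a copy of Aut(F_q) and normalise it by acting on the matrix entries.\<close>

lemma CG_semidirect:
  assumes ad: "adapted M0 \<O> (vec.span {e4}) P"
  shows "\<exists>\<theta>\<in>hom (field_Aut :: ('q \<Rightarrow> 'q) monoid) (AutoGroup (FH \<O> P)). \<exists>h. h \<in> iso (semidirect_product (FH \<O> P) field_Aut \<theta>) CG"
proof -
  obtain N0 where N0: "M0 ** N0 = mat 1" "N0 ** M0 = mat 1" using ad by (auto simp: adapted_def invertible_def)
  define pr where "pr A = pg_map (M0 ** A ** N0)" for A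
  have pr: "pr \<in> iso MGgrp (FH \<O> P)" unfolding pr_def by (rule FH_iso[OF ad N0])
  then have bij: "bij_betw pr MG (carrier (FH \<O> P))" by (simp add: iso_def MGgrp_def)
  have pr_mult: "pr (A ** C) = pr A \<otimes>\<^bsub>FH \<O> P\<^esub> pr C" if "A \<in> MG" "C \<in> MG" for A C
    using pr that by (simp add: iso_def hom_def MGgrp_def)
  \<comment> \<open>The normalised matrix of an element of \<open>FH\<close>. The normalisation
    makes this choice of representatives multiplicative.\<close>
  define m where "m = inv_into MG pr"
  have m: "m g \<in> MG" "pr (m g) = g" if "g \<in> carrier (FH \<O> P)" for g
    using that bij by (auto simp: m_def bij_betw_def inv_into_into f_inv_into_f)
  have mpr: "m (pr A) = A" if "A \<in> MG" for A using that bij by (simp add: m_def bij_betw_def)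
  have m_mult: "m (g \<otimes>\<^bsub>FH \<O> P\<^esub> g') = m g ** m g'" if "g \<in> carrier (FH \<O> P)" "g' \<in> carrier (FH \<O> P)" for g g'
    using mpr[OF MG_mult[OF m(1)[OF that(1)] m(1)[OF that(2)]]] pr_mult[OF m(1)[OF that(1)] m(1)[OF that(2)]] m(2) that by simp
  let ?i = "\<lambda>g. act V id (memb (m g)) 0" and ?j = "\<lambda>\<tau>. act V \<tau> (mat 1) 0"
  have j: "?j \<tau> = act V \<tau> (memb (mat 1)) 0" for \<tau> by (simp add: memb_one)
  have "\<exists>\<theta>\<in>hom field_Aut (AutoGroup (FH \<O> P)). (\<lambda>(n, x). ?i n \<otimes>\<^bsub>CG\<^esub> ?j x) \<in> iso (semidirect_product (FH \<O> P) field_Aut \<theta>) CG"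
  proof (rule group.split_semidirect_product_iso[OF group_CG group_FH[OF ad] group_field_Aut])
    show "?i \<in> hom (FH \<O> P) CG"
    proof (rule homI)
      fix g assume "g \<in> carrier (FH \<O> P)"
      then show "?i g \<in> carrier CG" using m(1) field_auts_id(1) unfolding carrier_CG by blast
    next
      fix g g' assume g: "g \<in> carrier (FH \<O> P)" "g' \<in> carrier (FH \<O> P)"
      show "?i (g \<otimes>\<^bsub>FH \<O> P\<^esub> g') = ?i g \<otimes>\<^bsub>CG\<^esub> ?i g'"
        by (simp add: CG_mult[OF field_auts_id(1) m(1)[OF g(1)] field_auts_id(1) m(1)[OF g(2)]] m_mult[OF g] emb_simps)
    qed
    show "inj_on ?i (carrier (FH \<O> P))"
    proof (rule inj_onI)
      fix g g' assume g: "g \<in> carrier (FH \<O> P)" "g' \<in> carrier (FH \<O> P)" and eq: "?i g = ?i g'"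
      have "memb (m g) = memb (m g')"
        using act_V_eqD(2)[OF valid_memb[OF field_auts_id(1) m(1)[OF g(1)]] valid_memb[OF field_auts_id(1) m(1)[OF g(2)]] eq] .
      then show "g = g'" using m(2) g by (metis emb_simps(10))
    qed
    show "?j \<in> hom field_Aut CG"
    proof (rule homI)
      fix \<tau> :: "'q \<Rightarrow> 'q" assume "\<tau> \<in> carrier field_Aut"
      then show "?j \<tau> \<in> carrier CG" unfolding j carrier_CG carrier_field_Aut using MG_one by blast
    next
      fix \<tau> \<rho> :: "'q \<Rightarrow> 'q" assume "\<tau> \<in> carrier field_Aut" "\<rho> \<in> carrier field_Aut"
      then have t: "\<tau> \<in> field_auts" "\<rho> \<in> field_auts" by (simp_all add: carrier_field_Aut)
      show "?j (\<tau> \<otimes>\<^bsub>field_Aut\<^esub> \<rho>) = ?j \<tau> \<otimes>\<^bsub>CG\<^esub> ?j \<rho>"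
        using CG_mult[OF t(1) MG_one t(2) MG_one] t
        by (simp add: memb_one field_Aut_mult vmap_simps[OF t(1)] field_auts_simps[OF t(1)])
    qed
    show "inj_on ?j (carrier field_Aut)"
    proof (rule inj_onI)
      fix \<tau> \<rho> :: "'q \<Rightarrow> 'q" assume "\<tau> \<in> carrier field_Aut" "\<rho> \<in> carrier field_Aut" and eq: "?j \<tau> = ?j \<rho>"
      then have t: "\<tau> \<in> field_auts" "\<rho> \<in> field_auts" by (simp_all add: carrier_field_Aut)
      show "\<tau> = \<rho>" by (rule act_V_eqD(1)[OF valid_mat_one[OF t(1)] valid_mat_one[OF t(2)] eq])
    qed
    show "\<exists>g'\<in>carrier (FH \<O> P). ?j \<tau> \<otimes>\<^bsub>CG\<^esub> ?i g = ?i g' \<otimes>\<^bsub>CG\<^esub> ?j \<tau>"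
      if \<tau>g: "\<tau> \<in> carrier field_Aut" "g \<in> carrier (FH \<O> P)" for \<tau> g
    proof -
      have \<tau>: "\<tau> \<in> field_auts" using \<tau>g(1) by (simp add: carrier_field_Aut)
      obtain M' where M': "M' \<in> MG" "mmap \<tau> (memb (m g)) = memb M'" using ex_mmap_memb[OF \<tau> m(1)[OF \<tau>g(2)]] by blast
      have "?j \<tau> \<otimes>\<^bsub>CG\<^esub> ?i g = act V \<tau> (memb M') 0"
        unfolding j CG_mult[OF \<tau> MG_one field_auts_id(1) m(1)[OF \<tau>g(2)]] M'(2) by (simp add: memb_one)
      also have "\<dots> = ?i (pr M') \<otimes>\<^bsub>CG\<^esub> ?j \<tau>"
        unfolding j mpr[OF M'(1)] CG_mult[OF field_auts_id(1) M'(1) \<tau> MG_one] by (simp add: memb_one)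
      finally show ?thesis using bij M'(1) by (auto simp: bij_betw_def)
    qed
    show "?i ` carrier (FH \<O> P) \<inter> ?j ` carrier field_Aut \<subseteq> {\<one>\<^bsub>CG\<^esub>}"
    proof
      fix f assume "f \<in> ?i ` carrier (FH \<O> P) \<inter> ?j ` carrier field_Aut"
      then obtain g \<tau> where f: "f = ?i g" "f = ?j \<tau>" "g \<in> carrier (FH \<O> P)" "\<tau> \<in> carrier field_Aut" by blast
      then have \<tau>: "\<tau> \<in> field_auts" by (simp add: carrier_field_Aut)
      have "?i g = ?j \<tau>" using f by simp
      from act_V_eqD(1)[OF valid_memb[OF field_auts_id(1) m(1)[OF f(3)]] valid_mat_one[OF \<tau>] this]
      have "\<tau> = id" by simp
      then have "f = restrict id V" using f(2) by (simp add: act_ident)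
      then show "f \<in> {\<one>\<^bsub>CG\<^esub>}" by (simp add: CG_def BijGroup_def id_def)
    qed
    show "\<exists>g\<in>carrier (FH \<O> P). \<exists>\<tau>\<in>carrier field_Aut. f = ?i g \<otimes>\<^bsub>CG\<^esub> ?j \<tau>" if f: "f \<in> carrier CG" for f
    proof -
      obtain \<tau> M where t: "f = act V \<tau> (memb M) 0" "\<tau> \<in> field_auts" "M \<in> MG" using f unfolding carrier_CG by blast
      have "?i (pr M) \<otimes>\<^bsub>CG\<^esub> ?j \<tau> = f"
        unfolding j mpr[OF t(3)] CG_mult[OF field_auts_id(1) t(3,2) MG_one] by (simp add: memb_one t(1))
      moreover have "pr M \<in> carrier (FH \<O> P)" using bij t(3) by (auto simp: bij_betw_def)
      ultimately show ?thesis using t(2) unfolding carrier_field_Aut by metis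
    qed
  qed
  then show ?thesis by blast
qed

lemma mat_commute: "(A :: 'q^4^4) ** mat c = mat c ** A"
  by (simp add: vec_eq_iff mat_mult_component matrix_matrix_4 forall_4)

text \<open>\<open>Q\<close> is an abstract copy of \<open>CG\<close>, so that the inner semidirect
  product can be inserted as it stands.\<close>

lemma geometric_Aut_semidirect:
  assumes Q: "group Q" and h: "h \<in> iso Q CG"
  shows "\<exists>\<psi>\<in>hom Q (AutoGroup (Persp Hyp)). geometric_Aut (V, E) \<cong> semidirect_product (Persp Hyp) Q \<psi>"
proof -
  have dim: "CARD(4) \<ge> 2" by simp
  note G_eq = geometric_Aut_eq[OF dim] and gP = group_Persp[OF dim] and cP = carrier_Persp[OF dim]
  let ?G = "geometric_Aut (V, E)"
  have G_mult: "act V \<tau> A w \<otimes>\<^bsub>?G\<^esub> act V \<rho> C u = act V (\<tau> \<circ> \<rho>) (A ** mmap \<tau> C) (A *v vmap \<tau> u + w)"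
    if "valid \<tau> A" "valid \<rho> C" for \<tau> A w \<rho> C u
    using act_V_compose[OF that] validD(4)[OF that(1)] validD(4)[OF that(2)] by (simp add: G_eq BijGroup_compose)
  have carG: "carrier ?G = {act V \<tau> A w | \<tau> A w. valid \<tau> A}" by (simp add: G_eq)
  let ?i = "\<lambda>f. restrict (collineation_image f) V"
  have i: "?i (act pg_points id (mat c) w) = act V id (mat c) w" if "c \<noteq> 0" for c w
    by (rule collineation_image_act_V[OF field_auts_id(1) mat_invertible[OF that]])
  have hC: "h x \<in> carrier CG" if "x \<in> carrier Q" for x using h that by (auto simp: iso_def hom_def)
  have hcases: "\<exists>\<tau> M. h x = act V \<tau> (memb M) 0 \<and> \<tau> \<in> field_auts \<and> M \<in> MG" if "x \<in> carrier Q" for x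
    using hC[OF that] unfolding carrier_CG by blast
  have "\<exists>\<psi>\<in>hom Q (AutoGroup (Persp Hyp)). (\<lambda>(n, x). ?i n \<otimes>\<^bsub>?G\<^esub> h x) \<in> iso (semidirect_product (Persp Hyp) Q \<psi>) ?G"
  proof (rule group.split_semidirect_product_iso[OF group_geometric_Aut[OF dim] gP Q])
    show "?i \<in> hom (Persp Hyp) ?G"
    proof (rule homI)
      fix f assume "f \<in> carrier (Persp Hyp)"
      then show "?i f \<in> carrier ?G" unfolding cP carG using i valid_mat by blast
    next
      fix f g assume "f \<in> carrier (Persp Hyp)" "g \<in> carrier (Persp Hyp)"
      then obtain c w c' w' where fg: "f = act pg_points id (mat c) w" "g = act pg_points id (mat c') w'" and c: "c \<noteq> 0" "c' \<noteq> 0"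
        unfolding cP by blast
      have "f \<otimes>\<^bsub>Persp Hyp\<^esub> g = compose pg_points f g"
        unfolding fg using Persp_Bij c by (simp add: Persp_def BijGroup_compose)
      also have "\<dots> = act pg_points id (mat (c * c')) (c *s w' + w)"
        unfolding fg by (rule mat_compose[OF c]) (rule Persp_act_point[OF c(2)])
      finally have "?i (f \<otimes>\<^bsub>Persp Hyp\<^esub> g) = act V id (mat (c * c')) (c *s w' + w)" using i c by simp
      also have "\<dots> = ?i f \<otimes>\<^bsub>?G\<^esub> ?i g"
        unfolding fg i[OF c(1)] i[OF c(2)] G_mult[OF valid_mat[OF c(1)] valid_mat[OF c(2)]]
        by (simp add: mat_mult_mat mat_vector)
      finally show "?i (f \<otimes>\<^bsub>Persp Hyp\<^esub> g) = ?i f \<otimes>\<^bsub>?G\<^esub> ?i g" .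
    qed
    show "inj_on ?i (carrier (Persp Hyp))"
    proof (rule inj_onI)
      fix f g assume "f \<in> carrier (Persp Hyp)" "g \<in> carrier (Persp Hyp)" and eq: "?i f = ?i g"
      then obtain c w c' w' where fg: "f = act pg_points id (mat c) w" "g = act pg_points id (mat c') w'" and c: "c \<noteq> 0" "c' \<noteq> 0"
        unfolding cP by blast
      have "act V id (mat c) w = act V id (mat c') w'" using eq unfolding fg i[OF c(1)] i[OF c(2)] .
      from act_V_eqD(2,3)[OF valid_mat[OF c(1)] valid_mat[OF c(2)] this] show "f = g" by (simp add: fg)
    qed
    show "h \<in> hom Q ?G"
    proof (rule homI)
      fix x assume "x \<in> carrier Q"
      then show "h x \<in> carrier ?G" unfolding carG using hcases valid_memb by blast
    next
      fix x y assume "x \<in> carrier Q" "y \<in> carrier Q"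
      then show "h (x \<otimes>\<^bsub>Q\<^esub> y) = h x \<otimes>\<^bsub>?G\<^esub> h y" using h by (simp add: iso_def hom_def CG_def G_eq)
    qed
    show "inj_on h (carrier Q)" using h by (simp add: iso_def bij_betw_def)
    show "\<exists>n'\<in>carrier (Persp Hyp). h x \<otimes>\<^bsub>?G\<^esub> ?i n = ?i n' \<otimes>\<^bsub>?G\<^esub> h x"
      if x: "x \<in> carrier Q" and n: "n \<in> carrier (Persp Hyp)" for x n
    proof -
      obtain c w where cw: "n = act pg_points id (mat c) w" "c \<noteq> 0" using n unfolding cP by blast
      obtain \<tau> M where t: "h x = act V \<tau> (memb M) 0" "\<tau> \<in> field_auts" "M \<in> MG" using hcases[OF x] by blast
      have c': "\<tau> c \<noteq> 0" using cw(2) by (simp add: field_auts_simps[OF t(2)])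
      note v = valid_memb[OF t(2,3)]
      \<comment> \<open>The perspectivity with scalar \<open>c\<close> and translation
        \<open>w\<close> is conjugated into the one with scalar \<open>\<tau> c\<close> and
        translation \<open>?w'\<close>.\<close>
      let ?w' = "memb M *v vmap \<tau> w"
      have "h x \<otimes>\<^bsub>?G\<^esub> ?i n = act V \<tau> (mat (\<tau> c) ** memb M) ?w'"
        unfolding t(1) cw(1) i[OF cw(2)] G_mult[OF v valid_mat[OF cw(2)]]
        by (simp add: vmap_simps[OF t(2)] mat_commute)
      also have "\<dots> = act V id (mat (\<tau> c)) ?w' \<otimes>\<^bsub>?G\<^esub> h x"
        unfolding t(1) G_mult[OF valid_mat[OF c'] v] by simp
      finally have "h x \<otimes>\<^bsub>?G\<^esub> ?i n = ?i (act pg_points id (mat (\<tau> c)) ?w') \<otimes>\<^bsub>?G\<^esub> h x"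
        unfolding i[OF c'] .
      then show ?thesis unfolding cP using c' by blast
    qed
    show "?i ` carrier (Persp Hyp) \<inter> h ` carrier Q \<subseteq> {\<one>\<^bsub>?G\<^esub>}"
    proof
      fix f assume "f \<in> ?i ` carrier (Persp Hyp) \<inter> h ` carrier Q"
      then obtain n x where nx: "f = ?i n" "n \<in> carrier (Persp Hyp)" "f = h x" "x \<in> carrier Q" by blast
      obtain c w where cw: "n = act pg_points id (mat c) w" "c \<noteq> 0" using nx(2) unfolding cP by blast
      obtain \<tau> M where t: "h x = act V \<tau> (memb M) 0" "\<tau> \<in> field_auts" "M \<in> MG" using hcases[OF nx(4)] by blast
      have f: "f = act V id (mat c) w" using nx(1) i[OF cw(2)] cw(1) by simp
      have "act V id (mat c) w = act V \<tau> (memb M) 0" using f nx(3) t(1) by simp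
      from act_V_eqD(2,3)[OF valid_mat[OF cw(2)] valid_memb[OF t(2,3)] this]
      have cM: "mat c = memb M" "w = 0" by auto
      \<comment> \<open>A scalar matrix multiplies the first coordinate of \<open>cv 0 0\<close> by
        \<open>c\<close>, whereas a matrix from \<open>MG\<close> keeps it equal to 1.\<close>
      have "c = (mat c *v emb (cv 0 0)) $ 1" by (simp add: mat_vector \<iota>_simps)
      also have "\<dots> = 1" unfolding cM(1) using MG_row[OF t(3), of 0 0] by (simp add: \<iota>_simps flip: emb_simps)
      finally have "c = 1" .
      then have "f = restrict id V" using f cM(2) by (simp add: act_ident)
      then show "f \<in> {\<one>\<^bsub>?G\<^esub>}" by (simp add: G_eq BijGroup_def id_def)
    qed
    show "\<exists>n\<in>carrier (Persp Hyp). \<exists>x\<in>carrier Q. f = ?i n \<otimes>\<^bsub>?G\<^esub> h x" if f: "f \<in> carrier ?G" for f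
    proof -
      obtain \<tau> A w where "f = act V \<tau> A w" "valid \<tau> A" using f unfolding carG by blast
      then obtain c M where t: "f = act V \<tau> (mat c ** memb M) w" "\<tau> \<in> field_auts" "c \<noteq> 0" "M \<in> MG"
        unfolding valid_iff by blast
      have "act V \<tau> (memb M) 0 \<in> carrier CG" using t unfolding carrier_CG by blast
      then have "act V \<tau> (memb M) 0 \<in> h ` carrier Q" using h by (simp add: iso_def bij_betw_def)
      then obtain x where x: "x \<in> carrier Q" "h x = act V \<tau> (memb M) 0" by (metis imageE)
      have "?i (act pg_points id (mat c) w) \<otimes>\<^bsub>?G\<^esub> h x = f"
        unfolding x(2) i[OF t(3)] G_mult[OF valid_mat[OF t(3)] valid_memb[OF t(2,4)]] by (simp add: t(1) vmap_simps[OF field_auts_id(1)])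
      then show ?thesis unfolding cP using x(1) t(3) by blast
    qed
  qed
  then obtain \<psi> f where \<psi>: "\<psi> \<in> hom Q (AutoGroup (Persp Hyp))" and f: "f \<in> iso (semidirect_product (Persp Hyp) Q \<psi>) ?G" by blast
  have "semidirect_product (Persp Hyp) Q \<psi> \<cong> ?G" using f by (rule is_isoI)
  then have "?G \<cong> semidirect_product (Persp Hyp) Q \<psi>"
    by (rule group.iso_sym[OF group_semidirect_product[OF gP Q \<psi>]])
  then show ?thesis using \<psi> by blast
qed

theorem geometric_Aut_structure:
  assumes ad: "adapted M0 \<O> (vec.span {e4}) P"
  shows "\<exists>\<theta>\<in>hom (field_Aut :: ('q \<Rightarrow> 'q) monoid) (AutoGroup (FH \<O> P)).
      \<exists>\<psi>\<in>hom (semidirect_product (FH \<O> P) field_Aut \<theta>) (AutoGroup (Persp Hyp)).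
        geometric_Aut (V, E) \<cong> semidirect_product (Persp Hyp) (semidirect_product (FH \<O> P) field_Aut \<theta>) \<psi>" (is ?iso)
    and "card (carrier (geometric_Aut (V, E))) =
      (CARD('q) - 1) * CARD('q) ^ 4 * (((CARD('r) - 1) * CARD('r) ^ 2) * (2 * (2 * e + 1)))" (is ?card)
proof -
  obtain \<theta> h where \<theta>: "\<theta> \<in> hom (field_Aut :: ('q \<Rightarrow> 'q) monoid) (AutoGroup (FH \<O> P))" and h: "h \<in> iso (semidirect_product (FH \<O> P) field_Aut \<theta>) CG"
    using CG_semidirect[OF ad] by blast
  let ?Q = "semidirect_product (FH \<O> P) field_Aut \<theta>"
  have Q: "group ?Q" by (rule group_semidirect_product[OF group_FH[OF ad] group_field_Aut \<theta>])
  obtain \<psi> where \<psi>: "\<psi> \<in> hom ?Q (AutoGroup (Persp Hyp))" "geometric_Aut (V, E) \<cong> semidirect_product (Persp Hyp) ?Q \<psi>"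
    using geometric_Aut_semidirect[OF Q h] by blast
  show ?iso using \<theta> \<psi> by blast
  obtain N0 where N0: "M0 ** N0 = mat 1" "N0 ** M0 = mat 1" using ad by (auto simp: adapted_def invertible_def)
  have "card (carrier (FH \<O> P)) = (CARD('r) - 1) * CARD('r) ^ 2"
    using iso_same_card[OF is_isoI[OF FH_iso[OF ad N0]]] card_MG by (simp add: MGgrp_def)
  moreover have "card (carrier (field_Aut :: ('q \<Rightarrow> 'q) monoid)) = 2 * (2 * e + 1)"
    unfolding carrier_field_Aut by (rule card_field_auts[OF card_q_power]) simp
  moreover have "card (carrier (Persp Hyp)) = (CARD('q) - 1) * CARD('q) ^ 4"
    using card_Persp by simp
  moreover have "card (carrier (geometric_Aut (V, E))) = card (carrier (semidirect_product (Persp Hyp) ?Q \<psi>))"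
    using \<psi>(2) by (rule iso_same_card)
  ultimately show ?card by (simp add: semidirect_product_def card_cartesian_product)
qed

subsection \<open>Change of basis\<close>

text \<open>Change of basis by a matrix over F_r; for invertible \<open>M\<close> the Baer subspace
  stays the same. An adapted \<open>M\<close> gives \<open>\<O>\<close> canonical
  coordinates.\<close>

definition nb :: "'r^4^4 \<Rightarrow> 4 \<Rightarrow> 'q^'n" where "nb M j = (\<Sum>i\<in>UNIV. memb M $ i $ j *s b i)"

lemma sum_nb: "(\<Sum>j\<in>UNIV. x $ j *s nb M j) = B (memb M *v x)"
proof -
  have "(\<Sum>j\<in>UNIV. x $ j *s nb M j) = (\<Sum>j\<in>UNIV. \<Sum>i\<in>UNIV. (memb M $ i $ j * x $ j) *s b i)"
    by (simp add: nb_def vec.scale_sum_right mult.commute)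
  also have "\<dots> = (\<Sum>i\<in>UNIV. \<Sum>j\<in>UNIV. (memb M $ i $ j * x $ j) *s b i)" by (rule sum.swap)
  also have "\<dots> = B (memb M *v x)" by (simp add: B_def matrix_vector_mult_def vec.scale_sum_left)
  finally show ?thesis .
qed

lemma frame_nb:
  assumes "invertible M" shows "frame w0 (nb M)"
proof
  have iM: "invertible (memb M)" using assms by (simp add: memb_invertible)
  show "c = 0 \<and> x = 0" if "c *s w0 + (\<Sum>i\<in>UNIV. x $ i *s nb M i) = 0" for c x
    using that unfolding sum_nb coords_eq_0_iff by (simp add: invertible_nz[OF iM])
  show "\<exists>c x. v = c *s w0 + (\<Sum>i\<in>UNIV. x $ i *s nb M i)" for v
  proof -
    obtain c x where v: "v = c *s w0 + B x" using coords_ex by blast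
    obtain N where "memb M ** N = mat 1" using iM unfolding invertible_def by blast
    then have "memb M *v (N *v x) = x" by (simp add: matrix_vector_mul_assoc)
    then show ?thesis unfolding sum_nb using v by metis
  qed
qed

lemma ovoid_rep_nb: "invertible M \<Longrightarrow> ovoid_rep w0 (nb M) e \<iota>"
  by (intro ovoid_rep.intro frame_nb tits_field_axioms ovoid_rep_axioms.intro \<iota> card_q)

lemma B_nb: "invertible M \<Longrightarrow> frame.B (nb M) x = B (memb M *v x)"
  using frame.B_def[OF frame_nb] sum_nb by metis

lemma Hyp_nb:
  assumes "invertible M" shows "frame.Hyp (nb M) = Hyp"
proof -
  have iM: "invertible (memb M)" using assms by (simp add: memb_invertible)
  then obtain N where "memb M ** N = mat 1" unfolding invertible_def by blast
  then have "memb M *v (N *v x) = x" for x by (simp add: matrix_vector_mul_assoc)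
  then have "range (\<lambda>x. B (memb M *v x)) = range B" by (metis (no_types, lifting) UNIV_I image_eqI image_subset_iff subset_antisym)
  then show ?thesis
    unfolding Hyp_def frame.Hyp_def[OF frame_nb[OF assms]] by (simp add: B_nb[OF assms])
qed

text \<open>In the basis \<open>nb M\<close> the ovoid is canonical and the removed point is
  \<open>Q\<close>; by \<open>span_emb\<close> no other point of the ovoid has the same image as the
  removed one.\<close>

lemma baer_image:
  assumes ad: "adapted M \<O> Q P" and Q: "Q \<in> Omega"
    and \<phi>: "\<And>X. X \<in> pg_points \<Longrightarrow> \<phi> X = vec.span ((\<lambda>x. \<Sum>i\<in>UNIV. \<iota> (x $ i) *s b i) ` X)"
  shows "\<phi> ` \<O> - {\<phi> P} = frame.inf (nb M) ` dirs Q"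
proof -
  have iM: "invertible M" and \<O>: "\<O> = (\<lambda>X. (*v) M ` X) ` Omega" and P: "P = (*v) M ` Q"
    using ad by (auto simp: adapted_def)
  interpret N: ovoid_rep w0 "nb M" e r \<iota> by (rule ovoid_rep_nb[OF iM])
  have \<phi>M: "\<phi> ((*v) M ` vec.span {v}) = N.inf (emb v)" if "v \<noteq> 0" for v
  proof -
    have "\<phi> (vec.span {M *v v}) = vec.span ((\<lambda>x. B (emb x)) ` vec.span {M *v v})"
      using that iM by (simp add: \<phi> invertible_nz B_def)
    also have "(\<lambda>x. B (emb x)) ` vec.span {M *v v} = {\<iota> k *s N.B (emb v) | k. True}"
      by (auto simp: vec.span_singleton image_image emb_simps B_scale B_nb[OF iM])
    \<comment> \<open>The F_r-multiples include the vector itself, so over F_q they span everything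
      it spans.\<close>
    also have "vec.span \<dots> = vec.span {N.B (emb v)}"
    proof (rule vec.span_unique)
      show "{\<iota> k *s N.B (emb v) | k. True} \<subseteq> vec.span {N.B (emb v)}"
        by (auto simp: in_span_single)
      fix T assume T: "{\<iota> k *s N.B (emb v) | k. True} \<subseteq> T" "vec.subspace T"
      have "\<iota> 1 *s N.B (emb v) \<in> T" using T(1) by blast
      then show "vec.span {N.B (emb v)} \<subseteq> T" using T(2) by (simp add: \<iota>_simps span_single_subset)
    qed simp
    finally show ?thesis by (simp add: image_matrix_span N.inf_def)
  qed
  obtain q where q: "Q = vec.span {q}" "q \<noteq> 0" using Q Omega_points by (auto simp: pg_points_eq)
  have eq: "N.inf (emb v) = N.inf (emb q) \<longleftrightarrow> vec.span {v} = Q" if v: "v \<noteq> 0" for v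
  proof
    assume "N.inf (emb v) = N.inf (emb q)"
    then obtain c where "emb v = c *s emb q" using v by (auto simp: N.inf_eq_iff emb_simps)
    then obtain k where "k \<noteq> 0" "v = k *s q" using span_emb[OF v] by blast
    then show "vec.span {v} = Q" by (simp add: q(1) span_singleton_scale)
  next
    assume "vec.span {v} = Q"
    then obtain c where "c \<noteq> 0" "v = c *s q" using v q by (auto simp: span_singleton_eq_iff)
    then show "N.inf (emb v) = N.inf (emb q)"
      using v by (subst N.inf_eq_iff) (auto simp: emb_simps \<iota>_simps intro!: exI[of _ "\<iota> c"])
  qed
  have "\<phi> ` \<O> - {\<phi> P} = {N.inf (emb v) | v. v \<noteq> 0 \<and> vec.span {v} \<in> Omega \<and> vec.span {v} \<noteq> Q}"
  proof (intro equalityI subsetI)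
    fix k assume k: "k \<in> \<phi> ` \<O> - {\<phi> P}"
    then obtain X where X: "X \<in> Omega" "k = \<phi> ((*v) M ` X)" by (auto simp: \<O>)
    then obtain v where v: "X = vec.span {v}" "v \<noteq> 0" using Omega_points by (auto simp: pg_points_eq)
    have "vec.span {v} \<noteq> Q" using k X(2) v by (auto simp: P)
    then show "k \<in> {N.inf (emb v) | v. v \<noteq> 0 \<and> vec.span {v} \<in> Omega \<and> vec.span {v} \<noteq> Q}"
      using X v \<phi>M by blast
  next
    fix k assume "k \<in> {N.inf (emb v) | v. v \<noteq> 0 \<and> vec.span {v} \<in> Omega \<and> vec.span {v} \<noteq> Q}"
    then obtain v where v: "k = N.inf (emb v)" "v \<noteq> 0" "vec.span {v} \<in> Omega" "vec.span {v} \<noteq> Q" by blast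
    then have "k = \<phi> ((*v) M ` vec.span {v})" by (simp add: \<phi>M)
    moreover have "k \<noteq> \<phi> P" using eq[OF v(2)] v q by (simp add: P \<phi>M)
    ultimately show "k \<in> \<phi> ` \<O> - {\<phi> P}" using v(3) by (auto simp: \<O>)
  qed
  also have "\<dots> = N.inf ` dirs Q"
  proof (intro equalityI subsetI)
    fix k assume "k \<in> {N.inf (emb v) | v. v \<noteq> 0 \<and> vec.span {v} \<in> Omega \<and> vec.span {v} \<noteq> Q}"
    then obtain v where v: "k = N.inf (emb v)" "v \<noteq> 0" "vec.span {v} \<in> Omega" "vec.span {v} \<noteq> Q" by blast
    then have "emb v \<in> dirs Q"
      unfolding dirs_def by (intro CollectI exI[of _ 1] exI[of _ v]) simp
    then show "k \<in> N.inf ` dirs Q" using v(1) by blast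
  next
    fix k assume "k \<in> N.inf ` dirs Q"
    then obtain c v where v: "k = N.inf (c *s emb v)" "c \<noteq> 0" "v \<noteq> 0" "vec.span {v} \<in> Omega" "vec.span {v} \<noteq> Q"
      unfolding dirs_def by blast
    have "N.inf (c *s emb v) = N.inf (emb v)" using v by (subst N.inf_eq_iff) (auto simp: emb_simps)
    then show "k \<in> {N.inf (emb v) | v. v \<noteq> 0 \<and> vec.span {v} \<in> Omega \<and> vec.span {v} \<noteq> Q}" using v by auto
  qed
  finally show ?thesis .
qed

end

text \<open>Any vector off the hyperplane extends the four basis vectors to five independent ones,
  which fill the space.\<close>

lemma ex_frame:
  fixes H :: "('q::{field,finite}^5) set" and b :: "4 \<Rightarrow> 'q^5"
  assumes H: "H \<in> pg_hyperplanes" and b: "inj b" "vec.independent (range b)" "vec.span (range b) = H"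
  obtains w0 where "frame w0 b" "frame.Hyp b = H"
proof -
  have dimH: "vec.dim H = 4" using H by (simp add: pg_hyperplanes_def)
  have "H \<noteq> UNIV" using dimH vec_dim_card[where ?'a = 'q and ?'n = 5] by auto
  then obtain w0 where w0: "w0 \<notin> H" by blast
  have indep: "vec.independent (insert w0 (range b))"
    using w0 b by (intro vec.independent_insertI) simp_all
  have "w0 \<notin> range b" using w0 b(3) vec.span_base by blast
  then have "card (insert w0 (range b)) = 5" using b(1) by (simp add: card_image)
  then have span: "vec.span (insert w0 (range b)) = UNIV"
    using vec.card_ge_dim_independent[OF _ indep, of UNIV] vec_dim_card[where ?'a = 'q and ?'n = 5] by auto
  have range_sum: "x \<in> H \<longleftrightarrow> (\<exists>y. x = (\<Sum>i\<in>UNIV. y $ i *s b i))" for x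
  proof
    assume "x \<in> H"
    then have "x \<in> vec.span (range b)" using b by simp
    then obtain u where "x = (\<Sum>v\<in>range b. u v *s v)" by (auto simp: vec.span_finite)
    then have "x = (\<Sum>i\<in>UNIV. (\<chi> i. u (b i)) $ i *s b i)" using b(1) by (simp add: sum.reindex)
    then show "\<exists>y. x = (\<Sum>i\<in>UNIV. y $ i *s b i)" by blast
  next
    assume "\<exists>y. x = (\<Sum>i\<in>UNIV. y $ i *s b i)"
    then show "x \<in> H"
      unfolding b(3)[symmetric] by (elim exE) (simp, intro vec.span_sum vec.span_scale vec.span_base rangeI)
  qed
  have subH: "vec.subspace H" using H by (simp add: pg_hyperplanes_def)
  have fr: "frame w0 b"
  proof
    fix c and x :: "'q^4" assume z: "c *s w0 + (\<Sum>i\<in>UNIV. x $ i *s b i) = 0"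
    have xH: "(\<Sum>i\<in>UNIV. x $ i *s b i) \<in> H" using range_sum by blast
    have c: "c = 0"
    proof (rule ccontr)
      assume "c \<noteq> 0"
      have "c *s w0 = - (\<Sum>i\<in>UNIV. x $ i *s b i)" using z by (simp add: eq_neg_iff_add_eq_0)
      then have "c *s w0 \<in> H" using vec.subspace_neg[OF subH xH] by simp
      then have "inverse c *s (c *s w0) \<in> H" by (rule vec.subspace_scale[OF subH])
      then show False using w0 \<open>c \<noteq> 0\<close> by simp
    qed
    then have "(\<Sum>i\<in>UNIV. x $ i *s b i) = 0" using z by simp
    then have "(\<Sum>v\<in>range b. (x $ inv_into UNIV b v) *s v) = 0" using b(1) by (simp add: sum.reindex)
    then have "x $ inv_into UNIV b (b i) = 0" for i
      using vec.independentD[OF b(2), of "range b" "\<lambda>v. x $ inv_into UNIV b v" "b i"] by simp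
    then show "c = 0 \<and> x = 0" using c b(1) by (simp add: vec_eq_iff)
  next
    fix v
    have "v \<in> vec.span (insert w0 (range b))" using span by simp
    then obtain c where "v - c *s w0 \<in> vec.span (range b)" unfolding vec.span_breakdown_eq by blast
    then obtain y where "v - c *s w0 = (\<Sum>i\<in>UNIV. y $ i *s b i)" using range_sum b(3) by blast
    then have "v = c *s w0 + (\<Sum>i\<in>UNIV. y $ i *s b i)" by (simp add: diff_eq_eq add.commute)
    then show "\<exists>c x. v = c *s w0 + (\<Sum>i\<in>UNIV. x $ i *s b i)" by blast
  qed
  moreover have "frame.Hyp b = H"
    unfolding frame.Hyp_def[OF fr] using range_sum by (auto simp: frame.B_def[OF fr])
  ultimately show thesis by (rule that)
qed

theorem theorem4p7:
  fixes q h e :: nat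
    and H :: "('q::{field,finite} ^ 5) set"
    and \<pi> \<T> K :: "('q ^ 5) set set"
    and \<phi> :: "('r::{field,finite} ^ 4) set \<Rightarrow> ('q ^ 5) set"
    and \<O> :: "('r ^ 4) set set"
    and P :: "('r ^ 4) set"
  assumes "q = 2 ^ h" and "h = 2 * (2 * e + 1)" and "e \<ge> 1"
    and "CARD('q) = q"
    and "H \<in> pg_hyperplanes"
    and "baer_subspace H \<pi> \<phi>"
    and "tits_ovoid e \<O>" and "P \<in> \<O>"
    and "\<T> = \<phi> ` \<O>"
    and "K = \<T> - {\<phi> P}"
  shows "semisymmetric (Gamma H K) \<and>
    (\<exists>\<theta> \<in> hom (field_Aut :: ('q \<Rightarrow> 'q) monoid) (AutoGroup (FH \<O> P)).
      \<exists>\<psi> \<in> hom (semidirect_product (FH \<O> P) field_Aut \<theta>) (AutoGroup (Persp H)).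
        geometric_Aut (Gamma H K)
          \<cong> semidirect_product (Persp H) (semidirect_product (FH \<O> P) field_Aut \<theta>) \<psi>) \<and>
    real (card (carrier (geometric_Aut (Gamma H K))))
      = real h * real q ^ 5 * (real q - 1) * (sqrt (real q) - 1)"
proof -
  obtain \<iota> :: "'r \<Rightarrow> 'q" and b :: "4 \<Rightarrow> 'q ^ 5" where card_q: "CARD('q) = CARD('r) ^ 2"
    and \<iota>: "field_embedding \<iota>" and b: "inj b" "vec.independent (range b)" "vec.span (range b) = H"
    and \<phi>: "\<And>X. X \<in> pg_points \<Longrightarrow> \<phi> X = vec.span ((\<lambda>x. \<Sum>i\<in>UNIV. \<iota> (x $ i) *s b i) ` X)"
    using assms(6) unfolding baer_subspace_def by blast
  \<comment> \<open>The order of the small field is forced by that of the large one.\<close>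
  have "CARD('r) ^ 2 = (2 ^ (2 * e + 1)) ^ 2"
    using assms(1,2,4) card_q by (simp add: mult.commute flip: power_mult)
  then have card_r: "CARD('r) = 2 ^ (2 * e + 1)" by (rule power2_eq_imp_eq) simp_all
  obtain w0 where fr: "frame w0 b" "frame.Hyp b = H" using ex_frame[OF assms(5) b] .
  interpret tits_field e "TYPE('r)" by unfold_locales (use card_r assms(3) in auto)
  interpret O: ovoid_rep w0 b e "TYPE('r)" \<iota>
    by (intro ovoid_rep.intro fr tits_field_axioms ovoid_rep_axioms.intro \<iota> card_q)
  have inOmega: "vec.span {e4} \<in> Omega" "vec.span {cv 1 0} \<in> Omega"
    by (auto simp: canonical_tits_ovoid_eq)
  \<comment> \<open>Two coordinate systems for one graph: removed point \<open>e4\<close> for the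
    group, regularity and edges, removed point (1, 1, 0, 1) for the parity count.\<close>
  obtain M where M: "adapted M \<O> (vec.span {e4}) P" using ex_adapted[OF assms(7,8) inOmega(1)] .
  obtain M' where M': "adapted M' \<O> (vec.span {cv 1 0}) P" using ex_adapted[OF assms(7,8) inOmega(2)] .
  have inv: "invertible M" "invertible M'" using M M' by (simp_all add: adapted_def)
  interpret N: ovoid_rep w0 "O.nb M" e "TYPE('r)" \<iota> by (rule O.ovoid_rep_nb[OF inv(1)])
  interpret N': ovoid_rep w0 "O.nb M'" e "TYPE('r)" \<iota> by (rule O.ovoid_rep_nb[OF inv(2)])
  have H: "N.Hyp = H" "N'.Hyp = H" using O.Hyp_nb[OF inv(1)] O.Hyp_nb[OF inv(2)] fr(2) by simp_all
  have K: "K = N.inf ` O.KD" "K = N'.inf ` O.dirs (vec.span {cv 1 0})"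
    unfolding assms(9,10) using O.baer_image[OF M inOmega(1) \<phi>] O.baer_image[OF M' inOmega(2) \<phi>] by simp_all
  have Gamma: "Gamma H K = (N.V, N.E)" using N.Gamma_eq H(1) K(1) by simp
  have "regular_graph (Gamma H K)" unfolding Gamma by (rule N.regular[OF N.card_directions])
  moreover have "edge_transitive (Gamma H K)" unfolding Gamma by (rule N.edge_transitive_KD)
  moreover have "\<not> vertex_transitive (Gamma H K)" using N'.not_vertex_transitive_dirs H(2) K(2) by simp
  ultimately have "semisymmetric (Gamma H K)" by (simp add: semisymmetric_def)
  moreover have "real (card (carrier (geometric_Aut (Gamma H K))))
      = real h * real q ^ 5 * (real q - 1) * (sqrt (real q) - 1)"
  proof -
    have q: "q = CARD('r) ^ 2" "CARD('q) = q" using assms(4) card_q by simp_all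
    have ge: "CARD('r) \<ge> 1" "q \<ge> 1" using card_ge_8 by (simp_all add: q(1))
    \<comment> \<open>The factor r^2 in the order of \<open>FH\<close> has become the fifth factor
      q.\<close>
    have "card (carrier (geometric_Aut (Gamma H K))) = (q - 1) * q ^ 4 * (((CARD('r) - 1) * q) * h)"
      unfolding Gamma N.geometric_Aut_structure(2)[OF M] q(2) assms(2) by (simp add: q(1))
    moreover have "sqrt (real q) = real CARD('r)" by (simp add: q(1))
    ultimately show ?thesis using ge by (simp add: of_nat_diff power_numeral_reduce)
  qed
  ultimately show ?thesis using N.geometric_Aut_structure(1)[OF M] unfolding Gamma[symmetric] H(1) by blast
qed

end
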